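(* The bounded adaptation problem is decidable for $\mathcal{E}_d^2$: there is an algorithm which, given an $\mathcal{E}_d^2$ process $P$, a finite set $M$ of $\mathcal{E}_d^2$ processes, a barb $e\in\{a,\overline a\mid a\in\mathcal N\}$ and $k\ge 1$, decides whether no $R\in\mathcal{BC}^M_P$ satisfies $R\Downarrow^k_e$.
   Context: Fix a countably infinite set $\mathcal N$ of names. Prefixes are $\pi ::= a \mid \overline{a} \mid \widetilde{a}\{U\}$. Processes: $P ::= a[P] \mid P\parallel P \mid \sum_{i\in I}\pi_i.P_i \mid\ !\pi.P$ with $I$ finite ($\mathbf 0$ is the empty sum). A process is in $\mathcal E_d^2$ if every update pattern $U$ occurring in it (at any depth) is generated by $U::= P\mid a[U]\mid U\parallel U\mid\bullet$ where $P$ is a hole-free $\mathcal E_d^2$ process (so no hole occurs in the scope of a prefix). $U\{Q\}$ replaces each hole of $U$ not inside an update prefix by $Q$. Semantics (dynamic LTS). Labels $\alpha::= a\mid\overline a\mid a[P]\mid\widetilde a\{U\}\mid\tau$; $\star$ a fresh placeholder. Rules: $a[P]\xrightarrow{a[P]}\star$; $\sum_{i\in I}\pi_i.P_i\xrightarrow{\pi_j}P_j$; $!\pi.P\xrightarrow{\pi}P\parallel!\pi.P$; if $P\xrightarrow\alpha P'$ then $a[P]\xrightarrow\alpha a[P']$; if $P_1\xrightarrow\alpha P_1'$ then $P_1\parallel P_2\xrightarrow\alpha P_1'\parallel P_2$ and $P_2\parallel P_1\xrightarrow\alpha P_2\parallel P_1'$; if $P_1\xrightarrow a P_1'$ and $P_2\xrightarrow{\overline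 a}P_2'$ then $P_1\parallel P_2\xrightarrow\tau P_1'\parallel P_2'$ (and symmetrically); if $P_1\xrightarrow{a[Q]}P_1'$ and $P_2\xrightarrow{\widetilde a\{U\}}P_2'$ then $P_1\parallel P_2\xrightarrow\tau P_1'[U\{Q\}/\star]\parallel P_2'$ (and symmetrically). $P\to P'$ means $P\xrightarrow\tau P'$. $P\downarrow_\alpha$ iff $P\xrightarrow\alpha P'$ for some $P'$; $P\Downarrow^k_\alpha$ iff there exist $Q_1,\dots,Q_k$ with $P\to^*Q_1\to Q_2\to\cdots\to Q_k$ and $Q_i\downarrow_\alpha$ for all $i$. For $M=\{P_1,\dots,P_n\}$, $\mathcal{BC}^M_P=\{P\parallel\prod^{m_1}P_1\parallel\cdots\parallel\prod^{m_n}P_n\mid m_i\in\mathbb N\}$, where $\prod^m Q$ denotes $m$ parallel copies of $Q$. *)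

theory Defs
  imports Main "HOL-Library.Nat_Bijection"
begin

section \<open>Recursive functions and decidability\<close>

datatype recf =
    Zero
  | Succ
  | Proj nat
  | Comp recf "recf list"
  | PrimRec recf recf
  | Mu recf

text \<open>
  \<open>rec_eval f xs y\<close>: the partial recursive function denoted by \<open>f\<close> is defined on \<open>xs\<close> and has
  value \<open>y\<close> there. Recursion and minimisation act on the first argument.
\<close>

inductive rec_eval :: "recf \<Rightarrow> nat list \<Rightarrow> nat \<Rightarrow> bool" where
  "rec_eval Zero xs 0"
| "rec_eval Succ [x] (Suc x)"
| "i < length xs \<Longrightarrow> rec_eval (Proj i) xs (xs ! i)"
| "list_all2 (\<lambda>g y. rec_eval g xs y) gs ys \<Longrightarrow> rec_eval f ys z \<Longrightarrow> rec_eval (Comp f gs) xs z"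
| "rec_eval f xs y \<Longrightarrow> rec_eval (PrimRec f g) (0 # xs) y"
| "rec_eval (PrimRec f g) (n # xs) r \<Longrightarrow> rec_eval g (n # r # xs) y \<Longrightarrow>
     rec_eval (PrimRec f g) (Suc n # xs) y"
| "rec_eval f (n # xs) 0 \<Longrightarrow> (\<And>m. m < n \<Longrightarrow> \<exists>y>0. rec_eval f (m # xs) y) \<Longrightarrow>
     rec_eval (Mu f) xs n"

text \<open>
  Decidability of \<open>Q\<close> for instances from \<open>D\<close>, presented as numbers by \<open>enc\<close>: some recursive
  function halts on (the code of) every instance in \<open>D\<close> with the correct answer. Nothing is
  required on numbers that are not codes of instances in \<open>D\<close>.
\<close>

definition decidable_on :: "('a \<Rightarrow> nat) \<Rightarrow> 'a set \<Rightarrow> ('a \<Rightarrow> bool) \<Rightarrow> bool" where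
  "decidable_on enc D Q \<longleftrightarrow>
     (\<exists>f. \<forall>x\<in>D. \<forall>y. rec_eval f [enc x] y \<longleftrightarrow> y = (if Q x then 1 else 0))"


section \<open>Syntax\<close>

type_synonym name = nat

datatype act = Inp name | Out name

text \<open>
  One type serves for processes, update patterns and the targets of transitions: \<open>Hole\<close> is the hole
  of update patterns, \<open>Star\<close> the placeholder left behind by a located process. A finite indexed sum
  is the list of its branches.
\<close>

datatype proc =
    Loc name proc
  | Par proc proc
  | Sum "(pref \<times> proc) list"
  | Repl pref proc
  | Hole
  | Star
and pref =
    Act act
  | Upd name proc

abbreviation Nil_proc :: proc where
  "Nil_proc \<equiv> Sum []"

text \<open>
  \<open>Ed2\<close> are the processes of $\mathcal{E}_d^2$, \<open>Ed2_pat\<close> its update patterns. Members of \<open>Ed2\<close>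
  contain no \<open>Star\<close>, and a \<open>Hole\<close> only inside an update prefix, where it belongs to the pattern of
  that prefix; this is the sense in which they are hole-free.
\<close>

inductive Ed2 :: "proc \<Rightarrow> bool" and Ed2_pat :: "proc \<Rightarrow> bool" and Ed2_pref :: "pref \<Rightarrow> bool" where
  "Ed2 P \<Longrightarrow> Ed2 (Loc a P)"
| "Ed2 P \<Longrightarrow> Ed2 Q \<Longrightarrow> Ed2 (Par P Q)"
| "(\<And>p P. (p, P) \<in> set bs \<Longrightarrow> Ed2_pref p \<and> Ed2 P) \<Longrightarrow> Ed2 (Sum bs)"
| "Ed2_pref p \<Longrightarrow> Ed2 P \<Longrightarrow> Ed2 (Repl p P)"
| "Ed2_pref (Act e)"
| "Ed2_pat U \<Longrightarrow> Ed2_pref (Upd a U)"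
| "Ed2 P \<Longrightarrow> Ed2_pat P"
| "Ed2_pat U \<Longrightarrow> Ed2_pat (Loc a U)"
| "Ed2_pat U \<Longrightarrow> Ed2_pat V \<Longrightarrow> Ed2_pat (Par U V)"
| "Ed2_pat Hole"

text \<open>\<open>fill Q U\<close> is $U\{Q\}$; \<open>subst_star R P\<close> is $P[R/\star]$.\<close>

primrec fill :: "proc \<Rightarrow> proc \<Rightarrow> proc" where
  "fill Q (Loc a U) = Loc a (fill Q U)"
| "fill Q (Par U V) = Par (fill Q U) (fill Q V)"
| "fill Q (Sum bs) = Sum (map (map_prod (\<lambda>p. p) (fill Q)) bs)"
| "fill Q (Repl p U) = Repl p (fill Q U)"
| "fill Q Hole = Q"
| "fill Q Star = Star"

primrec subst_star :: "proc \<Rightarrow> proc \<Rightarrow> proc" and subst_star_pref :: "proc \<Rightarrow> pref \<Rightarrow> pref" where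
  "subst_star R (Loc a P) = Loc a (subst_star R P)"
| "subst_star R (Par P Q) = Par (subst_star R P) (subst_star R Q)"
| "subst_star R (Sum bs) = Sum (map (map_prod (subst_star_pref R) (subst_star R)) bs)"
| "subst_star R (Repl p P) = Repl (subst_star_pref R p) (subst_star R P)"
| "subst_star R Hole = Hole"
| "subst_star R Star = R"
| "subst_star_pref R (Act e) = Act e"
| "subst_star_pref R (Upd a U) = Upd a (subst_star R U)"


section \<open>Semantics\<close>

datatype label = LAct act | LLoc name proc | LUpd name proc | Tau

fun pref_label :: "pref \<Rightarrow> label" where
  "pref_label (Act e) = LAct e"
| "pref_label (Upd a U) = LUpd a U"

inductive step :: "proc \<Rightarrow> label \<Rightarrow> proc \<Rightarrow> bool" where
  comp: "step (Loc a P) (LLoc a P) Star"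
| sum: "(p, P) \<in> set bs \<Longrightarrow> step (Sum bs) (pref_label p) P"
| repl: "step (Repl p P) (pref_label p) (Par P (Repl p P))"
| loc: "step P l P' \<Longrightarrow> step (Loc a P) l (Loc a P')"
| act1: "step P1 l P1' \<Longrightarrow> step (Par P1 P2) l (Par P1' P2)"
| act2: "step P1 l P1' \<Longrightarrow> step (Par P2 P1) l (Par P2 P1')"
| com1: "step P1 (LAct (Inp a)) P1' \<Longrightarrow> step P2 (LAct (Out a)) P2' \<Longrightarrow>
    step (Par P1 P2) Tau (Par P1' P2')"
| com2: "step P1 (LAct (Inp a)) P1' \<Longrightarrow> step P2 (LAct (Out a)) P2' \<Longrightarrow>
    step (Par P2 P1) Tau (Par P2' P1')"
| upd1: "step P1 (LLoc a Q) P1' \<Longrightarrow> step P2 (LUpd a U) P2' \<Longrightarrow>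
    step (Par P1 P2) Tau (Par (subst_star (fill Q U) P1') P2')"
| upd2: "step P1 (LLoc a Q) P1' \<Longrightarrow> step P2 (LUpd a U) P2' \<Longrightarrow>
    step (Par P2 P1) Tau (Par P2' (subst_star (fill Q U) P1'))"

definition red :: "proc \<Rightarrow> proc \<Rightarrow> bool" where
  "red P P' \<longleftrightarrow> step P Tau P'"

definition barb :: "proc \<Rightarrow> act \<Rightarrow> bool" where
  "barb P e \<longleftrightarrow> (\<exists>P'. step P (LAct e) P')"

definition barbs :: "proc \<Rightarrow> nat \<Rightarrow> act \<Rightarrow> bool" where
  "barbs P k e \<longleftrightarrow>
     (\<exists>Q :: nat \<Rightarrow> proc. red\<^sup>*\<^sup>* P (Q 1) \<and> (\<forall>i. 1 \<le> i \<and> i < k \<longrightarrow> red (Q i) (Q (i + 1))) \<and>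
        (\<forall>i. 1 \<le> i \<and> i \<le> k \<longrightarrow> barb (Q i) e))"


section \<open>The bounded adaptation problem\<close>

fun copies :: "nat \<Rightarrow> proc \<Rightarrow> proc" where
  "copies 0 Q = Nil_proc"
| "copies (Suc 0) Q = Q"
| "copies (Suc (Suc m)) Q = Par Q (copies (Suc m) Q)"

text \<open>
  Parallel composition is not taken modulo associativity or commutativity, so the set $M$ is
  enumerated in all possible orders; the context itself is associated to the left.
\<close>

definition clusters :: "proc set \<Rightarrow> proc \<Rightarrow> proc set" where
  "clusters M P =
     {foldl Par P (map2 copies ms Ps) | ms Ps. set Ps = M \<and> distinct Ps \<and> length ms = length Ps}"

definition bounded_adaptation :: "proc \<Rightarrow> proc set \<Rightarrow> act \<Rightarrow> nat \<Rightarrow> bool" where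
  "bounded_adaptation P M e k \<longleftrightarrow> \<not> (\<exists>R\<in>clusters M P. barbs R k e)"


section \<open>Problem instances as numbers\<close>

fun act_encode :: "act \<Rightarrow> nat" where
  "act_encode (Inp a) = prod_encode (0, a)"
| "act_encode (Out a) = prod_encode (1, a)"

primrec proc_encode :: "proc \<Rightarrow> nat" and pref_encode :: "pref \<Rightarrow> nat" where
  "proc_encode (Loc a P) = prod_encode (0, prod_encode (a, proc_encode P))"
| "proc_encode (Par P Q) = prod_encode (1, prod_encode (proc_encode P, proc_encode Q))"
| "proc_encode (Sum bs) =
     prod_encode (2, list_encode (map prod_encode (map (map_prod pref_encode proc_encode) bs)))"
| "proc_encode (Repl p P) = prod_encode (3, prod_encode (pref_encode p, proc_encode P))"
| "proc_encode Hole = prod_encode (4, 0)"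
| "proc_encode Star = prod_encode (5, 0)"
| "pref_encode (Act e) = prod_encode (0, act_encode e)"
| "pref_encode (Upd a U) = prod_encode (1, prod_encode (a, proc_encode U))"

type_synonym problem_inst = "proc \<times> proc list \<times> act \<times> nat"

text \<open>The finite set $M$ is given as a list of its elements, in any order and with any repetitions.\<close>

fun inst_encode :: "problem_inst \<Rightarrow> nat" where
  "inst_encode (P, Ms, e, k) =
     prod_encode (proc_encode P,
       prod_encode (list_encode (map proc_encode Ms), prod_encode (act_encode e, k)))"

definition Ed2_instances :: "problem_inst set" where
  "Ed2_instances = {(P, Ms, e, k). Ed2 P \<and> (\<forall>Q\<in>set Ms. Ed2 Q) \<and> k \<ge> 1}"

lemma act_encode_eq: "act_encode e = act_encode e' \<longleftrightarrow> e = e'"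
  by (cases e; cases e') auto

lemma proc_encode_eq: "proc_encode P = proc_encode Q \<longleftrightarrow> P = Q"
  and pref_encode_eq: "pref_encode p = pref_encode q \<longleftrightarrow> p = q"
proof (induction P and p arbitrary: Q and q)
  case (Loc a P) then show ?case by (cases Q) auto
next
  case (Par P P') then show ?case by (cases Q) auto
next
  case (Sum bs)
  let ?f = "\<lambda>x. prod_encode (map_prod pref_encode proc_encode x)"
  have inj: "x = y" if "x \<in> set bs" "?f x = ?f y" for x y
  proof -
    obtain p P q Q where xy: "x = (p, P)" "y = (q, Q)" by (cases x; cases y)
    have "pref_encode p = pref_encode q" "proc_encode P = proc_encode Q"
      using that(2) by (simp_all add: xy)
    moreover have "pref_encode p = pref_encode q \<longleftrightarrow> p = q"
      by (rule Sum(1)[OF that(1)]) (simp add: xy)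
    moreover have "proc_encode P = proc_encode Q \<longleftrightarrow> P = Q"
      by (rule Sum(2)[OF that(1)]) (simp add: xy)
    ultimately show ?thesis by (simp add: xy)
  qed
  have "bs = cs" if "map ?f bs = map ?f cs" for cs
    by (rule list.inj_map_strong[OF _ that]) (rule inj)
  then have eq: "map ?f bs = map ?f cs \<longleftrightarrow> bs = cs" for cs
    by blast
  show ?case
  proof (cases Q)
    case (Sum cs)
    then show ?thesis using eq[of cs] by (simp add: list_encode_eq comp_def)
  qed simp_all
next
  case (Repl p P) then show ?case by (cases Q) auto
next
  case Hole show ?case by (cases Q) auto
next
  case Star show ?case by (cases Q) auto
next
  case (Act e) then show ?case by (cases q) (auto simp: act_encode_eq)
next
  case (Upd a U) then show ?case by (cases q) auto
qed

lemma inj_inst_encode: "inj inst_encode"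
proof -
  have "inj proc_encode" by (simp add: inj_def proc_encode_eq)
  then show ?thesis
    by (auto simp: inj_def act_encode_eq proc_encode_eq list_encode_eq inj_map_eq_map)
qed

end

(*
A predicate and its complement that are both semidecidable are decidable, so it suffices to
semidecide whether some cluster R satisfies the k-fold barb, and whether none does.

The first is a matter of enumerating computations. For the second, order processes by embedding of
terms. The order is a strong simulation: whatever a process can do, a larger one can do as well, since
the patterns of the calculus have no hole below a prefix. Hence, for every i, the processes from which
the remaining part of the k-fold barb is reachable form an upward closed set. Only finitely many prefixed
subterms and location names occur in the derivatives of an instance, so by Kruskal's theorem these sets
have finite bases. Mapping a process to the set of those subterms of basis elements which embed into it
is a homomorphism into a finite algebra that separates the upward closed sets from their complements.
Consequently, if no cluster satisfies the k-fold barb, this is witnessed by a finite algebra on which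
abstract transitions cannot reach it. Conversely any finite algebra with that property is a proof of
safety, and whether an algebra has the property is decidable; so these algebras can be searched for.
*)

theory Submission
  imports Defs "HOL-Library.Ramsey"
begin

section \<open>Computability by logical form\<close>

section \<open>Recursive functions\<close>

text \<open>Decidability here means a concrete \<open>recf\<close>, and programming one that handles
  terms, transitions and bases of upward closed sets is the obstacle. So no algorithm is written
  down: a predicate is semidecidable by its logical form, built from equations and inequalities with
  conjunction, disjunction, existential and bounded quantifiers, and inductive closure. This is why
  certificates replace the usual backward search for well-structured systems: that search has to
  compute bases of predecessor sets, while a certificate only has to exist, so Kruskal's theorem may
  be used classically. Two orders cooperate: embedding is the well-quasi-order, and the larger
  \<open>\<sqsubseteq>\<close>, which adds laws of parallel composition, is the simulation.
  Infinitely many clusters become a single starting point by treating their assembly as transitions,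
  and a cluster has to be matched only up to \<open>\<sqsubseteq>\<close>. A location could be
  rewritten by infinitely many patterns, but only those standing in an update prefix find a partner,
  which keeps the tables finite.\<close>

lemma rec_eval_det: "rec_eval f xs y \<Longrightarrow> rec_eval f xs z \<Longrightarrow> y = z"
proof (induction arbitrary: z rule: rec_eval.induct)
  case (1 xs) then show ?case by (cases rule: rec_eval.cases) auto
next
  case (2 x) then show ?case by (cases rule: rec_eval.cases) auto
next
  case (3 i xs) from "3.prems" show ?case by (cases rule: rec_eval.cases) auto
next
  case (4 xs gs ys f z z')
  from "4.prems" obtain ys' where ys': "list_all2 (\<lambda>g y. rec_eval g xs y) gs ys'" "rec_eval f ys' z'"
    by (cases rule: rec_eval.cases) auto
  have "ys = ys'"
    using 4(1) ys'(1) by (auto simp: list_all2_conv_all_nth intro!: nth_equalityI)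
  then show ?case using "4.IH" ys'(2) by blast
next
  case (5 f xs y g)
  from "5.prems" have "rec_eval f xs z" by (cases rule: rec_eval.cases) auto
  then show ?case by (rule "5.IH")
next
  case (6 f g n xs r y)
  from "6.prems" obtain r' where "rec_eval (PrimRec f g) (n # xs) r'" "rec_eval g (n # r' # xs) z"
    by (cases rule: rec_eval.cases) auto
  then show ?case using "6.IH" by blast
next
  case (7 f n xs z)
  from "7.prems" have z: "rec_eval f (z # xs) 0" "\<And>m. m < z \<Longrightarrow> \<exists>y>0. rec_eval f (m # xs) y"
    by (cases rule: rec_eval.cases; auto)+
  show ?case
  proof (cases n z rule: linorder_cases)
    case less
    then show ?thesis using z(2)[of n] "7.IH"(1) by (metis less_numeral_extra(3))
  next
    case greater
    then show ?thesis using z(1) "7.IH"(2)[of z] by (metis less_numeral_extra(3))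
  qed
qed

definition rec_fun :: "nat \<Rightarrow> (nat list \<Rightarrow> nat) \<Rightarrow> bool" where
  "rec_fun n f \<longleftrightarrow> (\<exists>r. \<forall>xs. length xs = n \<longrightarrow> rec_eval r xs (f xs))"

lemma rec_fun_cong: "rec_fun n f \<Longrightarrow> (\<And>xs. length xs = n \<Longrightarrow> f xs = g xs) \<Longrightarrow> rec_fun n g"
  unfolding rec_fun_def by metis

lemma rec_fun_proj: "i < n \<Longrightarrow> rec_fun n (\<lambda>xs. xs ! i)"
  unfolding rec_fun_def by (auto intro!: exI[of _ "Proj i"] rec_eval.intros)

lemma rec_fun_comp:
  assumes "rec_fun (length gs) f" "\<forall>g\<in>set gs. rec_fun n g"
  shows "rec_fun n (\<lambda>xs. f (map (\<lambda>g. g xs) gs))"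
proof -
  obtain r where r: "\<And>ys. length ys = length gs \<Longrightarrow> rec_eval r ys (f ys)"
    using assms(1) unfolding rec_fun_def by blast
  have "\<forall>g\<in>set gs. \<exists>s. \<forall>xs. length xs = n \<longrightarrow> rec_eval s xs (g xs)"
    using assms(2) unfolding rec_fun_def by blast
  then obtain s where s: "\<And>g xs. g \<in> set gs \<Longrightarrow> length xs = n \<Longrightarrow> rec_eval (s g) xs (g xs)"
    by metis
  have "rec_eval (Comp r (map s gs)) xs (f (map (\<lambda>g. g xs) gs))" if "length xs = n" for xs
  proof (rule rec_eval.intros(4))
    show "list_all2 (\<lambda>g y. rec_eval g xs y) (map s gs) (map (\<lambda>g. g xs) gs)"
      using s that by (auto simp: list_all2_conv_all_nth)
  qed (simp add: r)
  then show ?thesis unfolding rec_fun_def by blast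
qed

lemma rec_fun_comp1:
  "rec_fun 1 (\<lambda>xs. f (xs ! 0)) \<Longrightarrow> rec_fun n g \<Longrightarrow> rec_fun n (\<lambda>xs. f (g xs))"
  using rec_fun_comp[of "[g]" "\<lambda>xs. f (xs ! 0)" n] by simp

lemma rec_fun_comp2:
  "rec_fun 2 (\<lambda>xs. f (xs ! 0) (xs ! 1)) \<Longrightarrow> rec_fun n g \<Longrightarrow> rec_fun n h \<Longrightarrow>
    rec_fun n (\<lambda>xs. f (g xs) (h xs))"
  using rec_fun_comp[of "[g, h]" "\<lambda>xs. f (xs ! 0) (xs ! 1)" n] by (simp add: numeral_2_eq_2)

lemma rec_fun_Suc:
  assumes "rec_fun n f" shows "rec_fun n (\<lambda>xs. Suc (f xs))"
proof -
  have "rec_eval Succ xs (Suc (xs ! 0))" if "length xs = 1" for xs :: "nat list"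
    using that by (cases xs) (auto intro: rec_eval.intros)
  then have "rec_fun 1 (\<lambda>xs. Suc (xs ! 0))" unfolding rec_fun_def by blast
  from rec_fun_comp1[OF this assms] show ?thesis .
qed

lemma rec_fun_const: "rec_fun n (\<lambda>xs. c)"
proof (induction c)
  case 0
  show ?case unfolding rec_fun_def by (auto intro!: exI[of _ Zero] rec_eval.intros)
qed (rule rec_fun_Suc)

lemma rec_fun_primrec:
  assumes "rec_fun n f" "rec_fun (Suc (Suc n)) g"
  shows "rec_fun (Suc n) (\<lambda>xs. rec_nat (f (tl xs)) (\<lambda>m r. g (m # r # tl xs)) (hd xs))"
proof -
  obtain r s where r: "\<And>xs. length xs = n \<Longrightarrow> rec_eval r xs (f xs)"
    and s: "\<And>xs. length xs = Suc (Suc n) \<Longrightarrow> rec_eval s xs (g xs)"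
    using assms unfolding rec_fun_def by metis
  have *: "rec_eval (PrimRec r s) (m # ys) (rec_nat (f ys) (\<lambda>m r. g (m # r # ys)) m)"
    if "length ys = n" for m ys
  proof (induction m)
    case 0
    then show ?case using r that by (simp add: rec_eval.intros)
  next
    case (Suc m)
    show ?case using that by (auto intro!: rec_eval.intros(6)[OF Suc] s)
  qed
  have "rec_eval (PrimRec r s) xs (rec_nat (f (tl xs)) (\<lambda>m r. g (m # r # tl xs)) (hd xs))"
    if "length xs = Suc n" for xs
    using that *[of "tl xs" "hd xs"] by (cases xs) auto
  then show ?thesis unfolding rec_fun_def by blast
qed

text \<open>A single parameter suffices for what follows, because pairing will pack several into
  one. The counter is \<open>xs ! 0\<close>, the parameter \<open>xs ! 1\<close>.\<close>

lemma rec_fun_primrec2: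
  assumes "rec_fun 1 (\<lambda>xs. f (xs ! 0))" "rec_fun 3 (\<lambda>xs. g (xs ! 0) (xs ! 1) (xs ! 2))"
  shows "rec_fun 2 (\<lambda>xs. rec_nat (f (xs ! 1)) (\<lambda>m r. g m r (xs ! 1)) (xs ! 0))"
proof -
  have "rec_fun (Suc 1) (\<lambda>xs. rec_nat (f (tl xs ! 0))
      (\<lambda>m r. g ((m # r # tl xs) ! 0) ((m # r # tl xs) ! 1) ((m # r # tl xs) ! 2)) (hd xs))"
    using rec_fun_primrec[of 1 "\<lambda>xs. f (xs ! 0)" "\<lambda>xs. g (xs ! 0) (xs ! 1) (xs ! 2)"] assms
    by (simp add: numeral_3_eq_3)
  then have "rec_fun 2 (\<lambda>xs. rec_nat (f (tl xs ! 0))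
      (\<lambda>m r. g ((m # r # tl xs) ! 0) ((m # r # tl xs) ! 1) ((m # r # tl xs) ! 2)) (hd xs))"
    by (simp only: numeral_2_eq_2 One_nat_def)
  then show ?thesis
  proof (rule rec_fun_cong)
    fix xs :: "nat list" assume "length xs = 2"
    then obtain a b where "xs = [a, b]" by (auto simp: numeral_2_eq_2 length_Suc_conv)
    then show "rec_nat (f (tl xs ! 0)) (\<lambda>m r. g ((m # r # tl xs) ! 0) ((m # r # tl xs) ! 1)
        ((m # r # tl xs) ! 2)) (hd xs) = rec_nat (f (xs ! 1)) (\<lambda>m r. g m r (xs ! 1)) (xs ! 0)"
      by (simp add: numeral_2_eq_2)
  qed
qed

lemma rec_fun_add: "rec_fun 2 (\<lambda>xs. xs ! 0 + xs ! 1)"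
proof (rule rec_fun_cong)
  show "rec_fun 2 (\<lambda>xs. rec_nat (xs ! 1) (\<lambda>m r. Suc r) (xs ! 0))"
    by (rule rec_fun_primrec2[of "\<lambda>x. x" "\<lambda>m r x. Suc r"]) (simp_all add: rec_fun_proj rec_fun_Suc)
  have "rec_nat y (\<lambda>m r. Suc r) x = x + y" for x y :: nat by (induction x) auto
  then show "rec_nat (xs ! 1) (\<lambda>m r. Suc r) (xs ! 0) = xs ! 0 + xs ! 1" for xs by simp
qed

lemma rec_fun_mult: "rec_fun 2 (\<lambda>xs. xs ! 0 * xs ! 1)"
proof (rule rec_fun_cong)
  show "rec_fun 2 (\<lambda>xs. rec_nat 0 (\<lambda>m r. r + xs ! 1) (xs ! 0))"
    by (rule rec_fun_primrec2[of "\<lambda>x. 0" "\<lambda>m r x. r + x"])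
      (simp_all add: rec_fun_proj rec_fun_const rec_fun_comp2[OF rec_fun_add])
  have "rec_nat 0 (\<lambda>m r. r + y) x = x * y" for x y :: nat by (induction x) auto
  then show "rec_nat 0 (\<lambda>m r. r + xs ! 1) (xs ! 0) = xs ! 0 * xs ! 1" for xs by simp
qed

lemma rec_fun_pred: "rec_fun 1 (\<lambda>xs. xs ! 0 - 1)"
proof -
  have "rec_fun 2 (\<lambda>xs. rec_nat 0 (\<lambda>m r. m) (xs ! 0))"
    by (rule rec_fun_primrec2[of "\<lambda>x. 0" "\<lambda>m r x. m"]) (simp_all add: rec_fun_proj rec_fun_const)
  then have "rec_fun 1 (\<lambda>xs. rec_nat 0 (\<lambda>m r. m) (xs ! 0))"
    using rec_fun_comp2[of "\<lambda>x y. rec_nat 0 (\<lambda>m r. m) x" 1 "\<lambda>xs. xs ! 0" "\<lambda>xs. xs ! 0"]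
    by (simp add: rec_fun_proj)
  moreover have "rec_nat 0 (\<lambda>m r. m) x = x - 1" for x :: nat by (cases x) auto
  ultimately show ?thesis by simp
qed

lemma rec_fun_diff: "rec_fun 2 (\<lambda>xs. xs ! 0 - xs ! 1)"
proof -
  have "rec_fun 2 (\<lambda>xs. rec_nat (xs ! 1) (\<lambda>m r. r - 1) (xs ! 0))"
    by (rule rec_fun_primrec2[of "\<lambda>x. x" "\<lambda>m r x. r - 1"])
      (simp_all add: rec_fun_proj rec_fun_comp1[OF rec_fun_pred, simplified])
  moreover have "rec_nat y (\<lambda>m r. r - 1) x = y - x" for x y :: nat by (induction x) auto
  ultimately have "rec_fun 2 (\<lambda>xs. xs ! 1 - xs ! 0)" by simp
  then show ?thesis
    using rec_fun_comp2[of "\<lambda>x y. y - x" 2 "\<lambda>xs. xs ! 1" "\<lambda>xs. xs ! 0"]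
    by (simp add: rec_fun_proj)
qed

lemma rec_fun_triangle: "rec_fun 1 (\<lambda>xs. triangle (xs ! 0))"
proof -
  have "rec_fun 2 (\<lambda>xs. rec_nat 0 (\<lambda>m r. r + Suc m) (xs ! 0))"
    by (rule rec_fun_primrec2[of "\<lambda>x. 0" "\<lambda>m r x. r + Suc m"])
      (intro rec_fun_proj rec_fun_const rec_fun_Suc rec_fun_comp2[OF rec_fun_add]; simp)+
  then have "rec_fun 1 (\<lambda>xs. rec_nat 0 (\<lambda>m r. r + Suc m) (xs ! 0))"
    using rec_fun_comp2[of "\<lambda>x y. rec_nat 0 (\<lambda>m r. r + Suc m) x" 1 "\<lambda>xs. xs ! 0" "\<lambda>xs. xs ! 0"]
    by (simp add: rec_fun_proj)
  moreover have "rec_nat 0 (\<lambda>m r. r + Suc m) x = triangle x" for x :: nat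
    by (induction x) auto
  ultimately show ?thesis by simp
qed

text \<open>Only inputs that admit a zero are covered; on the others the search diverges, and this
  is where partiality enters.\<close>

lemma rec_fun_Mu:
  assumes "rec_fun (Suc n) g"
  shows "\<exists>r. \<forall>xs. length xs = n \<longrightarrow> (\<exists>w. g (w # xs) = 0) \<longrightarrow> rec_eval r xs (LEAST w. g (w # xs) = 0)"
proof -
  obtain r where r: "\<And>xs. length xs = Suc n \<Longrightarrow> rec_eval r xs (g xs)"
    using assms unfolding rec_fun_def by blast
  have "rec_eval (Mu r) xs (LEAST w. g (w # xs) = 0)" if "length xs = n" "\<exists>w. g (w # xs) = 0" for xs
  proof (rule rec_eval.intros(7))
    have "g ((LEAST w. g (w # xs) = 0) # xs) = 0" using that(2) by (rule LeastI_ex)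
    then show "rec_eval r ((LEAST w. g (w # xs) = 0) # xs) 0"
      using r[of "(LEAST w. g (w # xs) = 0) # xs"] that(1) by simp
    fix m assume "m < (LEAST w. g (w # xs) = 0)"
    then have "g (m # xs) \<noteq> 0" by (rule not_less_Least)
    then show "\<exists>y>0. rec_eval r (m # xs) y" using r[of "m # xs"] that(1) by auto
  qed
  then show ?thesis by blast
qed

subsection \<open>Unary functions and pairing\<close>

definition pfst :: "nat \<Rightarrow> nat" where "pfst x = fst (prod_decode x)"
definition psnd :: "nat \<Rightarrow> nat" where "psnd x = snd (prod_decode x)"
abbreviation pr :: "nat \<Rightarrow> nat \<Rightarrow> nat" where "pr x y \<equiv> prod_encode (x, y)"

lemma pfst_pr [simp]: "pfst (pr x y) = x" and psnd_pr [simp]: "psnd (pr x y) = y"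
  by (simp_all add: pfst_def psnd_def)

lemma pr_pfst_psnd [simp]: "pr (pfst x) (psnd x) = x"
  by (simp add: pfst_def psnd_def)

definition recursive :: "(nat \<Rightarrow> nat) \<Rightarrow> bool" where
  "recursive f \<longleftrightarrow> rec_fun 1 (\<lambda>xs. f (xs ! 0))"

lemma recursive_id: "recursive (\<lambda>x. x)"
  unfolding recursive_def by (simp add: rec_fun_proj)

lemma recursive_const: "recursive (\<lambda>x. c)"
  unfolding recursive_def by (rule rec_fun_const)

lemma recursive_comp: "recursive f \<Longrightarrow> recursive g \<Longrightarrow> recursive (\<lambda>x. f (g x))"
  unfolding recursive_def by (rule rec_fun_comp1)

lemma recursive_binop:
  "rec_fun 2 (\<lambda>xs. h (xs ! 0) (xs ! 1)) \<Longrightarrow> recursive f \<Longrightarrow> recursive g \<Longrightarrow> recursive (\<lambda>x. h (f x) (g x))"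
  unfolding recursive_def by (rule rec_fun_comp2)

lemma recursive_Suc: "recursive f \<Longrightarrow> recursive (\<lambda>x. Suc (f x))"
  unfolding recursive_def by (rule rec_fun_Suc)

lemmas recursive_add = recursive_binop[OF rec_fun_add]
lemmas recursive_mult = recursive_binop[OF rec_fun_mult]
lemmas recursive_diff = recursive_binop[OF rec_fun_diff]

lemma recursive_triangle: "recursive f \<Longrightarrow> recursive (\<lambda>x. triangle (f x))"
  unfolding recursive_def by (rule rec_fun_comp1[OF rec_fun_triangle])

lemma rec_fun_pr: "rec_fun 2 (\<lambda>xs. pr (xs ! 0) (xs ! 1))"
  unfolding prod_encode_def by (simp, intro rec_fun_comp2[OF rec_fun_add] rec_fun_proj
    rec_fun_comp1[OF rec_fun_triangle]; simp)

lemmas recursive_pr = recursive_binop[OF rec_fun_pr]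

lemma triangle_mono: "m \<le> n \<Longrightarrow> triangle m \<le> triangle n"
  by (induction n) (auto simp: le_Suc_eq)

text \<open>Cantor pairing puts \<open>x\<close> on diagonal \<open>s = pfst x + psnd x\<close>,
  whose entries run from \<open>triangle s\<close> up to but excluding
  \<open>triangle (Suc s)\<close>. The truncated difference vanishes exactly when
  \<open>x < triangle (Suc s)\<close>, so minimisation finds the diagonal.\<close>

lemma diagonal_index: "(LEAST s. Suc x - triangle (Suc s) = 0) = pfst x + psnd x"
proof (rule Least_equality)
  define m n where "m = pfst x" and "n = psnd x"
  have x: "x = triangle (m + n) + m"
    using pr_pfst_psnd[of x] unfolding m_def n_def prod_encode_def by simp
  show "Suc x - triangle (Suc (pfst x + psnd x)) = 0"
    unfolding m_def[symmetric] n_def[symmetric] by (subst x) simp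
  fix s assume "Suc x - triangle (Suc s) = 0"
  then have "x < triangle (Suc s)" by simp
  moreover have "triangle (Suc s) \<le> x" if "s < m + n"
    using triangle_mono[of "Suc s" "m + n"] that by (subst x) simp
  ultimately show "pfst x + psnd x \<le> s"
    unfolding m_def[symmetric] n_def[symmetric] by linarith
qed

text \<open>Once the diagonal is found, \<open>pfst x\<close> is the offset of \<open>x\<close> on
  it, and \<open>psnd x\<close> is what the offset lacks to the index of the diagonal.\<close>

lemma recursive_pfst_psnd: "recursive pfst" "recursive psnd"
proof -
  let ?s = "\<lambda>x. pfst x + psnd x"
  have "rec_fun (Suc 1) (\<lambda>xs. Suc (xs ! 1) - triangle (Suc (xs ! 0)))"
    by (intro rec_fun_comp2[OF rec_fun_diff] rec_fun_Suc rec_fun_proj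
        rec_fun_comp1[OF rec_fun_triangle]) simp_all
  from rec_fun_Mu[OF this] obtain r where r: "\<And>xs. length xs = 1 \<Longrightarrow>
      (\<exists>w. Suc (xs ! 0) - triangle (Suc w) = 0) \<Longrightarrow> rec_eval r xs (?s (xs ! 0))"
    by (auto simp: diagonal_index[symmetric])
  have ex: "\<exists>w. Suc x - triangle (Suc w) = 0" for x
  proof -
    have "w \<le> triangle w" for w by (induction w) auto
    from this[of x] show ?thesis by (auto intro!: exI[of _ x])
  qed
  have s: "recursive ?s"
    unfolding recursive_def rec_fun_def by (intro exI[of _ r] allI impI r ex)
  have "x - triangle (pfst x + psnd x) = pfst x" for x
    using pr_pfst_psnd[of x] unfolding prod_encode_def by (simp add: algebra_simps)
  with recursive_diff[OF recursive_id recursive_triangle[OF s]] show f: "recursive pfst"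
    by simp
  from recursive_diff[OF s f] show "recursive psnd" by simp
qed

lemmas recursive_pfst = recursive_comp[OF recursive_pfst_psnd(1)]
lemmas recursive_psnd = recursive_comp[OF recursive_pfst_psnd(2)]

lemmas recursive_intros = recursive_const recursive_id recursive_Suc recursive_add recursive_mult
  recursive_diff recursive_pr recursive_pfst recursive_psnd

text \<open>The entire input \<open>x\<close> serves as the parameter of the recursion, packed with
  counter and accumulator into the one argument of \<open>g\<close>.\<close>

lemma recursive_primrec:
  assumes f: "recursive f" and g: "recursive g" and n: "recursive n"
  shows "recursive (\<lambda>x. rec_nat (f x) (\<lambda>m r. g (pr x (pr m r))) (n x))"
proof -
  have "rec_fun 3 (\<lambda>xs. g (pr (xs ! 2) (pr (xs ! 0) (xs ! 1))))"
    by (intro rec_fun_comp1[OF g[unfolded recursive_def]] rec_fun_comp2[OF rec_fun_pr]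
        rec_fun_proj) simp_all
  from rec_fun_primrec2[OF f[unfolded recursive_def] this]
  have "rec_fun 2 (\<lambda>xs. rec_nat (f (xs ! 1)) (\<lambda>m r. g (pr (xs ! 1) (pr m r))) (xs ! 0))" .
  from recursive_binop[OF this n recursive_id] show ?thesis .
qed

lemma recursive_funpow:
  assumes "recursive t" "recursive n" "recursive f"
  shows "recursive (\<lambda>x. (t ^^ n x) (f x))"
proof -
  have "recursive (\<lambda>y. t (psnd (psnd y)))"
    by (intro recursive_comp[OF assms(1)] recursive_intros)
  from recursive_primrec[OF assms(3) this assms(2)]
  have "recursive (\<lambda>x. rec_nat (f x) (\<lambda>m r. t r) (n x))" by simp
  moreover have "rec_nat a (\<lambda>m r. t r) k = (t ^^ k) a" for a k by (induction k) auto
  ultimately show ?thesis by simp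
qed

lemma recursive_sum:
  assumes "recursive g" "recursive n"
  shows "recursive (\<lambda>x. \<Sum>i<n x. g (pr x i))"
proof -
  have "recursive (\<lambda>y. psnd (psnd y) + g (pr (pfst y) (pfst (psnd y))))"
    by (intro recursive_comp[OF assms(1)] recursive_intros)
  from recursive_primrec[OF recursive_const[of 0] this assms(2)]
  have "recursive (\<lambda>x. rec_nat 0 (\<lambda>m r. r + g (pr x m)) (n x))" by simp
  moreover have "rec_nat 0 (\<lambda>m r. r + g (pr x m)) k = (\<Sum>i<k. g (pr x i))" for x k
    by (induction k) auto
  ultimately show ?thesis by simp
qed

subsection \<open>Codes of lists\<close>

text \<open>\<open>list_encode\<close> maps a nonempty list to the successor of a pair and
  \<open>[]\<close> to 0. As 0 also decodes to the pair of zeros, \<open>ltl 0 = 0\<close>, so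
  dropping beyond the end stays at the empty list.\<close>

definition ltl :: "nat \<Rightarrow> nat" where "ltl n = psnd (n - 1)"
definition lnth :: "nat \<Rightarrow> nat \<Rightarrow> nat" where "lnth n i = pfst ((ltl ^^ i) n - 1)"

lemma list_encode_nz: "list_encode xs = 0 \<longleftrightarrow> xs = []"
  by (cases xs) auto

lemma ltl_list_encode: "ltl (list_encode xs) = list_encode (tl xs)"
proof -
  have "prod_decode 0 = (0, 0)"
    using prod_encode_inverse[of "(0, 0)"] by (simp add: prod_encode_def)
  then show ?thesis by (cases xs) (simp_all add: ltl_def psnd_def)
qed

lemma funpow_ltl_list_encode: "(ltl ^^ i) (list_encode xs) = list_encode (drop i xs)"
  by (induction i arbitrary: xs) (simp_all add: funpow_Suc_right ltl_list_encode drop_Suc del: funpow.simps)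

lemma lnth_list_encode: "i < length xs \<Longrightarrow> lnth (list_encode xs) i = xs ! i"
  by (simp add: lnth_def funpow_ltl_list_encode Cons_nth_drop_Suc[symmetric])

lemma length_le_list_encode: "length xs \<le> list_encode xs"
proof (induction xs)
  case (Cons x xs)
  then show ?case using le_prod_encode_2[of "list_encode xs" x] by simp
qed simp

lemma recursive_ltl: "recursive f \<Longrightarrow> recursive (\<lambda>x. ltl (f x))"
  unfolding ltl_def by (intro recursive_intros)

lemma recursive_funpow_ltl: "recursive f \<Longrightarrow> recursive g \<Longrightarrow> recursive (\<lambda>x. (ltl ^^ g x) (f x))"
  by (intro recursive_funpow recursive_ltl recursive_id)

lemma recursive_lnth: "recursive f \<Longrightarrow> recursive g \<Longrightarrow> recursive (\<lambda>x. lnth (f x) (g x))"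
  unfolding lnth_def by (intro recursive_intros recursive_funpow_ltl)

section \<open>Semidecidable predicates on numbers\<close>

text \<open>Projection of the zero set of a total recursive function. Zeros rather than truth values
  turn conjunction into a sum, disjunction into a product, and the search for a witness into
  \<open>Mu\<close>.\<close>

definition semidec_nat :: "(nat \<Rightarrow> bool) \<Rightarrow> bool" where
  "semidec_nat P \<longleftrightarrow> (\<exists>g. recursive g \<and> (\<forall>x. P x \<longleftrightarrow> (\<exists>w. g (pr x w) = 0)))"

lemma semidec_natI: "recursive g \<Longrightarrow> (\<And>x. P x \<longleftrightarrow> (\<exists>w. g (pr x w) = 0)) \<Longrightarrow> semidec_nat P"
  unfolding semidec_nat_def by blast

lemma semidec_natE:
  assumes "semidec_nat P"
  obtains g where "recursive g" "\<And>x. P x \<longleftrightarrow> (\<exists>w. g (pr x w) = 0)"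
  using assms unfolding semidec_nat_def by blast

lemma semidec_nat_comp:
  assumes "semidec_nat P" "recursive f" shows "semidec_nat (\<lambda>x. P (f x))"
proof -
  obtain g where g: "recursive g" "\<And>x. P x \<longleftrightarrow> (\<exists>w. g (pr x w) = 0)"
    using assms(1) by (metis semidec_natE)
  show ?thesis
  proof (rule semidec_natI)
    show "recursive (\<lambda>y. g (pr (f (pfst y)) (psnd y)))"
      by (intro recursive_intros recursive_comp[OF g(1)] recursive_comp[OF assms(2)])
  qed (simp add: g(2))
qed

lemma semidec_nat_conj:
  assumes "semidec_nat P" "semidec_nat Q" shows "semidec_nat (\<lambda>x. P x \<and> Q x)"
proof -
  obtain g h where g: "recursive g" "\<And>x. P x \<longleftrightarrow> (\<exists>w. g (pr x w) = 0)"
    and h: "recursive h" "\<And>x. Q x \<longleftrightarrow> (\<exists>w. h (pr x w) = 0)"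
    using assms by (metis semidec_natE)
  show ?thesis
  proof (rule semidec_natI)
    show "recursive (\<lambda>y. g (pr (pfst y) (pfst (psnd y))) + h (pr (pfst y) (psnd (psnd y))))"
      by (intro recursive_intros recursive_comp[OF g(1)] recursive_comp[OF h(1)])
    show "P x \<and> Q x \<longleftrightarrow> (\<exists>w. g (pr (pfst (pr x w)) (pfst (psnd (pr x w)))) +
        h (pr (pfst (pr x w)) (psnd (psnd (pr x w)))) = 0)" for x
      unfolding g(2) h(2) by (auto, metis pfst_pr psnd_pr)
  qed
qed

lemma semidec_nat_disj:
  assumes "semidec_nat P" "semidec_nat Q" shows "semidec_nat (\<lambda>x. P x \<or> Q x)"
proof -
  obtain g h where g: "recursive g" "\<And>x. P x \<longleftrightarrow> (\<exists>w. g (pr x w) = 0)"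
    and h: "recursive h" "\<And>x. Q x \<longleftrightarrow> (\<exists>w. h (pr x w) = 0)"
    using assms by (metis semidec_natE)
  show ?thesis
    by (rule semidec_natI[of "\<lambda>y. g y * h y"])
      (auto simp: g(2) h(2) intro: recursive_intros g(1) h(1))
qed

lemma semidec_nat_eq:
  assumes "recursive f" "recursive g" shows "semidec_nat (\<lambda>x. f x = g x)"
proof (rule semidec_natI)
  show "recursive (\<lambda>y. (f (pfst y) - g (pfst y)) + (g (pfst y) - f (pfst y)))"
    by (intro recursive_intros recursive_comp[OF assms(1)] recursive_comp[OF assms(2)])
qed auto

lemma semidec_nat_less:
  assumes "recursive f" "recursive g" shows "semidec_nat (\<lambda>x. f x < g x)"
proof (rule semidec_natI)
  show "recursive (\<lambda>y. Suc (f (pfst y)) - g (pfst y))"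
    by (intro recursive_intros recursive_comp[OF assms(1)] recursive_comp[OF assms(2)])
qed auto

lemma semidec_nat_ex:
  assumes "semidec_nat P" shows "semidec_nat (\<lambda>x. \<exists>y. P (pr x y))"
proof -
  obtain g where g: "recursive g" "\<And>x. P x \<longleftrightarrow> (\<exists>w. g (pr x w) = 0)"
    using assms by (metis semidec_natE)
  show ?thesis
  proof (rule semidec_natI)
    show "recursive (\<lambda>y. g (pr (pr (pfst y) (pfst (psnd y))) (psnd (psnd y))))"
      by (intro recursive_intros recursive_comp[OF g(1)])
    show "(\<exists>y. P (pr x y)) \<longleftrightarrow>
        (\<exists>w. g (pr (pr (pfst (pr x w)) (pfst (psnd (pr x w)))) (psnd (psnd (pr x w)))) = 0)" for x
      unfolding g(2) by (auto, metis pfst_pr psnd_pr)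
  qed
qed

text \<open>The witnesses for the single \<open>i\<close> are collected in one list, whose code is
  the witness for all; a sum of natural numbers vanishes only if every summand does. Conversely any
  number may be read as such a list, since \<open>lnth\<close> is total.\<close>

lemma semidec_nat_all_less:
  assumes "semidec_nat P" "recursive n" shows "semidec_nat (\<lambda>x. \<forall>i<n x. P (pr x i))"
proof -
  obtain g where g: "recursive g" "\<And>x. P x \<longleftrightarrow> (\<exists>w. g (pr x w) = 0)"
    using assms by (metis semidec_natE)
  show ?thesis
  proof (rule semidec_natI)
    let ?h = "\<lambda>y. \<Sum>i<n (pfst y). g (pr (pr (pfst y) i) (lnth (psnd y) i))"
    have "recursive (\<lambda>z. g (pr (pr (pfst (pfst z)) (psnd z)) (lnth (psnd (pfst z)) (psnd z))))"
      by (intro recursive_intros recursive_lnth recursive_comp[OF g(1)])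
    from recursive_sum[OF this, of "\<lambda>y. n (pfst y)"] show "recursive ?h"
      by (simp add: recursive_comp[OF assms(2)] recursive_pfst_psnd)
    fix x
    show "(\<forall>i<n x. P (pr x i)) \<longleftrightarrow> (\<exists>w. ?h (pr x w) = 0)"
    proof
      assume "\<forall>i<n x. P (pr x i)"
      then have "\<forall>i. \<exists>w. i < n x \<longrightarrow> g (pr (pr x i) w) = 0" by (auto simp: g(2))
      then obtain w where w: "\<And>i. i < n x \<Longrightarrow> g (pr (pr x i) (w i)) = 0" by metis
      have "?h (pr x (list_encode (map w [0..<n x]))) = 0"
        using w by (auto simp: lnth_list_encode)
      then show "\<exists>w. ?h (pr x w) = 0" ..
    qed (auto simp: g(2))
  qed
qed

text \<open>Both searches run at once: a zero of the product witnesses \<open>P\<close> or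
  \<open>Q\<close>. Since exactly one of them holds, evaluating \<open>g\<close> at the witness
  found tells which.\<close>

lemma decidable_nat:
  assumes "semidec_nat P" "semidec_nat Q"
  shows "\<exists>r. \<forall>x. P x \<noteq> Q x \<longrightarrow> rec_eval r [x] (if P x then 1 else 0)"
proof -
  obtain g h where g: "recursive g" "\<And>x. P x \<longleftrightarrow> (\<exists>w. g (pr x w) = 0)"
    and h: "recursive h" "\<And>x. Q x \<longleftrightarrow> (\<exists>w. h (pr x w) = 0)"
    using assms by (metis semidec_natE)
  have "recursive (\<lambda>y. g y * h y)" by (intro recursive_intros g(1) h(1))
  then have "rec_fun (Suc 1) (\<lambda>xs. g (pr (xs ! 1) (xs ! 0)) * h (pr (xs ! 1) (xs ! 0)))"
    using rec_fun_comp1[of "\<lambda>y. g y * h y" "Suc 1" "\<lambda>xs. pr (xs ! 1) (xs ! 0)"]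
    unfolding recursive_def by (simp add: rec_fun_comp2[OF rec_fun_pr] rec_fun_proj)
  from rec_fun_Mu[OF this] obtain r where "\<forall>xs. length xs = 1 \<longrightarrow>
      (\<exists>w. g (pr ((w # xs) ! 1) ((w # xs) ! 0)) * h (pr ((w # xs) ! 1) ((w # xs) ! 0)) = 0) \<longrightarrow>
      rec_eval r xs (LEAST w. g (pr ((w # xs) ! 1) ((w # xs) ! 0)) * h (pr ((w # xs) ! 1) ((w # xs) ! 0)) = 0)"
    by blast
  note * = this
  have r: "rec_eval r [x] (LEAST w. g (pr x w) * h (pr x w) = 0)"
    if "\<exists>w. g (pr x w) * h (pr x w) = 0" for x
    using spec[OF *, of "[x]"] that by simp
  have "rec_fun 2 (\<lambda>xs. 1 - g (pr (xs ! 0) (xs ! 1)))"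
    by (intro rec_fun_comp2[OF rec_fun_diff] rec_fun_const rec_fun_comp1[OF g(1)[unfolded recursive_def]]
      rec_fun_comp2[OF rec_fun_pr] rec_fun_proj) simp_all
  then obtain s where "\<forall>xs. length xs = 2 \<longrightarrow> rec_eval s xs (1 - g (pr (xs ! 0) (xs ! 1)))"
    unfolding rec_fun_def by blast
  then have s: "rec_eval s [x, w] (1 - g (pr x w))" for x w
    by (auto dest!: spec[of _ "[x, w]"])
  have "rec_eval (Comp s [Proj 0, r]) [x] (if P x then 1 else 0)" if "P x \<noteq> Q x" for x
  proof -
    let ?w = "LEAST w. g (pr x w) * h (pr x w) = 0"
    have ex: "\<exists>w. g (pr x w) * h (pr x w) = 0" using that by (auto simp: g(2) h(2))
    have "g (pr x ?w) * h (pr x ?w) = 0" using ex by (rule LeastI_ex)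
    then have "g (pr x ?w) = 0 \<or> h (pr x ?w) = 0" by (simp only: mult_is_0)
    then have iff: "P x \<longleftrightarrow> g (pr x ?w) = 0" using that g(2)[of x] h(2)[of x] by blast
    have w: "1 - g (pr x ?w) = (if P x then 1 else 0)"
      unfolding iff by (cases "g (pr x ?w)") simp_all
    have p: "rec_eval (Proj 0) [x] x" using rec_eval.intros(3)[of 0 "[x]"] by simp
    show ?thesis
      unfolding w[symmetric] by (rule rec_eval.intros(4)[OF _ s]) (use r[OF ex] p in simp)
  qed
  then show ?thesis by blast
qed

section \<open>Computable functions and semidecidable predicates on coded types\<close>

text \<open>Codes need not exhaust the numbers. Semidecidability of the range is what permits a
  quantifier over the type to be replaced by one over numbers.\<close>

class coded =
  fixes enc :: "'a \<Rightarrow> nat"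
  assumes enc_eq [simp]: "enc x = enc y \<longleftrightarrow> x = y"
    and semidec_range: "semidec_nat (\<lambda>n. \<exists>x. n = enc x)"

definition computable :: "('a::coded \<Rightarrow> 'b::coded) \<Rightarrow> bool" where
  "computable f \<longleftrightarrow> (\<exists>g. recursive g \<and> (\<forall>x. enc (f x) = g (enc x)))"

definition semidec :: "('a::coded \<Rightarrow> bool) \<Rightarrow> bool" where
  "semidec P \<longleftrightarrow> (\<exists>N. semidec_nat N \<and> (\<forall>x. P x \<longleftrightarrow> N (enc x)))"

text \<open>With these two collections semidecidability becomes syntax-directed:
  \<open>semi_intros\<close> takes the formula apart, \<open>comp_intros\<close> the terms in
  it.\<close>

named_theorems comp_intros
named_theorems semi_intros

lemma computableI: "recursive g \<Longrightarrow> (\<And>x. enc (f x) = g (enc x)) \<Longrightarrow> computable f"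
  unfolding computable_def by blast

lemma semidecI: "semidec_nat N \<Longrightarrow> (\<And>x. P x \<longleftrightarrow> N (enc x)) \<Longrightarrow> semidec P"
  unfolding semidec_def by blast

instantiation nat :: coded
begin
definition "enc (n::nat) = n"
instance
proof
  show "semidec_nat (\<lambda>n. \<exists>x::nat. n = enc x)"
    using semidec_nat_eq[OF recursive_id recursive_id] by (simp add: enc_nat_def)
qed (simp add: enc_nat_def)
end

instantiation prod :: (coded, coded) coded
begin
definition "enc p = pr (enc (fst p)) (enc (snd p))"
instance
proof
  have "(\<exists>x::'a. pfst n = enc x) \<and> (\<exists>x::'b. psnd n = enc x) \<longleftrightarrow> (\<exists>x::'a \<times> 'b. n = enc x)" for n
  proof
    assume "(\<exists>x::'a. pfst n = enc x) \<and> (\<exists>x::'b. psnd n = enc x)"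
    then obtain a :: 'a and b :: 'b where "pfst n = enc a" "psnd n = enc b" by blast
    then have "n = enc (a, b)" unfolding enc_prod_def using pr_pfst_psnd[of n] by simp
    then show "\<exists>x::'a \<times> 'b. n = enc x" ..
  qed (auto simp: enc_prod_def)
  moreover have "semidec_nat (\<lambda>n. (\<exists>x::'a. pfst n = enc x) \<and> (\<exists>x::'b. psnd n = enc x))"
    by (intro semidec_nat_conj semidec_nat_comp[OF semidec_range] recursive_pfst_psnd)
  ultimately show "semidec_nat (\<lambda>n. \<exists>x::'a \<times> 'b. n = enc x)" by simp
qed (auto simp: enc_prod_def prod_eq_iff)
end

instantiation list :: (coded) coded
begin
definition "enc xs = list_encode (map enc xs)"
instance
proof
  show "enc x = enc y \<longleftrightarrow> x = y" for x y :: "'a list"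
    by (simp add: enc_list_def list_encode_eq inj_map_eq_map inj_def)
  \<comment> \<open>A list is no longer than its code, so \<open>i<n\<close> reaches every position;
    at positions beyond the end the remaining tail is 0.\<close>
  let ?P = "\<lambda>n. \<forall>i<n. (ltl ^^ i) n = 0 \<or> (\<exists>x::'a. lnth n i = enc x)"
  have "semidec_nat (\<lambda>y. (ltl ^^ psnd y) (pfst y) = 0 \<or> (\<exists>x::'a. lnth (pfst y) (psnd y) = enc x))"
    by (intro semidec_nat_disj semidec_nat_eq recursive_const recursive_funpow_ltl
        semidec_nat_comp[OF semidec_range] recursive_lnth recursive_pfst_psnd)
  from semidec_nat_all_less[OF this recursive_id] have "semidec_nat ?P" by simp
  moreover have "?P n \<longleftrightarrow> (\<exists>xs::'a list. n = enc xs)" for n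
  proof
    define ns where "ns = list_decode n"
    have n: "n = list_encode ns" by (simp add: ns_def)
    assume P: "?P n"
    have "\<exists>x::'a. ns ! i = enc x" if "i < length ns" for i
    proof -
      have "i < n" using that length_le_list_encode[of ns] unfolding n by linarith
      moreover have "(ltl ^^ i) n \<noteq> 0"
        using that unfolding n by (simp add: funpow_ltl_list_encode list_encode_nz)
      ultimately show ?thesis using P that by (metis n lnth_list_encode)
    qed
    then obtain f :: "nat \<Rightarrow> 'a" where "\<And>i. i < length ns \<Longrightarrow> ns ! i = enc (f i)" by metis
    then have "ns = map enc (map f [0..<length ns])" by (auto intro: nth_equalityI)
    then show "\<exists>xs::'a list. n = enc xs" unfolding n enc_list_def by metis
  next
    assume "\<exists>xs::'a list. n = enc xs"
    then obtain xs :: "'a list" where n: "n = list_encode (map enc xs)" by (auto simp: enc_list_def)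
    show "?P n"
    proof (intro allI impI)
      fix i assume "i < n"
      show "(ltl ^^ i) n = 0 \<or> (\<exists>x::'a. lnth n i = enc x)"
        unfolding n by (cases "i < length xs") (auto simp: funpow_ltl_list_encode lnth_list_encode)
    qed
  qed
  ultimately show "semidec_nat (\<lambda>n. \<exists>x::'a list. n = enc x)" by simp
qed
end

lemma enc_Pair: "enc (x, y) = pr (enc x) (enc y)"
  by (simp add: enc_prod_def)

text \<open>Reduces the computability of a constructor to arithmetic on its code.\<close>

lemma computable_enc: "computable f \<longleftrightarrow> computable (\<lambda>x. enc (f x))"
  by (simp add: computable_def enc_nat_def)

lemma computable_const [comp_intros]: "computable (\<lambda>x. c)"
  by (rule computableI[OF recursive_const]) simp

lemma computable_id [comp_intros]: "computable (\<lambda>x. x)"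
  by (rule computableI[OF recursive_id]) simp

lemma computable_compose: "computable f \<Longrightarrow> computable g \<Longrightarrow> computable (\<lambda>x. f (g x))"
  unfolding computable_def by (metis recursive_comp)

lemma computable_enc' [comp_intros]: "computable f \<Longrightarrow> computable (\<lambda>x. enc (f x))"
  using computable_enc by blast

lemma computable_pr [comp_intros]:
  assumes "computable f" "computable g" shows "computable (\<lambda>x. pr (f x) (g x))"
proof -
  obtain f' g' where "recursive f'" "\<And>x. enc (f x) = f' (enc x)" "recursive g'" "\<And>x. enc (g x) = g' (enc x)"
    using assms unfolding computable_def by metis
  then show ?thesis by (intro computableI[OF recursive_pr]) (auto simp: enc_nat_def)
qed

lemma computable_Pair [comp_intros]:
  "computable f \<Longrightarrow> computable g \<Longrightarrow> computable (\<lambda>x. (f x, g x))"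
  by (subst computable_enc) (simp add: enc_Pair comp_intros)

lemma computable_fst [comp_intros]:
  assumes "computable f" shows "computable (\<lambda>x. fst (f x))"
proof -
  obtain g where g: "recursive g" "\<And>x. enc (f x) = g (enc x)"
    using assms unfolding computable_def by blast
  show ?thesis
    by (rule computableI[OF recursive_pfst[OF g(1)]]) (simp add: g(2)[symmetric] enc_prod_def)
qed

lemma computable_snd [comp_intros]:
  assumes "computable f" shows "computable (\<lambda>x. snd (f x))"
proof -
  obtain g where g: "recursive g" "\<And>x. enc (f x) = g (enc x)"
    using assms unfolding computable_def by blast
  show ?thesis
    by (rule computableI[OF recursive_psnd[OF g(1)]]) (simp add: g(2)[symmetric] enc_prod_def)
qed

lemma computable_Suc [comp_intros]:
  assumes "computable f" shows "computable (\<lambda>x. Suc (f x))"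
proof -
  obtain g where g: "recursive g" "\<And>x. enc (f x) = g (enc x)"
    using assms unfolding computable_def by blast
  show ?thesis
    by (rule computableI[OF recursive_Suc[OF g(1)]]) (simp add: g(2)[symmetric] enc_nat_def)
qed

lemma computable_Cons [comp_intros]:
  assumes "computable f" "computable g" shows "computable (\<lambda>x. f x # g x)"
proof -
  have "computable (\<lambda>x. Suc (pr (enc (f x)) (enc (g x))))" by (intro comp_intros assms)
  then show ?thesis by (subst computable_enc) (simp add: enc_list_def)
qed

lemma enc_drop: "enc (drop i xs) = (ltl ^^ i) (enc xs)"
  by (simp add: enc_list_def funpow_ltl_list_encode drop_map)

lemma computable_drop [comp_intros]:
  assumes "computable n" "computable f" shows "computable (\<lambda>x. drop (n x) (f x))"
proof -
  obtain f' n' where "recursive f'" "\<And>x. enc (f x) = f' (enc x)" "recursive n'" "\<And>x. enc (n x) = n' (enc x)"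
    using assms unfolding computable_def by metis
  then show ?thesis by (intro computableI[OF recursive_funpow_ltl]) (auto simp: enc_drop enc_nat_def)
qed

text \<open>A finite function stored as a list indexed by the codes of its keys. It is thereby an
  object of a coded type, over which an existential quantifier can search; positions outside the
  list read as 0.\<close>

definition lookup :: "nat list \<Rightarrow> 'k::coded \<Rightarrow> nat" where
  "lookup t k = (if enc k < length t then t ! enc k else 0)"

lemma enc_nat_list: "enc (t :: nat list) = list_encode t"
proof -
  have "map enc t = t" by (induction t) (auto simp: enc_nat_def)
  then show ?thesis by (simp add: enc_list_def)
qed

lemma computable_lookup [comp_intros]:
  assumes "computable t" "computable k" shows "computable (\<lambda>x. lookup (t x) (k x))"
proof -
  obtain f' n' where f: "recursive f'" "\<And>x. enc (t x) = f' (enc x)"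
    and n: "recursive n'" "\<And>x. enc (k x) = n' (enc x)"
    using assms unfolding computable_def by metis
  have "lnth 0 0 = 0"
    using prod_encode_inverse[of "(0, 0)"] by (simp add: lnth_def pfst_def prod_encode_def)
  then have "lookup t k = lnth (list_encode t) (enc k)" for t and k :: "'c::coded"
    by (auto simp: lookup_def lnth_list_encode, simp add: lnth_def funpow_ltl_list_encode)
  then show ?thesis
    by (intro computableI[OF recursive_lnth[OF f(1) n(1)]])
      (simp add: f(2)[symmetric] n(2)[symmetric] enc_nat_list, simp add: enc_nat_def)
qed

lemma lookup_exists:
  fixes f :: "'k::coded \<Rightarrow> nat"
  assumes "finite K" shows "\<exists>t. \<forall>k\<in>K. lookup t k = f k"
proof -
  obtain N where N: "\<And>k. k \<in> K \<Longrightarrow> enc k < N"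
    using finite_imageI[OF assms, of enc] by (metis finite_nat_set_iff_bounded imageI)
  have "inj (enc :: 'k \<Rightarrow> nat)" by (simp add: inj_def)
  then have "\<forall>k\<in>K. lookup (map (\<lambda>i. f (inv enc i)) [0..<N]) k = f k"
    using N by (simp add: lookup_def)
  then show ?thesis by blast
qed

lemma semidec_comp:
  assumes "semidec P" "computable f" shows "semidec (\<lambda>x. P (f x))"
proof -
  obtain N where N: "semidec_nat N" "\<And>x. P x \<longleftrightarrow> N (enc x)"
    using assms(1) unfolding semidec_def by blast
  obtain g where g: "recursive g" "\<And>x. enc (f x) = g (enc x)"
    using assms(2) unfolding computable_def by blast
  show ?thesis by (rule semidecI[OF semidec_nat_comp[OF N(1) g(1)]]) (simp add: N(2) g(2))
qed

lemma semidec_conj [semi_intros]: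
  assumes "semidec P" "semidec Q" shows "semidec (\<lambda>x. P x \<and> Q x)"
proof -
  obtain M where M: "semidec_nat M" "\<And>x. P x \<longleftrightarrow> M (enc x)" using assms(1) unfolding semidec_def by blast
  obtain N where N: "semidec_nat N" "\<And>x. Q x \<longleftrightarrow> N (enc x)" using assms(2) unfolding semidec_def by blast
  show ?thesis by (rule semidecI[OF semidec_nat_conj[OF M(1) N(1)]]) (simp add: M(2) N(2))
qed

lemma semidec_disj [semi_intros]:
  assumes "semidec P" "semidec Q" shows "semidec (\<lambda>x. P x \<or> Q x)"
proof -
  obtain M where M: "semidec_nat M" "\<And>x. P x \<longleftrightarrow> M (enc x)" using assms(1) unfolding semidec_def by blast
  obtain N where N: "semidec_nat N" "\<And>x. Q x \<longleftrightarrow> N (enc x)" using assms(2) unfolding semidec_def by blast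
  show ?thesis by (rule semidecI[OF semidec_nat_disj[OF M(1) N(1)]]) (simp add: M(2) N(2))
qed

text \<open>The premise must have a semidecidable negation. In the certificates premises are
  equations between table entries and 1, whose negations are handled by
  \<open>semidec_neq\<close>.\<close>

lemma semidec_imp [semi_intros]: "semidec (\<lambda>x. \<not> P x) \<Longrightarrow> semidec Q \<Longrightarrow> semidec (\<lambda>x. P x \<longrightarrow> Q x)"
  using semidec_disj[of "\<lambda>x. \<not> P x" Q] by (simp only: imp_conv_disj)

lemma semidec_eq [semi_intros]:
  assumes "computable f" "computable g" shows "semidec (\<lambda>x. f x = g x)"
proof -
  obtain f' where f: "recursive f'" "\<And>x. enc (f x) = f' (enc x)"
    using assms(1) unfolding computable_def by blast
  obtain g' where g: "recursive g'" "\<And>x. enc (g x) = g' (enc x)"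
    using assms(2) unfolding computable_def by blast
  show ?thesis by (rule semidecI[OF semidec_nat_eq[OF f(1) g(1)]]) (simp add: f(2)[symmetric] g(2)[symmetric])
qed

lemma semidec_less [semi_intros]:
  fixes f g :: "'a::coded \<Rightarrow> nat"
  assumes "computable f" "computable g" shows "semidec (\<lambda>x. f x < g x)"
proof -
  obtain f' where f: "recursive f'" "\<And>x. enc (f x) = f' (enc x)"
    using assms(1) unfolding computable_def by blast
  obtain g' where g: "recursive g'" "\<And>x. enc (g x) = g' (enc x)"
    using assms(2) unfolding computable_def by blast
  show ?thesis
    by (rule semidecI[OF semidec_nat_less[OF f(1) g(1)]])
      (simp add: f(2)[symmetric] g(2)[symmetric] enc_nat_def)
qed

lemma semidec_neq [semi_intros]:
  assumes "computable f" "computable g" shows "semidec (\<lambda>x. f x \<noteq> g x)"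
proof -
  have "semidec (\<lambda>x. enc (f x) < enc (g x) \<or> enc (g x) < enc (f x))"
    by (intro semi_intros comp_intros assms)
  moreover have "enc a < enc b \<or> enc b < enc a \<longleftrightarrow> a \<noteq> b" for a b :: 'b
    by (metis enc_eq linorder_neq_iff)
  ultimately show ?thesis by simp
qed

lemma semidec_ex [semi_intros]:
  fixes P :: "'a::coded \<Rightarrow> 'b::coded \<Rightarrow> bool"
  assumes "semidec (\<lambda>z. P (fst z) (snd z))" shows "semidec (\<lambda>x. \<exists>y. P x y)"
proof -
  obtain N where N: "semidec_nat N" "\<And>z. P (fst z) (snd z) \<longleftrightarrow> N (enc z)"
    using assms unfolding semidec_def by blast
  have "semidec_nat (\<lambda>n. N n \<and> (\<exists>y::'b. psnd n = enc y))"
    by (intro semidec_nat_conj N semidec_nat_comp[OF semidec_range] recursive_pfst_psnd)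
  from semidec_nat_ex[OF this] show ?thesis
  proof (rule semidecI)
    show "(\<exists>y. P x y) \<longleftrightarrow> (\<exists>n. N (pr (enc x) n) \<and> (\<exists>y::'b. psnd (pr (enc x) n) = enc y))" for x
      using N(2)[of "(x, _)"] by (auto simp: enc_Pair)
  qed
qed

lemma semidec_all_less [semi_intros]:
  fixes n :: "'a::coded \<Rightarrow> nat"
  assumes "semidec (\<lambda>z. P (fst z) (snd z))" "computable n"
  shows "semidec (\<lambda>x. \<forall>i<n x. P x i)"
proof -
  obtain N where N: "semidec_nat N" "\<And>z. P (fst z) (snd z) \<longleftrightarrow> N (enc z)"
    using assms(1) unfolding semidec_def by blast
  obtain n' where n: "recursive n'" "\<And>x. enc (n x) = n' (enc x)"
    using assms(2) unfolding computable_def by blast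
  show ?thesis
    by (rule semidecI[OF semidec_nat_all_less[OF N(1) n(1)]])
      (use N(2)[of "(_, _)"] in \<open>simp add: n(2)[symmetric] enc_Pair enc_nat_def\<close>)
qed

text \<open>For lists of arbitrary coded type only \<open>drop\<close> and \<open>Cons\<close> have
  been shown computable, so an element is described as the head of a suffix.\<close>

lemma semidec_member_aux:
  fixes f :: "'a::coded \<Rightarrow> 'b::coded list"
  shows "(\<exists>i y M. drop i xs = y # M \<and> P y) \<longleftrightarrow> (\<exists>y\<in>set xs. P y)"
proof
  assume "\<exists>i y M. drop i xs = y # M \<and> P y"
  then show "\<exists>y\<in>set xs. P y" by (metis in_set_dropD list.set_intros(1))
next
  assume "\<exists>y\<in>set xs. P y"
  then show "\<exists>i y M. drop i xs = y # M \<and> P y" by (metis Cons_nth_drop_Suc in_set_conv_nth)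
qed

lemma semidec_bex [semi_intros]:
  fixes f :: "'a::coded \<Rightarrow> 'b::coded list"
  assumes "semidec (\<lambda>z. P (fst z) (snd z))" "computable f"
  shows "semidec (\<lambda>x. \<exists>y\<in>set (f x). P x y)"
proof -
  have "semidec (\<lambda>x. \<exists>i y M. drop i (f x) = y # M \<and> P x y)"
    by (intro semi_intros comp_intros computable_compose[OF assms(2)]
        semidec_comp[OF assms(1), of "\<lambda>x. (fst (fst (fst x)), snd (fst x))", simplified])
  then show ?thesis by (simp only: semidec_member_aux)
qed

lemma semidec_member [semi_intros]:
  fixes f :: "'a::coded \<Rightarrow> 'b::coded"
  assumes "computable f" "computable g" shows "semidec (\<lambda>x. f x \<in> set (g x))"
proof -
  have "semidec (\<lambda>x. \<exists>y\<in>set (g x). y = f x)"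
    by (intro semi_intros comp_intros computable_compose[OF assms(1)] assms(2))
  then show ?thesis by simp
qed

text \<open>A bound \<open>n\<close> on the length is guessed and confirmed by
  \<open>drop n (f x) = []\<close>; the quantifier over elements then becomes a bounded one over
  suffixes.\<close>

lemma semidec_ball [semi_intros]:
  fixes f :: "'a::coded \<Rightarrow> 'b::coded list"
  assumes "semidec (\<lambda>z. P (fst z) (snd z))" "computable f"
  shows "semidec (\<lambda>x. \<forall>y\<in>set (f x). P x y)"
proof -
  have "semidec (\<lambda>x. \<exists>n. drop n (f x) = [] \<and> (\<forall>i<n. drop i (f x) = [] \<or>
      (\<exists>y M. drop i (f x) = y # M \<and> P x y)))"
    by (intro semi_intros comp_intros computable_compose[OF assms(2)]
        semidec_comp[OF assms(1), of "\<lambda>x. (fst (fst (fst (fst x))), snd (fst x))", simplified])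
  moreover have "(\<exists>n. drop n xs = [] \<and> (\<forall>i<n. drop i xs = [] \<or> (\<exists>y M. drop i xs = y # M \<and> Q y)))
      \<longleftrightarrow> (\<forall>y\<in>set xs. Q y)" for xs :: "'b list" and Q
  proof
    assume "\<exists>n. drop n xs = [] \<and> (\<forall>i<n. drop i xs = [] \<or> (\<exists>y M. drop i xs = y # M \<and> Q y))"
    then obtain n where n: "length xs \<le> n"
      "\<And>i. i < n \<Longrightarrow> drop i xs = [] \<or> (\<exists>y M. drop i xs = y # M \<and> Q y)" by auto
    have "Q (xs ! i)" if "i < length xs" for i
      using n(2)[of i] n(1) that by (auto simp: Cons_nth_drop_Suc[symmetric])
    then show "\<forall>y\<in>set xs. Q y" by (metis in_set_conv_nth)
  next
    assume "\<forall>y\<in>set xs. Q y"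
    then show "\<exists>n. drop n xs = [] \<and> (\<forall>i<n. drop i xs = [] \<or> (\<exists>y M. drop i xs = y # M \<and> Q y))"
      by (intro exI[of _ "length xs"]) (auto simp: Cons_nth_drop_Suc[symmetric])
  qed
  ultimately show ?thesis by simp
qed

section \<open>Inductive closure\<close>

text \<open>A common format for inductive definitions: codes of processes, filling of patterns,
  transitions and runs are all instances, so their semidecidability rests on one argument.\<close>

inductive derivable :: "('a list \<Rightarrow> 'a \<Rightarrow> bool) \<Rightarrow> 'a \<Rightarrow> bool" for R where
  derivableI: "R ps c \<Longrightarrow> (\<And>p. p \<in> set ps \<Longrightarrow> derivable R p) \<Longrightarrow> derivable R c"

text \<open>A proof linearised with the latest conclusion in front and its premises further back: a
  finite object that can be searched for.\<close>

inductive derivation :: "('a list \<Rightarrow> 'a \<Rightarrow> bool) \<Rightarrow> 'a list \<Rightarrow> bool" for R where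
  "derivation R []"
| "derivation R M \<Longrightarrow> R ps c \<Longrightarrow> set ps \<subseteq> set M \<Longrightarrow> derivation R (c # M)"

lemma derivation_append: "derivation R L \<Longrightarrow> derivation R M \<Longrightarrow> derivation R (L @ M)"
proof (induction rule: derivation.induct)
  case (2 L ps c)
  then show ?case using derivation.intros(2)[of R "L @ M" ps c] by auto
qed simp

lemma derivable_derivation: "derivable R c \<Longrightarrow> \<exists>M. derivation R (c # M)"
proof (induction rule: derivable.induct)
  case (derivableI ps c)
  have "\<exists>M. derivation R M \<and> set qs \<subseteq> set M" if "set qs \<subseteq> set ps" for qs
    using that
  proof (induction qs)
    case Nil
    show ?case by (auto intro: derivation.intros)
  next
    case (Cons q qs)
    then obtain M N where "derivation R M" "set qs \<subseteq> set M" "derivation R (q # N)"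
      using derivableI(3) by (metis insert_subset list.set(2))
    then show ?case by (intro exI[of _ "(q # N) @ M"]) (auto dest: derivation_append)
  qed
  then show ?case using derivation.intros(2)[of R _ ps c] derivableI(1) by blast
qed

lemma derivation_derivable: "derivation R L \<Longrightarrow> c \<in> set L \<Longrightarrow> derivable R c"
  by (induction arbitrary: c rule: derivation.induct) (auto intro: derivableI)

text \<open>Eliminates the recursion in favour of a condition on suffixes to which the closure rules
  for semidecidable predicates apply.\<close>

lemma derivation_iff: "derivation R L \<longleftrightarrow> (\<exists>n. drop n L = [] \<and>
    (\<forall>i<n. \<exists>c M ps. drop i L = c # M \<and> R ps c \<and> (\<forall>p\<in>set ps. p \<in> set M)))"
proof
  assume "derivation R L"
  then have "\<forall>i<length L. \<exists>c M ps. drop i L = c # M \<and> R ps c \<and> (\<forall>p\<in>set ps. p \<in> set M)"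
  proof (induction rule: derivation.induct)
    case (2 M ps c)
    show ?case
    proof (intro allI impI)
      fix i assume "i < length (c # M)"
      then show "\<exists>c' M' ps. drop i (c # M) = c' # M' \<and> R ps c' \<and> (\<forall>p\<in>set ps. p \<in> set M')"
        using 2 by (cases i) auto
    qed
  qed simp
  then show "\<exists>n. drop n L = [] \<and> (\<forall>i<n. \<exists>c M ps. drop i L = c # M \<and> R ps c \<and> (\<forall>p\<in>set ps. p \<in> set M))"
    by (intro exI[of _ "length L"]) simp
next
  assume "\<exists>n. drop n L = [] \<and> (\<forall>i<n. \<exists>c M ps. drop i L = c # M \<and> R ps c \<and> (\<forall>p\<in>set ps. p \<in> set M))"
  then obtain n where n: "drop n L = []"
    "\<And>i. i < n \<Longrightarrow> \<exists>c M ps. drop i L = c # M \<and> R ps c \<and> (\<forall>p\<in>set ps. p \<in> set M)" by blast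
  have "derivation R (drop i L)" if "i \<le> n" for i
    using that
  proof (induction rule: inc_induct)
    case base
    show ?case using n(1) by (simp add: derivation.intros)
  next
    case (step i)
    then obtain c M ps where "drop i L = c # M" "R ps c" "\<forall>p\<in>set ps. p \<in> set M" using n(2) by blast
    moreover have "drop (Suc i) L = M"
      using calculation(1) by (metis drop_Suc tl_drop list.sel(3))
    ultimately show ?case using step by (auto intro: derivation.intros)
  qed
  from this[of 0] show "derivation R L" by simp
qed

lemma semidec_derivable:
  fixes R :: "'e::coded \<Rightarrow> 'a::coded list \<Rightarrow> 'a \<Rightarrow> bool"
  assumes R: "semidec (\<lambda>z. R (fst z) (fst (snd z)) (snd (snd z)))"
  shows "semidec (\<lambda>z. derivable (R (fst z)) (snd z))"
proof -
  have R': "semidec (\<lambda>z. R (f z) (g z) (h z))" if "computable f" "computable g" "computable h"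
    for f :: "'z::coded \<Rightarrow> 'e" and g h
    using semidec_comp[OF R, of "\<lambda>z. (f z, g z, h z)"] that by (simp add: comp_intros)
  have "semidec (\<lambda>z. \<exists>L M. L = snd z # M \<and> (\<exists>n. drop n L = [] \<and>
    (\<forall>i<n. \<exists>c M ps. drop i L = c # M \<and> R (fst z) ps c \<and> (\<forall>p\<in>set ps. p \<in> set M))))"
    by (intro semi_intros comp_intros R')
  moreover have "derivable (R e) c \<longleftrightarrow> (\<exists>L M. L = c # M \<and> derivation (R e) L)" for e c
    using derivable_derivation[of "R e" c] derivation_derivable[of "R e" "c # _" c] by auto
  ultimately show ?thesis by (simp add: derivation_iff)
qed

section \<open>Codes of the syntax\<close>

section \<open>Codes of processes\<close>

lemma semidec_nat_iff: "semidec P \<longleftrightarrow> semidec_nat P"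
  by (simp add: semidec_def enc_nat_def flip: fun_eq_iff)

instantiation act :: coded
begin
definition "enc e = act_encode e"
instance
proof
  show "enc x = enc y \<longleftrightarrow> x = y" for x y :: act by (simp add: enc_act_def act_encode_eq)
  have "semidec (\<lambda>n. \<exists>a. n = pr 0 a \<or> n = pr 1 a)"
    by (intro semi_intros comp_intros)
  moreover have "(\<exists>a. n = pr 0 a \<or> n = pr 1 a) \<longleftrightarrow> (\<exists>e::act. n = enc e)" for n
    unfolding enc_act_def by (metis act.exhaust act_encode.simps)
  ultimately show "semidec_nat (\<lambda>n. \<exists>e::act. n = enc e)" by (simp add: semidec_nat_iff)
qed
end

text \<open>Processes and prefixes are mutually recursive; tags 0 and 1 merge their codes into one
  inductive closure. Its purpose is to semidecide which numbers are codes.\<close>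

definition proc_code_rule :: "(nat \<times> nat) list \<Rightarrow> nat \<times> nat \<Rightarrow> bool" where
  "proc_code_rule ps c \<longleftrightarrow>
     (\<exists>a q. c = (0, pr 0 (pr a q)) \<and> (0, q) \<in> set ps) \<or>
     (\<exists>p q. c = (0, pr 1 (pr p q)) \<and> (0, p) \<in> set ps \<and> (0, q) \<in> set ps) \<or>
     (\<exists>bs :: nat list. c = (0, pr 2 (enc bs)) \<and>
        (\<forall>b\<in>set bs. \<exists>p q. b = pr p q \<and> (1, p) \<in> set ps \<and> (0, q) \<in> set ps)) \<or>
     (\<exists>p q. c = (0, pr 3 (pr p q)) \<and> (1, p) \<in> set ps \<and> (0, q) \<in> set ps) \<or>
     c = (0, pr 4 0) \<or> c = (0, pr 5 0) \<or>
     (\<exists>e :: act. c = (1, pr 0 (enc e))) \<or>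
     (\<exists>a q. c = (1, pr 1 (pr a q)) \<and> (0, q) \<in> set ps)"

lemma semidec_proc_code: "semidec (\<lambda>c. derivable proc_code_rule c)"
proof -
  \<comment> \<open>The first component is a dummy parameter, since \<open>semidec_derivable\<close>
    speaks of families of rules.\<close>
  have "semidec (\<lambda>z :: nat \<times> (nat \<times> nat) list \<times> (nat \<times> nat). proc_code_rule (fst (snd z)) (snd (snd z)))"
    unfolding proc_code_rule_def by (intro semi_intros comp_intros)
  then have "semidec (\<lambda>z :: nat \<times> nat \<times> nat. derivable proc_code_rule (snd z))"
    by (rule semidec_derivable)
  from semidec_comp[OF this, of "\<lambda>c. (0, c)"] show ?thesis by (simp add: comp_intros)
qed

lemma proc_encode_Sum:
  "proc_encode (Sum bs) = pr 2 (enc (map (\<lambda>b. pr (pref_encode (fst b)) (proc_encode (snd b))) bs))"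
  by (simp add: enc_nat_list comp_def map_prod_def split_beta)

lemma derivable_proc_encode:
  "derivable proc_code_rule (0, proc_encode P)" "derivable proc_code_rule (1, pref_encode p)"
proof (induction P and p)
  case (Loc a P)
  have "proc_code_rule [(0, proc_encode P)] (0, proc_encode (Loc a P))"
    by (simp add: proc_code_rule_def)
  then show ?case by (rule derivableI) (simp add: Loc)
next
  case (Par P Q)
  have "proc_code_rule [(0, proc_encode P), (0, proc_encode Q)] (0, proc_encode (Par P Q))"
    by (simp add: proc_code_rule_def)
  then show ?case by (rule derivableI) (use Par in auto)
next
  case (Sum bs)
  let ?ps = "map (\<lambda>b. (1, pref_encode (fst b))) bs @ map (\<lambda>b. (0, proc_encode (snd b))) bs"
  have "proc_code_rule ?ps (0, pr 2 (enc (map (\<lambda>b. pr (pref_encode (fst b)) (proc_encode (snd b))) bs)))"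
    unfolding proc_code_rule_def
    by (rule disjI2, rule disjI2, rule disjI1, intro exI conjI, rule refl) force
  then show ?case
    unfolding proc_encode_Sum
  proof (rule derivableI)
    fix c :: "nat \<times> nat" assume "c \<in> set ?ps"
    then obtain b where b: "b \<in> set bs" "c = (1, pref_encode (fst b)) \<or> c = (0, proc_encode (snd b))"
      by auto
    obtain p P where pP: "b = (p, P)" by (cases b)
    have "derivable proc_code_rule (1, pref_encode p)"
      by (rule Sum(1)[OF b(1)]) (simp add: pP)
    moreover have "derivable proc_code_rule (0, proc_encode P)"
      by (rule Sum(2)[OF b(1)]) (simp add: pP)
    ultimately show "derivable proc_code_rule c" using b(2) by (auto simp: pP)
  qed
next
  case (Repl p P)
  have "proc_code_rule [(1, pref_encode p), (0, proc_encode P)] (0, proc_encode (Repl p P))"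
    by (simp add: proc_code_rule_def)
  then show ?case by (rule derivableI) (use Repl in auto)
next
  case (Upd a U)
  have "proc_code_rule [(0, proc_encode U)] (1, pref_encode (Upd a U))"
    by (simp add: proc_code_rule_def)
  then show ?case by (rule derivableI) (simp add: Upd)
next
  case Hole
  show ?case by (rule derivableI[of _ "[]"]) (simp_all add: proc_code_rule_def)
next
  case Star
  show ?case by (rule derivableI[of _ "[]"]) (simp_all add: proc_code_rule_def)
next
  case (Act e)
  show ?case by (rule derivableI[of _ "[]"]) (auto simp: proc_code_rule_def enc_act_def)
qed

lemma proc_code_derivable:
  "derivable proc_code_rule c \<Longrightarrow>
    (fst c = 0 \<longrightarrow> (\<exists>P. snd c = proc_encode P)) \<and> (fst c = 1 \<longrightarrow> (\<exists>p. snd c = pref_encode p))"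
proof (induction rule: derivable.induct)
  case (derivableI ps c)
  have P: "\<exists>P. q = proc_encode P" if "(0, q) \<in> set ps" for q
    using derivableI.IH[OF that] by simp
  have p: "\<exists>p. q = pref_encode p" if "(1, q) \<in> set ps" for q
    using derivableI.IH[OF that] by simp
  have S: "\<exists>P. pr 2 (enc bs) = proc_encode P"
    if "\<forall>b\<in>set bs. \<exists>p q. b = pr p q \<and> (1, p) \<in> set ps \<and> (0, q) \<in> set ps" for bs :: "nat list"
  proof -
    have "\<forall>b\<in>set bs. \<exists>c. b = pr (pref_encode (fst c)) (proc_encode (snd c))"
      using that P p by (metis fst_conv snd_conv)
    then obtain f where "\<And>b. b \<in> set bs \<Longrightarrow> b = pr (pref_encode (fst (f b))) (proc_encode (snd (f b)))"
      by metis
    then have "bs = map (\<lambda>b. pr (pref_encode (fst b)) (proc_encode (snd b))) (map f bs)"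
      by (simp add: map_idI)
    then show ?thesis by (metis proc_encode_Sum)
  qed
  have L: "\<exists>P. pr 0 (pr a q) = proc_encode P" if "(0, q) \<in> set ps" for a q
    using P[OF that] by (metis proc_encode.simps(1))
  have A: "\<exists>P. pr 1 (pr q r) = proc_encode P" if "(0, q) \<in> set ps" "(0, r) \<in> set ps" for q r
    using P[OF that(1)] P[OF that(2)] by (metis proc_encode.simps(2))
  have R: "\<exists>P. pr 3 (pr q r) = proc_encode P" if "(1, q) \<in> set ps" "(0, r) \<in> set ps" for q r
    using p[OF that(1)] P[OF that(2)] by (metis proc_encode.simps(4))
  have U: "\<exists>p. pr 1 (pr a q) = pref_encode p" if "(0, q) \<in> set ps" for a q
    using P[OF that] by (metis pref_encode.simps(2))
  have H: "\<exists>P. pr 4 0 = proc_encode P" "\<exists>P. pr 5 0 = proc_encode P"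
    by (metis proc_encode.simps(5), metis proc_encode.simps(6))
  have E: "\<exists>p. pr 0 (enc e) = pref_encode p" for e :: act
    unfolding enc_act_def by (metis pref_encode.simps(1))
  show ?case
    using derivableI.hyps unfolding proc_code_rule_def
    by (elim disjE exE conjE) (simp_all only: fst_conv snd_conv L A R U H E S, simp_all)
qed

lemma range_proc_encode: "derivable proc_code_rule (0, n) \<longleftrightarrow> (\<exists>P. n = proc_encode P)"
  and range_pref_encode: "derivable proc_code_rule (1, n) \<longleftrightarrow> (\<exists>p. n = pref_encode p)"
  using proc_code_derivable[of "(0, n)"] proc_code_derivable[of "(1, n)"] derivable_proc_encode
  by auto

instantiation proc :: coded
begin
definition "enc P = proc_encode P"
instance
proof
  show "enc x = enc y \<longleftrightarrow> x = y" for x y :: proc by (simp add: enc_proc_def proc_encode_eq)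
  have "semidec (\<lambda>n. derivable proc_code_rule (0, n))"
    by (intro semidec_comp[OF semidec_proc_code] comp_intros)
  then show "semidec_nat (\<lambda>n. \<exists>P::proc. n = enc P)"
    by (simp add: semidec_nat_iff range_proc_encode enc_proc_def)
qed
end

instantiation pref :: coded
begin
definition "enc p = pref_encode p"
instance
proof
  show "enc x = enc y \<longleftrightarrow> x = y" for x y :: pref by (simp add: enc_pref_def pref_encode_eq)
  have "semidec (\<lambda>n. derivable proc_code_rule (1, n))"
    by (intro semidec_comp[OF semidec_proc_code] comp_intros)
  then show "semidec_nat (\<lambda>n. \<exists>p::pref. n = enc p)"
    by (simp only: semidec_nat_iff range_pref_encode enc_pref_def)
qed
end

fun label_encode :: "label \<Rightarrow> nat" where
  "label_encode (LAct e) = pr 0 (enc e)"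
| "label_encode (LLoc a U) = pr 1 (pr a (enc U))"
| "label_encode (LUpd a U) = pr 2 (pr a (enc U))"
| "label_encode Tau = pr 3 0"

instantiation label :: coded
begin
definition "enc l = label_encode l"
instance
proof
  show "enc x = enc y \<longleftrightarrow> x = y" for x y :: label by (cases x; cases y) (auto simp: enc_label_def)
  have "semidec (\<lambda>n. (\<exists>e::act. n = pr 0 (enc e)) \<or> (\<exists>a. \<exists>U::proc. n = pr 1 (pr a (enc U))) \<or>
      (\<exists>a. \<exists>U::proc. n = pr 2 (pr a (enc U))) \<or> n = pr 3 0)"
    by (intro semi_intros comp_intros)
  moreover have "(\<exists>e::act. n = pr 0 (enc e)) \<or> (\<exists>a. \<exists>U::proc. n = pr 1 (pr a (enc U))) \<or>
      (\<exists>a. \<exists>U::proc. n = pr 2 (pr a (enc U))) \<or> n = pr 3 0 \<longleftrightarrow> (\<exists>l::label. n = enc l)" for n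
    unfolding enc_label_def by (metis label.exhaust label_encode.simps)
  ultimately show "semidec_nat (\<lambda>n. \<exists>l::label. n = enc l)" by (simp add: semidec_nat_iff)
qed
end

lemma computable_Loc [comp_intros]:
  assumes "computable f" "computable g" shows "computable (\<lambda>x. Loc (f x) (g x))"
proof -
  have "computable (\<lambda>x. pr 0 (pr (f x) (enc (g x))))" by (intro comp_intros assms)
  then show ?thesis by (subst computable_enc) (simp add: enc_proc_def)
qed

lemma computable_Par [comp_intros]:
  assumes "computable f" "computable g" shows "computable (\<lambda>x. Par (f x) (g x))"
proof -
  have "computable (\<lambda>x. pr 1 (pr (enc (f x)) (enc (g x))))" by (intro comp_intros assms)
  then show ?thesis by (subst computable_enc) (simp add: enc_proc_def)
qed

lemma computable_Sum [comp_intros]: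
  assumes "computable f" shows "computable (\<lambda>x. Sum (f x))"
proof -
  have "computable (\<lambda>x. pr 2 (enc (f x)))" by (intro comp_intros assms)
  then show ?thesis by (subst computable_enc) (simp add: enc_proc_def enc_list_def enc_prod_def[abs_def] enc_pref_def comp_def map_prod_def split_beta)
qed

lemma computable_Repl [comp_intros]:
  assumes "computable f" "computable g" shows "computable (\<lambda>x. Repl (f x) (g x))"
proof -
  have "computable (\<lambda>x. pr 3 (pr (enc (f x)) (enc (g x))))" by (intro comp_intros assms)
  then show ?thesis by (subst computable_enc) (simp add: enc_proc_def enc_pref_def)
qed

lemma computable_Inp [comp_intros]:
  assumes "computable f" shows "computable (\<lambda>x. Inp (f x))"
proof -
  have "computable (\<lambda>x. pr 0 (f x))" by (intro comp_intros assms)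
  then show ?thesis by (subst computable_enc) (simp add: enc_act_def)
qed

lemma computable_Out [comp_intros]:
  assumes "computable f" shows "computable (\<lambda>x. Out (f x))"
proof -
  have "computable (\<lambda>x. pr 1 (f x))" by (intro comp_intros assms)
  then show ?thesis by (subst computable_enc) (simp add: enc_act_def)
qed

lemma computable_Act [comp_intros]:
  assumes "computable f" shows "computable (\<lambda>x. Act (f x))"
proof -
  have "computable (\<lambda>x. pr 0 (enc (f x)))" by (intro comp_intros assms)
  then show ?thesis by (subst computable_enc) (simp add: enc_pref_def enc_act_def)
qed

lemma computable_Upd [comp_intros]:
  assumes "computable f" "computable g" shows "computable (\<lambda>x. Upd (f x) (g x))"
proof -
  have "computable (\<lambda>x. pr 1 (pr (f x) (enc (g x))))" by (intro comp_intros assms)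
  then show ?thesis by (subst computable_enc) (simp add: enc_pref_def enc_proc_def)
qed

lemma computable_LAct [comp_intros]:
  assumes "computable f" shows "computable (\<lambda>x. LAct (f x))"
proof -
  have "computable (\<lambda>x. pr 0 (enc (f x)))" by (intro comp_intros assms)
  then show ?thesis by (subst computable_enc) (simp add: enc_label_def)
qed

lemma computable_LLoc [comp_intros]:
  assumes "computable f" "computable g" shows "computable (\<lambda>x. LLoc (f x) (g x))"
proof -
  have "computable (\<lambda>x. pr 1 (pr (f x) (enc (g x))))" by (intro comp_intros assms)
  then show ?thesis by (subst computable_enc) (simp add: enc_label_def)
qed

lemma computable_LUpd [comp_intros]:
  assumes "computable f" "computable g" shows "computable (\<lambda>x. LUpd (f x) (g x))"
proof -
  have "computable (\<lambda>x. pr 2 (pr (f x) (enc (g x))))" by (intro comp_intros assms)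
  then show ?thesis by (subst computable_enc) (simp add: enc_label_def)
qed

section \<open>The calculus as a monotone transition system\<close>

section \<open>A label-symmetric semantics\<close>

text \<open>Prefixed terms count as leaves here: everything above a prefix is reachable by update
  and embedding, nothing below it is.\<close>

lemma proc_top_induct [case_names Loc Par Sum Repl Hole Star]:
  assumes "\<And>a P. X P \<Longrightarrow> X (Loc a P)" "\<And>P Q. X P \<Longrightarrow> X Q \<Longrightarrow> X (Par P Q)"
    "\<And>bs. X (Sum bs)" "\<And>p P. X (Repl p P)" "X Hole" "X Star"
  shows "X P"
proof (induction P rule: measure_induct_rule[of size])
  case (less P)
  show ?case
  proof (cases P)
    case (Loc a Q)
    then show ?thesis using assms(1)[of Q a] less[of Q] by simp
  next
    case (Par Q R)
    then show ?thesis using assms(2)[of Q R] less[of Q] less[of R] by simp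
  qed (simp_all add: assms(3-))
qed

text \<open>Unlike \<open>fill\<close> it stops at sums and replications. On patterns of the
  calculus the two agree, as \<open>Ed2_fill\<close> shows, but only \<open>pfill\<close> is
  monotone without comparing terms below prefixes.\<close>

primrec pfill :: "proc \<Rightarrow> proc \<Rightarrow> proc" where
  "pfill R (Loc a U) = Loc a (pfill R U)"
| "pfill R (Par U V) = Par (pfill R U) (pfill R V)"
| "pfill R (Sum bs) = Sum bs"
| "pfill R (Repl p U) = Repl p U"
| "pfill R Hole = R"
| "pfill R Star = Star"

text \<open>Oriented: the receiving or rewritten side comes first. Each label on the left has
  exactly one partner, a fact used in \<open>T_com\<close>.\<close>

inductive co :: "label \<Rightarrow> label \<Rightarrow> bool" where
  "co (LAct (Inp a)) (LAct (Out a))"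
| "co (LLoc a U) (LUpd a U)"

text \<open>
  In \<open>trn\<close> the label \<open>LLoc a U\<close> means that a location \<open>a\<close> has been rewritten by the pattern \<open>U\<close>,
  so that no placeholder is left behind and an update is a communication of dual labels.
\<close>

inductive trn :: "proc \<Rightarrow> label \<Rightarrow> proc \<Rightarrow> bool" where
  trn_sum: "(p, P) \<in> set bs \<Longrightarrow> trn (Sum bs) (pref_label p) P"
| trn_repl: "trn (Repl p P) (pref_label p) (Par P (Repl p P))"
| trn_upd: "trn (Loc a R) (LLoc a U) (pfill R U)"
| trn_loc: "trn P l P' \<Longrightarrow> trn (Loc a P) l (Loc a P')"
| trn_par1: "trn P l P' \<Longrightarrow> trn (Par P Q) l (Par P' Q)"
| trn_par2: "trn P l P' \<Longrightarrow> trn (Par Q P) l (Par Q P')"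
| trn_com1: "trn P l P' \<Longrightarrow> trn Q m Q' \<Longrightarrow> co l m \<Longrightarrow> trn (Par P Q) Tau (Par P' Q')"
| trn_com2: "trn P l P' \<Longrightarrow> trn Q m Q' \<Longrightarrow> co l m \<Longrightarrow> trn (Par Q P) Tau (Par Q' P')"

inductive_simps Ed2_simps [simp]:
  "Ed2 (Loc a P)" "Ed2 (Par P Q)" "Ed2 (Sum bs)" "Ed2 (Repl p P)" "Ed2 Hole" "Ed2 Star"
  "Ed2_pref (Act e)" "Ed2_pref (Upd a U)"

lemma Ed2_fill:
  "Ed2 P \<Longrightarrow> fill R P = P \<and> pfill R P = P"
  "Ed2_pat U \<Longrightarrow> fill R U = pfill R U \<and> (Ed2 R \<longrightarrow> Ed2 (pfill R U))"
  "Ed2_pref p \<Longrightarrow> True"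
proof (induction rule: Ed2_Ed2_pat_Ed2_pref.inducts)
  case (3 bs)
  then have "map_prod (\<lambda>p. p) (fill R) b = b" if "b \<in> set bs" for b
    using that by (cases b) auto
  then show ?case by (simp add: map_idI)
qed auto

lemma Ed2_subst_star:
  "Ed2 P \<Longrightarrow> subst_star S P = P"
  "Ed2_pat U \<Longrightarrow> subst_star S U = U"
  "Ed2_pref p \<Longrightarrow> subst_star_pref S p = p"
proof (induction rule: Ed2_Ed2_pat_Ed2_pref.inducts)
  case (3 bs)
  then have "map_prod (subst_star_pref S) (subst_star S) b = b" if "b \<in> set bs" for b
    using that by (cases b) auto
  then show ?case by (simp add: map_idI)
qed auto

text \<open>While a location label is being derived, the pattern of the future partner is unknown.
  Hence the claim for \<open>LLoc a R\<close> ranges over all \<open>U\<close>, and over all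
  fillings of the placeholder.\<close>

lemma trn_if_step:
  "step P l P' \<Longrightarrow> Ed2 P \<Longrightarrow>
    (case l of
      LLoc a R \<Rightarrow> Ed2 R \<and> (\<forall>S. Ed2 S \<longrightarrow> Ed2 (subst_star S P')) \<and>
        (\<forall>U. trn P (LLoc a U) (subst_star (pfill R U) P'))
    | LUpd a U \<Rightarrow> Ed2 P' \<and> Ed2_pat U \<and> trn P l P'
    | _ \<Rightarrow> Ed2 P' \<and> trn P l P')"
proof (induction rule: step.induct)
  case (comp a P)
  then show ?case by (simp add: trn_upd)
next
  case (sum p P bs)
  then have "Ed2_pref p" "Ed2 P" by auto
  then show ?case using trn_sum[OF sum.hyps] by (cases p) auto
next
  case (repl p P)
  then show ?case using trn_repl[of p P] by (cases p) auto
next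
  case (loc P l P' a)
  then show ?case by (auto split: label.splits intro: trn_loc)
next
  case (act1 P1 l P1' P2)
  then show ?case by (auto split: label.splits simp: Ed2_subst_star intro: trn_par1)
next
  case (act2 P1 l P1' P2)
  then show ?case by (auto split: label.splits simp: Ed2_subst_star intro: trn_par2)
next
  case (com1 P1 a P1' P2 P2')
  then show ?case by (auto intro: trn_com1[OF _ _ co.intros(1)])
next
  case (com2 P1 a P1' P2 P2')
  then show ?case by (auto intro: trn_com2[OF _ _ co.intros(1)])
next
  case (upd1 P1 a Q P1' P2 U P2')
  then show ?case by (auto simp: Ed2_fill intro: trn_com1[OF _ _ co.intros(2)])
next
  case (upd2 P1 a Q P1' P2 U P2')
  then show ?case by (auto simp: Ed2_fill intro: trn_com2[OF _ _ co.intros(2)])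
qed

text \<open>Rewriting in place is split into detaching the location and substituting for the
  placeholder; siblings contain no \<open>Star\<close>, so the substitution leaves them
  alone.\<close>

lemma step_if_trn:
  "trn P l P' \<Longrightarrow> Ed2 P \<Longrightarrow>
    (case l of
      LLoc a U \<Rightarrow> \<exists>R Q. step P (LLoc a R) Q \<and> P' = subst_star (pfill R U) Q
    | _ \<Rightarrow> step P l P')"
proof (induction rule: trn.induct)
  case (trn_sum p P bs)
  then show ?case using step.sum[of p P bs] by (cases p) auto
next
  case (trn_repl p P)
  then show ?case using step.repl[of p P] by (cases p) auto
next
  case (trn_upd a R U)
  then show ?case using step.comp[of a R] by fastforce
next
  case (trn_loc P l P' a)
  show ?case
  proof (cases l)
    case (LLoc b U)
    then obtain R Q where "step P (LLoc b R) Q" "P' = subst_star (pfill R U) Q"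
      using trn_loc by auto
    then have "step (Loc a P) (LLoc b R) (Loc a Q)" "Loc a P' = subst_star (pfill R U) (Loc a Q)"
      by (simp_all add: step.loc)
    then have "\<exists>R Q. step (Loc a P) (LLoc b R) Q \<and> Loc a P' = subst_star (pfill R U) Q"
      by (intro exI[of _ R] exI[of _ "Loc a Q"] conjI)
    then show ?thesis by (simp only: LLoc label.case)
  qed (use trn_loc in \<open>simp_all add: step.loc\<close>)
next
  case (trn_par1 P l P' Q)
  then have Q: "subst_star S Q = Q" for S by (simp add: Ed2_subst_star)
  show ?case
  proof (cases l)
    case (LLoc b U)
    then obtain R X where "step P (LLoc b R) X" "P' = subst_star (pfill R U) X"
      using trn_par1 by auto
    then have "step (Par P Q) (LLoc b R) (Par X Q)" "Par P' Q = subst_star (pfill R U) (Par X Q)"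
      by (simp_all add: step.act1 Q)
    then have "\<exists>R X. step (Par P Q) (LLoc b R) X \<and> Par P' Q = subst_star (pfill R U) X"
      by (intro exI[of _ R] exI[of _ "Par X Q"] conjI)
    then show ?thesis by (simp only: LLoc label.case)
  qed (use trn_par1 in \<open>simp_all add: step.act1\<close>)
next
  case (trn_par2 P l P' Q)
  then have Q: "subst_star S Q = Q" for S by (simp add: Ed2_subst_star)
  show ?case
  proof (cases l)
    case (LLoc b U)
    then obtain R X where "step P (LLoc b R) X" "P' = subst_star (pfill R U) X"
      using trn_par2 by auto
    then have "step (Par Q P) (LLoc b R) (Par Q X)" "Par Q P' = subst_star (pfill R U) (Par Q X)"
      by (simp_all add: step.act2 Q)
    then have "\<exists>R X. step (Par Q P) (LLoc b R) X \<and> Par Q P' = subst_star (pfill R U) X"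
      by (intro exI[of _ R] exI[of _ "Par Q X"] conjI)
    then show ?thesis by (simp only: LLoc label.case)
  qed (use trn_par2 in \<open>simp_all add: step.act2\<close>)
next
  case (trn_com1 P l P' Q m Q')
  from \<open>co l m\<close> show ?case
  proof cases
    case (1 a)
    then show ?thesis using trn_com1 by (auto intro: step.com1)
  next
    case (2 a U)
    then have Q: "step Q (LUpd a U) Q'" using trn_com1 by auto
    obtain R P2 where P: "step P (LLoc a R) P2" "P' = subst_star (pfill R U) P2"
      using trn_com1 2 by auto
    \<comment> \<open>\<open>step\<close> uses \<open>fill\<close> and \<open>trn\<close> uses
      \<open>pfill\<close>. They agree on \<open>U\<close> because it labels a step of an
      \<open>Ed2\<close> process and so is a pattern of the calculus.\<close>
    have "Ed2_pat U" using trn_if_step[OF Q] trn_com1.prems by simp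
    then show ?thesis using step.upd1[OF P(1) Q] P(2) by (simp add: Ed2_fill)
  qed
next
  case (trn_com2 P l P' Q m Q')
  from \<open>co l m\<close> show ?case
  proof cases
    case (1 a)
    then show ?thesis using trn_com2 by (auto intro: step.com2)
  next
    case (2 a U)
    then have Q: "step Q (LUpd a U) Q'" using trn_com2 by auto
    obtain R P2 where P: "step P (LLoc a R) P2" "P' = subst_star (pfill R U) P2"
      using trn_com2 2 by auto
    have "Ed2_pat U" using trn_if_step[OF Q] trn_com2.prems by simp
    then show ?thesis using step.upd2[OF P(1) Q] P(2) by (simp add: Ed2_fill)
  qed
qed

lemma Ed2_red: "Ed2 P \<Longrightarrow> red P P' \<longleftrightarrow> trn P Tau P'"
  using trn_if_step[of P Tau P'] step_if_trn[of P Tau P'] by (auto simp: red_def)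

lemma Ed2_trn_Tau: "Ed2 P \<Longrightarrow> trn P Tau P' \<Longrightarrow> Ed2 P'"
  using trn_if_step[of P Tau P'] step_if_trn[of P Tau P'] by auto

lemma Ed2_barb:
  assumes "Ed2 P" shows "barb P e \<longleftrightarrow> (\<exists>P'. trn P (LAct e) P')"
proof -
  have "step P (LAct e) P' \<longleftrightarrow> trn P (LAct e) P'" for P'
    using trn_if_step[of P "LAct e" P'] step_if_trn[of P "LAct e" P'] assms by auto
  then show ?thesis by (simp add: barb_def)
qed

section \<open>The simulation preorder\<close>

text \<open>Beyond embedding, the order contains commutativity and associativity to absorb the
  bracketing of clusters, and \<open>le_Nil\<close> to absorb empty blocks of copies. There is no
  congruence below prefixes.\<close>

inductive le :: "proc \<Rightarrow> proc \<Rightarrow> bool" (infix "\<sqsubseteq>" 50) where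
  le_refl [simp]: "P \<sqsubseteq> P"
| le_trans [trans]: "P \<sqsubseteq> Q \<Longrightarrow> Q \<sqsubseteq> R \<Longrightarrow> P \<sqsubseteq> R"
| le_Loc: "P \<sqsubseteq> Q \<Longrightarrow> Loc a P \<sqsubseteq> Loc a Q"
| le_Par: "P \<sqsubseteq> P' \<Longrightarrow> Q \<sqsubseteq> Q' \<Longrightarrow> Par P Q \<sqsubseteq> Par P' Q'"
| le_in_Loc: "P \<sqsubseteq> Loc a P"
| le_in_Par: "P \<sqsubseteq> Par P Q"
| le_comm: "Par P Q \<sqsubseteq> Par Q P"
| le_assoc: "Par (Par P Q) R \<sqsubseteq> Par P (Par Q R)"
| le_Nil: "Nil_proc \<sqsubseteq> P"

text \<open>Here the restriction on patterns pays off: holes are filled only under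
  \<open>Loc\<close> and \<open>Par\<close>, for which congruence rules exist.\<close>

lemma pfill_mono: "R \<sqsubseteq> S \<Longrightarrow> pfill R U \<sqsubseteq> pfill S U"
  by (induction U rule: proc_top_induct) (auto intro: le_Loc le_Par)

lemma trn_LocE:
  assumes "trn (Loc a P) l P'"
  obtains (upd) U where "l = LLoc a U" "P' = pfill P U"
    | (inner) Q where "P' = Loc a Q" "trn P l Q"
  using assms by (cases rule: trn.cases) auto

lemma trn_ParE:
  assumes "trn (Par P Q) l R"
  obtains (left) P' where "R = Par P' Q" "trn P l P'"
    | (right) Q' where "R = Par P Q'" "trn Q l Q'"
    | (com1) P' Q' m n where "l = Tau" "R = Par P' Q'" "trn P m P'" "trn Q n Q'" "co m n"
    | (com2) P' Q' m n where "l = Tau" "R = Par P' Q'" "trn Q m Q'" "trn P n P'" "co m n"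
  using assms by (cases rule: trn.cases) auto

lemma trn_SumE:
  assumes "trn (Sum bs) l P'"
  obtains p where "(p, P') \<in> set bs" "l = pref_label p"
  using assms by (cases rule: trn.cases) auto

text \<open>Labels can be matched exactly since the prefixes of the smaller process reappear
  unchanged in the larger one. When a location is rewritten, the same pattern is applied to a larger
  content, and \<open>pfill_mono\<close> compares the results.\<close>

lemma le_simulation: "P \<sqsubseteq> Q \<Longrightarrow> trn P l P' \<Longrightarrow> \<exists>Q'. trn Q l Q' \<and> P' \<sqsubseteq> Q'"
proof (induction arbitrary: l P' rule: le.induct)
  case (le_trans P Q R)
  from le_trans.IH(1)[OF le_trans.prems] obtain Q' where Q: "trn Q l Q'" "P' \<sqsubseteq> Q'" by blast
  from le_trans.IH(2)[OF Q(1)] show ?case using Q(2) le.le_trans by blast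
next
  case (le_Loc P Q a)
  from le_Loc.prems show ?case
  proof (cases rule: trn_LocE)
    case (upd U)
    then show ?thesis using pfill_mono[OF le_Loc.hyps] trn_upd by blast
  next
    case (inner R)
    then show ?thesis using le_Loc.IH trn_loc le.le_Loc by blast
  qed
next
  case (le_Par P P' Q Q' l S)
  from le_Par.prems show ?case
  proof (cases rule: trn_ParE)
    case (left R)
    then show ?thesis using le_Par.IH(1)[of l R] le_Par.hyps trn_par1 le.le_Par by blast
  next
    case (right R)
    then show ?thesis using le_Par.IH(2)[of l R] le_Par.hyps trn_par2 le.le_Par by blast
  next
    case (com1 P2 Q2 m n)
    obtain P3 Q3 where "trn P' m P3" "P2 \<sqsubseteq> P3" "trn Q' n Q3" "Q2 \<sqsubseteq> Q3"
      using le_Par.IH(1)[OF com1(3)] le_Par.IH(2)[OF com1(4)] by blast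
    then show ?thesis using com1 trn_com1[of P' m P3 Q' n Q3] le.le_Par by blast
  next
    case (com2 P2 Q2 m n)
    obtain P3 Q3 where "trn P' n P3" "P2 \<sqsubseteq> P3" "trn Q' m Q3" "Q2 \<sqsubseteq> Q3"
      using le_Par.IH(2)[OF com2(3)] le_Par.IH(1)[OF com2(4)] by blast
    then show ?thesis using com2 trn_com2[of Q' m Q3 P' n P3] le.le_Par by blast
  qed
next
  case (le_comm P Q)
  from le_comm.prems show ?case
  proof (cases rule: trn_ParE)
    case (left P2)
    then show ?thesis using trn_par2 le.le_comm by blast
  next
    case (right Q2)
    then show ?thesis using trn_par1 le.le_comm by blast
  next
    case (com1 P2 Q2 m n)
    then show ?thesis using trn_com2[OF com1(3,4,5)] le.le_comm by blast
  next
    case (com2 P2 Q2 m n)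
    then show ?thesis using trn_com1[OF com2(3,4,5)] le.le_comm by blast
  qed
next
  case (le_assoc P Q R)
  \<comment> \<open>A partner in a communication has a visible label, so if it is itself a parallel
    composition, exactly one of its components moved.\<close>
  have notau: "m \<noteq> Tau" "n \<noteq> Tau" if "co m n" for m n using that by (auto elim: co.cases)
  from le_assoc.prems show ?case
  proof (cases rule: trn_ParE)
    case (left X)
    from left(2) show ?thesis
    proof (cases rule: trn_ParE)
      case (left P2)
      then show ?thesis using trn_par1 le.le_assoc \<open>P' = Par X R\<close> by blast
    next
      case (right Q2)
      then show ?thesis using trn_par1 trn_par2 le.le_assoc \<open>P' = Par X R\<close> by blast
    next
      case (com1 P2 Q2 m n)
      then show ?thesis
        using trn_com1[OF com1(3) trn_par1[OF com1(4), of R] com1(5)] le.le_assoc \<open>P' = Par X R\<close> by blast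
    next
      case (com2 P2 Q2 m n)
      then show ?thesis
        using trn_com2[OF trn_par1[OF com2(3), of R] com2(4,5)] le.le_assoc \<open>P' = Par X R\<close> by blast
    qed
  next
    case (right R2)
    then show ?thesis using trn_par2 le.le_assoc by blast
  next
    case (com1 X R2 m n)
    from com1(3) show ?thesis
    proof (cases rule: trn_ParE)
      case (left P2)
      then show ?thesis
        using trn_com1[OF left(2) trn_par2[OF com1(4), of Q] com1(5)] le.le_assoc com1(1,2) by blast
    next
      case (right Q2)
      then show ?thesis
        using trn_par2[OF trn_com1[OF right(2) com1(4,5)], of P] le.le_assoc com1(1,2) by blast
    qed (use notau[OF com1(5)] in auto)
  next
    case (com2 X R2 m n)
    from com2(4) show ?thesis
    proof (cases rule: trn_ParE)
      case (left P2)
      then show ?thesis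
        using trn_com2[OF trn_par2[OF com2(3), of Q] left(2) com2(5)] le.le_assoc com2(1,2) by blast
    next
      case (right Q2)
      then show ?thesis
        using trn_par2[OF trn_com2[OF com2(3) right(2) com2(5)], of P] le.le_assoc com2(1,2) by blast
    qed (use notau[OF com2(5)] in auto)
  qed
next
  case (le_Nil P)
  then show ?case by (auto elim: trn_SumE)
next
  case (le_refl P)
  then show ?case using le.le_refl by blast
next
  case (le_in_Loc P a)
  then show ?case using trn_loc le.le_in_Loc by blast
next
  case (le_in_Par P Q)
  then show ?case using trn_par1 le.le_in_Par by blast
qed

lemma le_assoc': "Par P (Par Q R) \<sqsubseteq> Par (Par P Q) R"
proof -
  have "Par P (Par Q R) \<sqsubseteq> Par (Par R Q) P"
    by (rule le_trans[OF le_comm]) (intro le_Par le_comm le_refl)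
  also have "\<dots> \<sqsubseteq> Par R (Par Q P)" by (rule le_assoc)
  also have "\<dots> \<sqsubseteq> Par (Par P Q) R"
    by (rule le_trans[OF le_comm]) (intro le_Par le_comm le_refl)
  finally show ?thesis .
qed

section \<open>Stages of a computation\<close>

text \<open>
  In stage 0 the cluster is being assembled, in stage 1 it runs, and stage \<open>i + 1\<close> is reached when
  \<open>i\<close> consecutive processes have exhibited the barb.
\<close>

inductive stg :: "proc list \<Rightarrow> act \<Rightarrow> nat \<times> proc \<Rightarrow> nat \<times> proc \<Rightarrow> bool" for Ms e where
  stg_add: "Q \<in> set Ms \<Longrightarrow> stg Ms e (0, R) (0, Par R Q)"
| stg_run: "stg Ms e (0, R) (1, R)"
| stg_red: "trn R Tau R' \<Longrightarrow> stg Ms e (1, R) (1, R')"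
| stg_barb: "trn R (LAct e) R' \<Longrightarrow> stg Ms e (1, R) (2, R)"
| stg_next: "2 \<le> i \<Longrightarrow> trn R Tau R' \<Longrightarrow> trn R' (LAct e) R'' \<Longrightarrow> stg Ms e (i, R) (Suc i, R')"

abbreviation stages :: "proc list \<Rightarrow> act \<Rightarrow> nat \<times> proc \<Rightarrow> nat \<times> proc \<Rightarrow> bool" where
  "stages Ms e \<equiv> (stg Ms e)\<^sup>*\<^sup>*"

lemma stg_simulation:
  assumes "stg Ms e s t" "snd s \<sqsubseteq> S"
  shows "\<exists>S'. stg Ms e (fst s, S) (fst t, S') \<and> snd t \<sqsubseteq> S'"
  using assms(1)
proof cases
  case (stg_add Q R)
  then show ?thesis
    using assms(2) stg.stg_add[OF stg_add(3), of e S] by (auto intro!: exI[of _ "Par S Q"] le_Par)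
next
  case (stg_run R)
  then show ?thesis using assms(2) stg.stg_run[of Ms e S] by (intro exI[of _ S]) simp
next
  case (stg_red R R')
  then obtain S' where "trn S Tau S'" "R' \<sqsubseteq> S'" using le_simulation assms(2) by fastforce
  then show ?thesis using stg_red stg.stg_red[of S S' Ms e] by (intro exI[of _ S']) simp
next
  case (stg_barb R R')
  then obtain S' where "trn S (LAct e) S'" using le_simulation assms(2) by fastforce
  then show ?thesis using stg_barb assms(2) stg.stg_barb[of S e S' Ms] by (intro exI[of _ S]) simp
next
  case (stg_next i R R' R'')
  then obtain S' where S': "trn S Tau S'" "R' \<sqsubseteq> S'" using le_simulation assms(2) by fastforce
  obtain S'' where "trn S' (LAct e) S''" using le_simulation[OF S'(2) stg_next(5)] by blast
  then show ?thesis
    using stg_next S' stg.stg_next[OF stg_next(3) S'(1), of e S'' Ms] by (intro exI[of _ S']) simp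
qed

lemma stages_simulation:
  "stages Ms e (i, R) t \<Longrightarrow> R \<sqsubseteq> S \<Longrightarrow> \<exists>S'. stages Ms e (i, S) (fst t, S') \<and> snd t \<sqsubseteq> S'"
proof (induction rule: rtranclp_induct)
  case (step t u)
  then obtain S' where "stages Ms e (i, S) (fst t, S')" "snd t \<sqsubseteq> S'" by blast
  then show ?case using stg_simulation[OF step.hyps(2)] by (meson rtranclp.rtrancl_into_rtrancl)
qed auto

text \<open>Stage \<open>Suc k\<close> is reached after \<open>k\<close> consecutive barbs. Starting
  from stage 0, the predicate speaks about all clusters at once.\<close>

definition wins :: "proc list \<Rightarrow> act \<Rightarrow> nat \<Rightarrow> nat \<Rightarrow> proc \<Rightarrow> bool" where
  "wins Ms e k i R \<longleftrightarrow> (\<exists>R'. stages Ms e (i, R) (Suc k, R'))"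

lemma wins_mono: "wins Ms e k i R \<Longrightarrow> R \<sqsubseteq> S \<Longrightarrow> wins Ms e k i S"
  unfolding wins_def using stages_simulation by fastforce

lemma stages_of_barbs:
  assumes "Ed2 R" "barbs R k e" "k \<ge> 1" shows "wins Ms e k 1 R"
proof -
  obtain Q where Q: "red\<^sup>*\<^sup>* R (Q 1)" "\<And>i. 1 \<le> i \<Longrightarrow> i < k \<Longrightarrow> red (Q i) (Q (i + 1))"
    "\<And>i. 1 \<le> i \<Longrightarrow> i \<le> k \<Longrightarrow> barb (Q i) e"
    using assms(2) unfolding barbs_def by blast
  have "stages Ms e (1, R) (1, Q 1) \<and> Ed2 (Q 1)"
    using Q(1)
  proof (induction rule: rtranclp_induct)
    case (step P P')
    then show ?case using stg_red by (metis Ed2_red Ed2_trn_Tau rtranclp.rtrancl_into_rtrancl)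
  qed (simp add: assms(1))
  then have base: "stages Ms e (1, R) (2, Q 1)" "Ed2 (Q 1)"
    using Q(3)[of 1] assms(3) stg_barb by (auto simp: Ed2_barb intro: rtranclp.rtrancl_into_rtrancl)
  have "stages Ms e (1, R) (Suc i, Q i) \<and> Ed2 (Q i)" if "1 \<le> i" "i \<le> k" for i
    using that
  proof (induction i rule: dec_induct)
    case base
    then show ?case using \<open>Ed2 (Q 1)\<close> \<open>stages Ms e (1, R) (2, Q 1)\<close> by (simp add: numeral_2_eq_2)
  next
    case (step i)
    then have IH: "stages Ms e (1, R) (Suc i, Q i)" "Ed2 (Q i)" by auto
    have t: "trn (Q i) Tau (Q (Suc i))" using Q(2)[of i] step IH(2) by (simp add: Ed2_red)
    have E: "Ed2 (Q (Suc i))" using Ed2_trn_Tau[OF IH(2) t] .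
    obtain R'' where "trn (Q (Suc i)) (LAct e) R''" using Q(3)[of "Suc i"] step E by (auto simp: Ed2_barb)
    then have "stg Ms e (Suc i, Q i) (Suc (Suc i), Q (Suc i))" using stg_next[OF _ t] step.hyps by simp
    then show ?case using IH(1) E by (auto intro: rtranclp.rtrancl_into_rtrancl)
  qed
  then show ?thesis using assms(3) unfolding wins_def by blast
qed

text \<open>\<open>barbs\<close> with the last process of the run exposed, so that a run can be
  prolonged by one reduction.\<close>

definition barb_run :: "proc \<Rightarrow> act \<Rightarrow> nat \<Rightarrow> proc \<Rightarrow> bool" where
  "barb_run R e n P \<longleftrightarrow> (\<exists>Q. red\<^sup>*\<^sup>* R (Q 1) \<and> (\<forall>i. 1 \<le> i \<and> i < n \<longrightarrow> red (Q i) (Q (i + 1))) \<and>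
     (\<forall>i. 1 \<le> i \<and> i \<le> n \<longrightarrow> barb (Q i) e) \<and> Q n = P)"

lemma barb_run_1: "red\<^sup>*\<^sup>* R P \<Longrightarrow> barb P e \<Longrightarrow> barb_run R e 1 P"
  unfolding barb_run_def by (intro exI[of _ "\<lambda>_. P"]) simp

lemma barb_run_Suc:
  assumes "barb_run R e n P" "1 \<le> n" "red P P'" "barb P' e" shows "barb_run R e (Suc n) P'"
proof -
  obtain Q where Q: "red\<^sup>*\<^sup>* R (Q 1)" "\<And>i. 1 \<le> i \<Longrightarrow> i < n \<Longrightarrow> red (Q i) (Q (i + 1))"
    "\<And>i. 1 \<le> i \<Longrightarrow> i \<le> n \<Longrightarrow> barb (Q i) e" "Q n = P"
    using assms(1) unfolding barb_run_def by blast
  define Q' where "Q' = Q(Suc n := P')"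
  have low: "Q' i = Q i" if "i \<le> n" for i using that by (simp add: Q'_def)
  have top: "Q' (Suc n) = P'" by (simp add: Q'_def)
  have "red (Q' i) (Q' (i + 1))" if "1 \<le> i" "i < Suc n" for i
    using Q(2)[of i] Q(4) assms(3) that low[of i] low[of "Suc i"] top by (cases "i = n") simp_all
  moreover have "barb (Q' i) e" if "1 \<le> i" "i \<le> Suc n" for i
    using Q(3)[of i] assms(4) that low[of i] top by (cases "i = Suc n") simp_all
  moreover have "red\<^sup>*\<^sup>* R (Q' 1)" using Q(1) low assms(2) by simp
  ultimately show ?thesis unfolding barb_run_def using top by blast
qed

lemma barbs_of_stages:
  "stages Ms e (1, R) t \<Longrightarrow> Ed2 R \<Longrightarrow>
    Ed2 (snd t) \<and> (fst t = 1 \<and> red\<^sup>*\<^sup>* R (snd t) \<or> (\<exists>n\<ge>1. fst t = Suc n \<and> barb_run R e n (snd t)))"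
proof (induction rule: rtranclp_induct)
  case (step t u)
  then have E: "Ed2 (snd t)" by blast
  note IH = step.IH[OF step.prems]
  from step.hyps(2) show ?case
  proof cases
    case (stg_add Q S)
    then show ?thesis using IH by simp
  next
    case (stg_run S)
    then show ?thesis using IH by simp
  next
    case (stg_red P P')
    then have "red\<^sup>*\<^sup>* R P" "red P P'" "Ed2 P'"
      using IH E Ed2_trn_Tau[of P P'] by (simp_all add: Ed2_red)
    then show ?thesis using stg_red by (simp add: rtranclp.rtrancl_into_rtrancl)
  next
    case (stg_barb P P')
    then have "red\<^sup>*\<^sup>* R P" "barb P e" using IH E by (auto simp: Ed2_barb)
    from barb_run_1[OF this] show ?thesis using stg_barb E by (simp add: exI[of _ 1])
  next
    case (stg_next i P P' P'')
    then obtain n where n: "n \<ge> 1" "i = Suc n" "barb_run R e n P" using IH by auto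
    have E': "Ed2 P'" "red P P'" "barb P' e"
      using stg_next E Ed2_trn_Tau by (auto simp: Ed2_red Ed2_barb)
    from barb_run_Suc[OF n(3,1) E'(2,3)] show ?thesis using stg_next n(2) E'(1) by auto
  qed
qed simp

lemma barbs_iff_wins:
  assumes "Ed2 R" "k \<ge> 1" shows "barbs R k e \<longleftrightarrow> wins Ms e k 1 R"
proof
  assume "wins Ms e k 1 R"
  then obtain R' where "stages Ms e (1, R) (Suc k, R')" unfolding wins_def by blast
  from barbs_of_stages[OF this assms(1)] have "barb_run R e k R'" using assms(2) by simp
  then show "barbs R k e" unfolding barbs_def barb_run_def by blast
qed (rule stages_of_barbs[OF assms(1) _ assms(2)])

text \<open>Clusters whose copies arrive one at a time, in any order. They agree with
  \<open>clusters\<close> only up to mutual domination in \<open>\<sqsubseteq>\<close>, which is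
  enough because \<open>wins\<close> is upward closed.\<close>

inductive ctx :: "proc list \<Rightarrow> proc \<Rightarrow> proc \<Rightarrow> bool" for Ms P where
  "ctx Ms P P"
| "ctx Ms P R \<Longrightarrow> Q \<in> set Ms \<Longrightarrow> ctx Ms P (Par R Q)"

lemma stages_of_ctx: "ctx Ms P R \<Longrightarrow> stages Ms e (0, P) (0, R)"
  by (induction rule: ctx.induct) (auto intro: rtranclp.rtrancl_into_rtrancl stg_add)

lemma ctx_of_stages:
  "stages Ms e (0, P) t \<Longrightarrow> (fst t = 0 \<and> ctx Ms P (snd t)) \<or> (fst t \<noteq> 0 \<and> (\<exists>R. ctx Ms P R \<and> stages Ms e (1, R) t))"
proof (induction rule: rtranclp_induct)
  case (step t u)
  show ?case
  proof (cases "fst t = 0")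
    case True
    then show ?thesis using step by (auto elim!: stg.cases intro: ctx.intros)
  next
    case False
    then have "fst u \<noteq> 0" using step.hyps(2) by (auto elim: stg.cases)
    then show ?thesis using False step by (auto intro: rtranclp.rtrancl_into_rtrancl)
  qed
qed (simp add: ctx.intros)

lemma wins_0: "wins Ms e k 0 P \<longleftrightarrow> (\<exists>R. ctx Ms P R \<and> wins Ms e k 1 R)"
proof
  assume "wins Ms e k 0 P"
  then show "\<exists>R. ctx Ms P R \<and> wins Ms e k 1 R"
    unfolding wins_def using ctx_of_stages by fastforce
next
  assume "\<exists>R. ctx Ms P R \<and> wins Ms e k 1 R"
  then obtain R R' where R: "ctx Ms P R" "stages Ms e (1, R) (Suc k, R')" unfolding wins_def by blast
  have "stages Ms e (0, P) (1, R)" using stages_of_ctx[OF R(1)] stg_run by (rule rtranclp.rtrancl_into_rtrancl)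
  then show "wins Ms e k 0 P" unfolding wins_def using R(2) by (meson rtranclp_trans)
qed

section \<open>Clusters\<close>

lemma foldl_Par_mono: "X \<sqsubseteq> Y \<Longrightarrow> foldl Par X zs \<sqsubseteq> foldl Par Y zs"
  by (induction zs arbitrary: X Y) (simp_all add: le_Par)

lemma le_foldl_Par: "X \<sqsubseteq> foldl Par X zs"
  by (induction zs arbitrary: X) (auto intro: le_trans[OF le_in_Par])

text \<open>Lets a newly added component travel to the front of the fold, where it can join the
  block of copies it belongs to.\<close>

lemma Par_foldl_Par: "Par (foldl Par X zs) Y \<sqsubseteq> foldl Par (Par X Y) zs"
proof (induction zs arbitrary: X)
  case (Cons z zs)
  have "Par (Par X z) Y \<sqsubseteq> Par X (Par z Y)" by (rule le_assoc)
  also have "\<dots> \<sqsubseteq> Par X (Par Y z)" by (intro le_Par le_comm le_refl)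
  also have "\<dots> \<sqsubseteq> Par (Par X Y) z" by (rule le_assoc')
  finally have "foldl Par (Par (Par X z) Y) zs \<sqsubseteq> foldl Par (Par (Par X Y) z) zs"
    by (rule foldl_Par_mono)
  with Cons[of "Par X z"] show ?case using le_trans by simp
qed simp

lemma Par_copies_ctx:
  "ctx Ms P S \<Longrightarrow> X \<sqsubseteq> S \<Longrightarrow> Q \<in> set Ms \<Longrightarrow> \<exists>S'. ctx Ms P S' \<and> Par X (copies m Q) \<sqsubseteq> S'"
proof (induction m Q arbitrary: X S rule: copies.induct)
  case (1 Q)
  \<comment> \<open>An empty block is \<open>Nil_proc\<close>, which one copy of \<open>Q\<close>
    dominates.\<close>
  then show ?case by (intro exI[of _ "Par S Q"]) (auto intro: ctx.intros le_Par le_Nil)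
next
  case (2 Q)
  then show ?case by (intro exI[of _ "Par S Q"]) (auto intro: ctx.intros le_Par)
next
  case (3 m Q)
  from "3.IH"[OF ctx.intros(2)[OF "3.prems"(1,3)] le_Par[OF "3.prems"(2) le_refl] "3.prems"(3)]
  obtain S' where S': "ctx Ms P S'" "Par (Par X Q) (copies (Suc m) Q) \<sqsubseteq> S'" by blast
  have "Par X (copies (Suc (Suc m)) Q) \<sqsubseteq> S'" using le_trans[OF le_assoc' S'(2)] by simp
  with S'(1) show ?case by blast
qed

lemma foldl_copies_ctx:
  "ctx Ms P S \<Longrightarrow> X \<sqsubseteq> S \<Longrightarrow> set Ps \<subseteq> set Ms \<Longrightarrow> length ms = length Ps \<Longrightarrow>
    \<exists>S'. ctx Ms P S' \<and> foldl Par X (map2 copies ms Ps) \<sqsubseteq> S'"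
proof (induction Ps arbitrary: X S ms)
  case (Cons Q Ps)
  then obtain m ms' where ms: "ms = m # ms'" by (cases ms) auto
  obtain S' where "ctx Ms P S'" "Par X (copies m Q) \<sqsubseteq> S'"
    using Par_copies_ctx Cons.prems by (metis list.set_intros(1) subsetD)
  then show ?case using Cons.IH[of S' "Par X (copies m Q)" ms'] Cons.prems by (simp add: ms)
qed auto

text \<open>For \<open>m = 0\<close> the left side is \<open>Par Nil_proc Q\<close>, and no rule of
  the order discards a component. Overshooting by one copy treats all \<open>m\<close> alike and is
  harmless, as only domination is wanted.\<close>

lemma Par_copies: "Par (copies m Q) Q \<sqsubseteq> copies (Suc (Suc m)) Q"
proof -
  have "copies m Q \<sqsubseteq> copies (Suc m) Q"
  proof (cases m)
    case (Suc n)
    then show ?thesis using le_trans[OF le_in_Par le_comm] by simp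
  qed (simp add: le_Nil)
  then have "Par (copies m Q) Q \<sqsubseteq> Par (copies (Suc m) Q) Q" by (intro le_Par le_refl)
  also have "\<dots> \<sqsubseteq> copies (Suc (Suc m)) Q" using le_comm by simp
  finally show ?thesis .
qed

lemma foldl_copies_add:
  "Q \<in> set Ps \<Longrightarrow> length ms = length Ps \<Longrightarrow>
    \<exists>ms'. length ms' = length Ps \<and> Par (foldl Par X (map2 copies ms Ps)) Q \<sqsubseteq> foldl Par X (map2 copies ms' Ps)"
proof (induction Ps arbitrary: X ms)
  case (Cons P Ps)
  then obtain m ns where ms: "ms = m # ns" by (cases ms) auto
  show ?case
  proof (cases "Q = P")
    case True
    let ?zs = "map2 copies ns Ps"
    have "Par (Par X (copies m P)) P \<sqsubseteq> Par X (Par (copies m P) P)" by (rule le_assoc)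
    also have "\<dots> \<sqsubseteq> Par X (copies (Suc (Suc m)) P)" by (intro le_Par le_refl Par_copies)
    finally have "foldl Par (Par (Par X (copies m P)) P) ?zs \<sqsubseteq> foldl Par (Par X (copies (Suc (Suc m)) P)) ?zs"
      by (rule foldl_Par_mono)
    with Par_foldl_Par[of "Par X (copies m P)" ?zs P]
    have "Par (foldl Par (Par X (copies m P)) ?zs) P \<sqsubseteq> foldl Par (Par X (copies (Suc (Suc m)) P)) ?zs"
      by (rule le_trans)
    then show ?thesis using Cons.prems ms True by (intro exI[of _ "Suc (Suc m) # ns"]) simp
  next
    case False
    then obtain ms' where "length ms' = length Ps"
      "Par (foldl Par (Par X (copies m P)) (map2 copies ns Ps)) Q \<sqsubseteq>
        foldl Par (Par X (copies m P)) (map2 copies ms' Ps)"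
      using Cons.IH[of ns "Par X (copies m P)"] Cons.prems ms by auto
    then show ?thesis using ms by (intro exI[of _ "m # ms'"]) simp
  qed
qed simp

lemma ctx_foldl_copies:
  "ctx Ms P R \<Longrightarrow> set Ps = set Ms \<Longrightarrow>
    \<exists>ms. length ms = length Ps \<and> R \<sqsubseteq> foldl Par P (map2 copies ms Ps)"
proof (induction rule: ctx.induct)
  case 1
  show ?case using le_foldl_Par by (intro exI[of _ "map (\<lambda>_. 0) Ps"]) simp
next
  case (2 R Q)
  then obtain ms where ms: "length ms = length Ps" "R \<sqsubseteq> foldl Par P (map2 copies ms Ps)" by blast
  then obtain ms' where "length ms' = length Ps"
    "Par (foldl Par P (map2 copies ms Ps)) Q \<sqsubseteq> foldl Par P (map2 copies ms' Ps)"
    using foldl_copies_add 2 by metis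
  then show ?case using ms(2) by (meson le_Par le_refl le_trans)
qed

lemma Ed2_copies: "Ed2 Q \<Longrightarrow> Ed2 (copies m Q)"
  by (induction m Q rule: copies.induct) auto

lemma Ed2_foldl_Par: "Ed2 X \<Longrightarrow> \<forall>z\<in>set zs. Ed2 z \<Longrightarrow> Ed2 (foldl Par X zs)"
  by (induction zs arbitrary: X) auto

lemma Ed2_cluster:
  assumes "Ed2 P" "\<forall>Q\<in>M. Ed2 Q" "R \<in> clusters M P" shows "Ed2 R"
proof -
  obtain ms Ps where "R = foldl Par P (map2 copies ms Ps)" "set Ps = M"
    using assms(3) unfolding clusters_def by blast
  then show ?thesis using assms(1,2) by (auto intro!: Ed2_foldl_Par Ed2_copies dest!: set_zip_rightD)
qed

theorem bounded_adaptation_iff: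
  assumes P: "Ed2 P" "\<forall>Q\<in>set Ms. Ed2 Q" and k: "k \<ge> 1"
  shows "bounded_adaptation P (set Ms) e k \<longleftrightarrow> \<not> wins Ms e k 0 P"
proof -
  have "(\<exists>R\<in>clusters (set Ms) P. barbs R k e) \<longleftrightarrow> (\<exists>R. ctx Ms P R \<and> wins Ms e k 1 R)"
  proof
    assume "\<exists>R\<in>clusters (set Ms) P. barbs R k e"
    then obtain R where R: "R \<in> clusters (set Ms) P" "barbs R k e" by blast
    then have "wins Ms e k 1 R" using barbs_iff_wins[OF Ed2_cluster[OF P] k] by blast
    moreover obtain ms Ps where "R = foldl Par P (map2 copies ms Ps)" "set Ps = set Ms" "length ms = length Ps"
      using R(1) unfolding clusters_def by blast
    then obtain S where "ctx Ms P S" "R \<sqsubseteq> S"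
      using foldl_copies_ctx[OF ctx.intros(1) le_refl, of Ps Ms ms P] by auto
    ultimately show "\<exists>R. ctx Ms P R \<and> wins Ms e k 1 R" using wins_mono by blast
  next
    assume "\<exists>R. ctx Ms P R \<and> wins Ms e k 1 R"
    then obtain R where R: "ctx Ms P R" "wins Ms e k 1 R" by blast
    \<comment> \<open>\<open>clusters\<close> asks for an enumeration of the set without
      repetitions.\<close>
    obtain ms where ms: "length ms = length (remdups Ms)" "R \<sqsubseteq> foldl Par P (map2 copies ms (remdups Ms))"
      using ctx_foldl_copies[OF R(1), of "remdups Ms"] by auto
    let ?S = "foldl Par P (map2 copies ms (remdups Ms))"
    have S: "?S \<in> clusters (set Ms) P"
      unfolding clusters_def using ms(1) by (intro CollectI exI conjI) auto
    then have "barbs ?S k e"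
      using barbs_iff_wins[OF Ed2_cluster[OF P S] k] wins_mono[OF R(2) ms(2)] by blast
    with S show "\<exists>R\<in>clusters (set Ms) P. barbs R k e" by blast
  qed
  then show ?thesis unfolding bounded_adaptation_def wins_0 by simp
qed

section \<open>Well-quasi-orders and recognisable sets\<close>

section \<open>Kruskal's theorem for process terms\<close>

text \<open>Homeomorphic embedding of the skeleton made of \<open>Loc\<close> and
  \<open>Par\<close>. Prefixed terms are leaves and must coincide; the recursion follows the larger
  term.\<close>

primrec emb :: "proc \<Rightarrow> proc \<Rightarrow> bool" where
  "emb t (Loc a Q) \<longleftrightarrow> emb t Q \<or> (\<exists>u. t = Loc a u \<and> emb u Q)"
| "emb t (Par P Q) \<longleftrightarrow> emb t P \<or> emb t Q \<or> (\<exists>u v. t = Par u v \<and> emb u P \<and> emb v Q)"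
| "emb t (Sum bs) \<longleftrightarrow> t = Sum bs"
| "emb t (Repl p Q) \<longleftrightarrow> t = Repl p Q"
| "emb t Hole \<longleftrightarrow> t = Hole"
| "emb t Star \<longleftrightarrow> t = Star"

lemma emb_refl: "emb P P"
  by (induction P rule: proc_top_induct) auto

lemma emb_le: "emb t Q \<Longrightarrow> t \<sqsubseteq> Q"
proof (induction Q arbitrary: t rule: proc_top_induct)
  case (Loc a Q)
  then show ?case using le_trans[OF _ le_in_Loc] by (auto intro: le_Loc)
next
  case (Par P Q)
  have "t \<sqsubseteq> Par P Q" if "t \<sqsubseteq> P" for t using le_trans[OF that le_in_Par] .
  moreover have "t \<sqsubseteq> Par P Q" if "t \<sqsubseteq> Q" for t using le_trans[OF le_trans[OF that le_in_Par] le_comm] .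
  ultimately show ?case using Par by (auto intro: le_Par)
qed auto

text \<open>Terms with leaves from \<open>L\<close> and location names from \<open>N\<close>.
  Distinct leaves are incomparable and names must match, so a well-quasi-order requires both sets to
  be finite.\<close>

primrec over :: "proc set \<Rightarrow> name set \<Rightarrow> proc \<Rightarrow> bool" where
  "over L N (Loc a P) \<longleftrightarrow> a \<in> N \<and> over L N P"
| "over L N (Par P Q) \<longleftrightarrow> over L N P \<and> over L N Q"
| "over L N (Sum bs) \<longleftrightarrow> Sum bs \<in> L"
| "over L N (Repl p P) \<longleftrightarrow> Repl p P \<in> L"
| "over L N Hole \<longleftrightarrow> Hole \<in> L"
| "over L N Star \<longleftrightarrow> Star \<in> L"

inductive isub :: "proc \<Rightarrow> proc \<Rightarrow> bool" where
  "isub P (Loc a P)" | "isub P (Par P Q)" | "isub Q (Par P Q)"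

lemma isub_facts: "isub s Q \<Longrightarrow> size s < size Q \<and> (over L N Q \<longrightarrow> over L N s) \<and> (emb t s \<longrightarrow> emb t Q)"
  by (induction rule: isub.induct) auto

text \<open>Ramsey's theorem yields an infinite set of indices on which either all pairs ascend or
  none does; the latter would be a sequence without any ascending pair.\<close>

lemma ascending_subsequence:
  fixes f :: "nat \<Rightarrow> 'a"
  assumes good: "\<And>g :: nat \<Rightarrow> 'a. (\<And>i. g i \<in> S) \<Longrightarrow> \<exists>i j. i < j \<and> R (g i) (g j)" and f: "\<And>i. f i \<in> S"
  shows "\<exists>\<phi> :: nat \<Rightarrow> nat. strict_mono \<phi> \<and> (\<forall>i j. i < j \<longrightarrow> R (f (\<phi> i)) (f (\<phi> j)))"
proof -
  \<comment> \<open>Ramsey colours unordered pairs; \<open>Min\<close> and \<open>Max\<close>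
    recover their order.\<close>
  define col where "col X = (if R (f (Min X)) (f (Max X)) then 0 else 1 :: nat)" for X
  have "\<exists>Y t. Y \<subseteq> UNIV \<and> infinite Y \<and> t < (2::nat) \<and> (\<forall>x\<in>Y. \<forall>y\<in>Y. x \<noteq> y \<longrightarrow> col {x, y} = t)"
    by (rule Ramsey2) (simp_all add: col_def)
  then obtain Y t where Y: "infinite Y" "\<forall>x\<in>Y. \<forall>y\<in>Y. x \<noteq> y \<longrightarrow> col {x, y} = t"
    by (elim exE conjE) (rule that)
  let ?\<phi> = "enumerate Y"
  have mono: "?\<phi> i < ?\<phi> j" if "i < j" for i j using enumerate_mono[OF that Y(1)] .
  have col: "col {?\<phi> i, ?\<phi> j} = t" if "i < j" for i j
    using Y(2) mono[OF that] enumerate_in_set[OF Y(1), of i] enumerate_in_set[OF Y(1), of j]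
    by (metis less_irrefl)
  have R: "R (f (?\<phi> i)) (f (?\<phi> j)) \<longleftrightarrow> t = 0" if "i < j" for i j
  proof -
    have "Min {?\<phi> i, ?\<phi> j} = ?\<phi> i" "Max {?\<phi> i, ?\<phi> j} = ?\<phi> j"
      using mono[OF that] by (simp_all add: min_def max_def)
    then show ?thesis using col[OF that] unfolding col_def by (simp split: if_splits)
  qed
  from good[of "\<lambda>i. f (?\<phi> i)", OF f] obtain i j where "i < j" "R (f (?\<phi> i)) (f (?\<phi> j))" by blast
  then have "t = 0" using R by blast
  then have "\<forall>i j. i < j \<longrightarrow> R (f (?\<phi> i)) (f (?\<phi> j))" using R by blast
  then show ?thesis using mono by (intro exI[of _ ?\<phi>]) (simp add: strict_mono_def)
qed

text \<open>Nash-Williams' argument: in a bad sequence \<open>m\<close> whose terms are successively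
  of least size, the immediate subterms of the terms are well-quasi-ordered. Infinitely many terms
  share their root symbol, and an ascending pair among their arguments lifts to the terms. With
  arities at most 2, passing to one ascending subsequence handles the arguments.\<close>

theorem kruskal:
  fixes f :: "nat \<Rightarrow> proc"
  assumes fin: "finite L" "finite N" and f: "\<And>i. over L N (f i)"
  shows "\<exists>i j. i < j \<and> emb (f i) (f j)"
proof (rule ccontr)
  define bad where "bad g \<longleftrightarrow> (\<forall>i. over L N (g i)) \<and> (\<forall>i j. i < j \<longrightarrow> \<not> emb (g i) (g j))" for g :: "nat \<Rightarrow> proc"
  assume "\<nexists>i j. i < j \<and> emb (f i) (f j)"
  then have badf: "bad f" using f by (simp add: bad_def)
  define least where "least n g \<longleftrightarrow> bad g \<and> (\<forall>h. bad h \<and> (\<forall>i<n. h i = g i) \<longrightarrow> size (g n) \<le> size (h n))"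
    for n g
  have ex: "\<exists>h. least n h \<and> (\<forall>i<n. h i = g i)" if "bad g" for n g
  proof -
    have "bad g \<and> (\<forall>i<n. g i = g i)" using that by simp
    from ex_has_least_nat[of "\<lambda>h. bad h \<and> (\<forall>i<n. h i = g i)", OF this, of "\<lambda>h. size (h n)"]
    obtain h where h: "bad h" "\<forall>i<n. h i = g i"
      "\<And>h'. bad h' \<and> (\<forall>i<n. h' i = g i) \<Longrightarrow> size (h n) \<le> size (h' n)" by blast
    have "size (h n) \<le> size (h' n)" if "bad h'" "\<forall>i<n. h' i = h i" for h'
      using h(3)[of h'] that h(2) by simp
    then have "least n h" unfolding least_def using h(1) by blast
    with h(2) show ?thesis by blast
  qed
  have "\<exists>F. \<forall>n. least n (F n) \<and> (\<forall>i<Suc n. F (Suc n) i = F n i)"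
  proof (rule dependent_nat_choice[where P = least and Q = "\<lambda>n g h. \<forall>i<Suc n. h i = g i"])
    show "\<exists>g. least 0 g" using ex[OF badf, of 0] by blast
    fix g :: "nat \<Rightarrow> proc" and n assume "least n g"
    then have "bad g" by (simp add: least_def)
    then show "\<exists>h. least (Suc n) h \<and> (\<forall>i<Suc n. h i = g i)" by (rule ex)
  qed
  then obtain F where F: "\<And>n. least n (F n)" "\<And>n i. i < Suc n \<Longrightarrow> F (Suc n) i = F n i" by blast
  define m where "m n = F n n" for n
  have Fm: "F n i = m i" if "i \<le> n" for i n
    using that by (induction n rule: dec_induct) (simp_all add: m_def F(2))
  have badF: "bad (F n)" for n using F(1) by (simp add: least_def)
  have badm: "bad m"
    unfolding bad_def
  proof (intro conjI allI impI)
    show "over L N (m i)" for i using badF[of i] by (simp add: bad_def m_def)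
    show "\<not> emb (m i) (m j)" if "i < j" for i j
    proof -
      have "\<not> emb (F j i) (F j j)" using badF[of j] that unfolding bad_def by blast
      then show ?thesis using that Fm[of i j] Fm[of j j] by simp
    qed
  qed
  have minimal: "size (m n) \<le> size (h n)" if "bad h" "\<And>i. i < n \<Longrightarrow> h i = m i" for h n
  proof -
    have "\<forall>i<n. h i = F n i" using that(2) Fm[of _ n] by simp
    then show ?thesis using F(1)[of n] that(1) unfolding least_def m_def by blast
  qed
  define S where "S = {s. \<exists>n. isub s (m n)}"
  have good: "\<exists>i j. i < j \<and> emb (g i) (g j)" if "\<And>i. g i \<in> S" for g :: "nat \<Rightarrow> proc"
  proof (rule ccontr)
    assume contra: "\<nexists>i j. i < j \<and> emb (g i) (g j)"
    have "\<forall>i. \<exists>n. isub (g i) (m n)" using that by (simp add: S_def)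
    then obtain r where r: "\<And>i. isub (g i) (m (r i))" by metis
    have "\<exists>i0. True \<and> (\<forall>i. True \<longrightarrow> r i0 \<le> r i)" by (rule ex_has_least_nat) simp
    then obtain i0 where i0: "\<And>i. r i0 \<le> r i" by blast
    \<comment> \<open>The minimal sequence up to the least index \<open>r i0\<close> that supplies a
      term of \<open>g\<close>, and from there on \<open>g\<close> itself, entered at
      \<open>i0\<close>. A bad \<open>h\<close> would have a term at position \<open>r i0\<close>
      smaller than the minimal choice.\<close>
    define h where "h i = (if i < r i0 then m i else g (i0 + (i - r i0)))" for i
    have "bad h"
      unfolding bad_def
    proof (intro conjI allI impI)
      fix i j :: nat
      have mo: "over L N (m k)" for k using badm by (simp add: bad_def)
      then have "over L N (g k)" for k using isub_facts[OF r[of k]] by blast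
      then show "over L N (h i)" using mo by (simp add: h_def)
      assume "i < j"
      show "\<not> emb (h i) (h j)"
      proof (cases "j < r i0")
        case True
        then show ?thesis using badm \<open>i < j\<close> by (simp add: bad_def h_def)
      next
        case False
        let ?k = "i0 + (j - r i0)"
        show ?thesis
        proof (cases "i < r i0")
          case True
          \<comment> \<open>Minimality of \<open>r i0\<close> makes the parent
            \<open>m (r ?k)\<close> of \<open>g ?k\<close> come after \<open>m i\<close>; an
            embedding into the subterm would be one into the parent.\<close>
          have "i < r ?k" using True i0[of ?k] by simp
          then have "\<not> emb (m i) (m (r ?k))" using badm by (simp add: bad_def)
          then have "\<not> emb (m i) (g ?k)" using isub_facts[OF r[of ?k]] by blast
          then show ?thesis using True False by (simp add: h_def)
        next
          case False
          then have "i0 + (i - r i0) < ?k" using \<open>i < j\<close> by simp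
          then show ?thesis using contra False \<open>\<not> j < r i0\<close> by (simp add: h_def)
        qed
      qed
    qed
    then have "size (m (r i0)) \<le> size (h (r i0))" by (rule minimal) (simp add: h_def)
    moreover have "size (g i0) < size (m (r i0))" using isub_facts[OF r[of i0]] by blast
    ultimately show False by (simp add: h_def)
  qed
  \<comment> \<open>The root symbol with its arguments erased to \<open>Hole\<close>; over
    \<open>L\<close> and \<open>N\<close> it takes finitely many values.\<close>
  define root where "root Q = (case Q of Loc a _ \<Rightarrow> Loc a Hole | Par _ _ \<Rightarrow> Par Hole Hole | _ \<Rightarrow> Q)" for Q
  have "range (\<lambda>n. root (m n)) \<subseteq> (\<lambda>a. Loc a Hole) ` N \<union> {Par Hole Hole} \<union> L"
  proof
    fix x assume "x \<in> range (\<lambda>n. root (m n))"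
    then obtain n where n: "x = root (m n)" by blast
    have "over L N (m n)" using badm by (simp add: bad_def)
    then show "x \<in> (\<lambda>a. Loc a Hole) ` N \<union> {Par Hole Hole} \<union> L"
      unfolding n root_def by (cases "m n") auto
  qed
  then have "finite (range (\<lambda>n. root (m n)))" by (rule finite_subset) (simp add: fin)
  then obtain n0 where inf: "infinite {n \<in> UNIV. root (m n) = root (m n0)}"
    using pigeonhole_infinite[of UNIV "\<lambda>n. root (m n)"] by auto
  define \<psi> where "\<psi> = enumerate {n \<in> UNIV. root (m n) = root (m n0)}"
  have mono: "\<psi> i < \<psi> j" if "i < j" for i j unfolding \<psi>_def using enumerate_mono[OF that inf] .
  have root: "root (m (\<psi> i)) = root (m n0)" for i unfolding \<psi>_def using enumerate_in_set[OF inf, of i] by simp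
  have nemb: "\<not> emb (m (\<psi> i)) (m (\<psi> j))" if "i < j" for i j using badm mono[OF that] by (simp add: bad_def)
  have leaf: "m (\<psi> i) = m n0" if "\<forall>a P. m n0 \<noteq> Loc a P" "\<forall>P Q. m n0 \<noteq> Par P Q" for i
    using root[of i] that unfolding root_def by (cases "m (\<psi> i)"; cases "m n0"; simp)
  show False
  proof (cases "m n0")
    case (Loc a Q)
    have "\<exists>x. m (\<psi> i) = Loc a x" for i
      using root[of i] unfolding Loc root_def by (cases "m (\<psi> i)") auto
    then obtain x where x: "\<And>i. m (\<psi> i) = Loc a (x i)" by metis
    have xS: "x i \<in> S" for i
      unfolding S_def using isub.intros(1)[of "x i" a] x[of i] by (auto intro!: exI[of _ "\<psi> i"])
    from good[OF this] obtain i j where "i < j" "emb (x i) (x j)" by blast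
    then show False using nemb[of i j] x by simp
  next
    case (Par P Q)
    have "\<exists>x y. m (\<psi> i) = Par x y" for i
      using root[of i] unfolding Par root_def by (cases "m (\<psi> i)") auto
    then obtain x y where xy: "\<And>i. m (\<psi> i) = Par (x i) (y i)" by metis
    have xS: "x i \<in> S" for i 
      unfolding S_def using isub.intros(2)[of "x i" "y i"] xy[of i] by (auto intro!: exI[of _ "\<psi> i"])
    have yS: "y i \<in> S" for i 
      unfolding S_def using isub.intros(3)[of "y i" "x i"] xy[of i] by (auto intro!: exI[of _ "\<psi> i"])
    \<comment> \<open>The left arguments ascend along all pairs of this subsequence, so any
      ascending pair of right arguments in it settles the case.\<close>
    obtain \<phi> :: "nat \<Rightarrow> nat" where \<phi>: "strict_mono \<phi>" "\<And>i j. i < j \<Longrightarrow> emb (x (\<phi> i)) (x (\<phi> j))"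
      using ascending_subsequence[of S emb x, OF good xS] by blast
    from good[of "\<lambda>i. y (\<phi> i)", OF yS] obtain i j where "i < j" "emb (y (\<phi> i)) (y (\<phi> j))" by blast
    then show False using nemb[of "\<phi> i" "\<phi> j"] xy \<phi> by (simp add: strict_mono_def)
  qed (use leaf nemb[of 0 1] emb_refl in simp_all)
qed

text \<open>Otherwise elements of \<open>X\<close> could be chosen one after another such that no
  earlier one embeds into a later one, against Kruskal's theorem.\<close>

lemma finite_basis:
  assumes fin: "finite L" "finite N" and X: "X \<subseteq> {P. over L N P}"
  shows "\<exists>B. finite B \<and> B \<subseteq> X \<and> (\<forall>Q\<in>X. \<exists>b\<in>B. emb b Q)"
proof (rule ccontr)
  assume "\<not> ?thesis"
  then have contr: "\<forall>B. \<not> (finite B \<and> B \<subseteq> X \<and> (\<forall>Q\<in>X. \<exists>b\<in>B. emb b Q))" unfolding not_ex .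
  have ex: "\<exists>Q. Q \<in> X \<and> (\<forall>b\<in>B. \<not> emb b Q)" if "finite B" "B \<subseteq> X" for B
    using spec[OF contr, of B] that by auto
  define c where "c B = (SOME Q. Q \<in> X \<and> (\<forall>b\<in>B. \<not> emb b Q))" for B
  have c: "c B \<in> X \<and> (\<forall>b\<in>B. \<not> emb b (c B))" if "finite B" "B \<subseteq> X" for B
    unfolding c_def using someI_ex[OF ex[OF that]] .
  define B where "B = rec_nat {} (\<lambda>_ B. insert (c B) B)"
  have B_Suc: "B 0 = {}" "\<And>n. B (Suc n) = insert (c (B n)) (B n)" by (simp_all add: B_def)
  have B: "finite (B n) \<and> B n \<subseteq> X" for n by (induction n) (auto simp: B_Suc c)
  have mem: "c (B i) \<in> B j" if "i < j" for i j
    using that by (induction j) (auto simp: B_Suc less_Suc_eq)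
  have "over L N (c (B i))" for i
    using c[of "B i"] B[of i] X by auto
  from kruskal[OF fin this] obtain i j where ij: "i < j" "emb (c (B i)) (c (B j))" by blast
  show False using c[of "B j"] B[of j] mem[OF ij(1)] ij(2) by simp
qed

section \<open>Recognising upward closed sets by finite algebras\<close>

primrec tops :: "proc \<Rightarrow> proc set" where
  "tops (Loc a P) = insert (Loc a P) (tops P)"
| "tops (Par P Q) = insert (Par P Q) (tops P \<union> tops Q)"
| "tops (Sum bs) = {Sum bs}"
| "tops (Repl p P) = {Repl p P}"
| "tops Hole = {Hole}"
| "tops Star = {Star}"

lemma finite_tops: "finite (tops P)"
  by (induction P rule: proc_top_induct) auto

lemma self_tops: "P \<in> tops P"
  by (induction P rule: proc_top_induct) auto

lemma tops_closed:
  "Loc a t \<in> tops P \<Longrightarrow> t \<in> tops P" "Par u v \<in> tops P \<Longrightarrow> u \<in> tops P \<and> v \<in> tops P"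
  by (induction P rule: proc_top_induct) (auto simp: self_tops)

text \<open>Equality of values is a congruence because whether \<open>t\<close> embeds into
  \<open>Loc a P\<close> or \<open>Par P Q\<close> depends only on embeddings of \<open>t\<close>
  and its arguments into the components, and \<open>F\<close> is closed under arguments. The values
  are numbered below \<open>n\<close> to make the operations storable in tables.\<close>

theorem recognisable:
  assumes fin: "finite L" "finite N" "finite I"
    and up: "\<And>i P Q. i \<in> I \<Longrightarrow> X i P \<Longrightarrow> P \<sqsubseteq> Q \<Longrightarrow> X i Q"
  shows "\<exists>(\<phi> :: proc \<Rightarrow> nat) n. \<phi> ` {P. over L N P} = {..<n} \<and>
    (\<forall>P P' a. over L N P \<longrightarrow> over L N P' \<longrightarrow> \<phi> P = \<phi> P' \<longrightarrow> \<phi> (Loc a P) = \<phi> (Loc a P')) \<and>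
    (\<forall>P P' Q Q'. over L N P \<longrightarrow> over L N P' \<longrightarrow> over L N Q \<longrightarrow> over L N Q' \<longrightarrow>
      \<phi> P = \<phi> P' \<longrightarrow> \<phi> Q = \<phi> Q' \<longrightarrow> \<phi> (Par P Q) = \<phi> (Par P' Q')) \<and>
    (\<forall>i\<in>I. \<forall>P P'. over L N P \<longrightarrow> over L N P' \<longrightarrow> \<phi> P = \<phi> P' \<longrightarrow> X i P \<longrightarrow> X i P')"
proof -
  let ?A = "{P. over L N P}"
  define Y where "Y i = {P. over L N P \<and> X i P}" for i
  have Y: "Y i \<subseteq> {P. over L N P}" for i by (simp add: Y_def Collect_mono)
  define B where "B i = (SOME B. finite B \<and> B \<subseteq> Y i \<and> (\<forall>Q\<in>Y i. \<exists>b\<in>B. emb b Q))" for i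
  have B': "finite (B i) \<and> B i \<subseteq> Y i \<and> (\<forall>Q\<in>Y i. \<exists>b\<in>B i. emb b Q)" for i
    unfolding B_def by (rule someI_ex) (rule finite_basis[OF fin(1,2) Y])
  have B: "finite (B i)" "B i \<subseteq> {P. over L N P \<and> X i P}"
    "over L N Q \<Longrightarrow> X i Q \<Longrightarrow> \<exists>b\<in>B i. emb b Q" for i Q
    using B'[of i] by (simp_all add: Y_def)
  define F where "F = (\<Union>i\<in>I. \<Union>b\<in>B i. tops b)"
  have finF: "finite F" unfolding F_def by (intro finite_UN_I fin(3) B(1) finite_tops)
  have BF: "b \<in> F" if "i \<in> I" "b \<in> B i" for i b
    unfolding F_def using that self_tops[of b] by (intro UN_I)
  have F1: "t \<in> F" if t: "Loc a t \<in> F" for a t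
  proof -
    obtain i b where "i \<in> I" "b \<in> B i" "Loc a t \<in> tops b" using t[unfolded F_def] by (elim UN_E)
    then show ?thesis unfolding F_def using tops_closed(1) by (intro UN_I)
  qed
  have F2: "u \<in> F \<and> v \<in> F" if t: "Par u v \<in> F" for u v
  proof -
    obtain i b where "i \<in> I" "b \<in> B i" "Par u v \<in> tops b" using t[unfolded F_def] by (elim UN_E)
    then have "u \<in> tops b" "v \<in> tops b" "i \<in> I" "b \<in> B i" using tops_closed(2)[of u v b] by simp_all
    then show ?thesis unfolding F_def by (intro conjI UN_I)
  qed
  define \<Phi> where "\<Phi> Q = {t \<in> F. emb t Q}" for Q
  have mem: "t \<in> \<Phi> Q \<longleftrightarrow> t \<in> F \<and> emb t Q" for t Q by (simp add: \<Phi>_def)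
  have same: "emb t P \<longleftrightarrow> emb t P'" if "\<Phi> P = \<Phi> P'" "t \<in> F" for t P P'
    using mem[of t P] mem[of t P'] that by simp
  have cLoc: "\<Phi> (Loc a P) = \<Phi> (Loc a P')" if e: "\<Phi> P = \<Phi> P'" for a P P'
  proof -
    have "emb t (Loc a P) \<longleftrightarrow> emb t (Loc a P')" if t: "t \<in> F" for t
    proof -
      have "emb u P \<longleftrightarrow> emb u P'" if "t = Loc a u" for u
        using same[OF e F1[of a u]] t that by simp
      then show ?thesis using same[OF e t] by auto
    qed
    then show ?thesis unfolding \<Phi>_def by (intro Collect_cong conj_cong refl)
  qed
  have cPar: "\<Phi> (Par P Q) = \<Phi> (Par P' Q')" if e: "\<Phi> P = \<Phi> P'" "\<Phi> Q = \<Phi> Q'" for P P' Q Q'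
  proof -
    have "emb t (Par P Q) \<longleftrightarrow> emb t (Par P' Q')" if t: "t \<in> F" for t
    proof -
      have "emb u P \<longleftrightarrow> emb u P'" "emb v Q \<longleftrightarrow> emb v Q'" if "t = Par u v" for u v
      proof -
        have uv: "u \<in> F" "v \<in> F" using F2[of u v] t that by simp_all
        show "emb u P \<longleftrightarrow> emb u P'" by (rule same[OF e(1) uv(1)])
        show "emb v Q \<longleftrightarrow> emb v Q'" by (rule same[OF e(2) uv(2)])
      qed
      then show ?thesis using same[OF e(1) t] same[OF e(2) t] by auto
    qed
    then show ?thesis unfolding \<Phi>_def by (intro Collect_cong conj_cong refl)
  qed
  have "finite (\<Phi> ` ?A)" by (rule finite_subset[of _ "Pow F"]) (auto simp: \<Phi>_def finF)
  from ex_bij_betw_finite_nat[OF this]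
  obtain h where h: "bij_betw h (\<Phi> ` ?A) {0..<card (\<Phi> ` ?A)}" by (elim exE)
  define \<phi> where "\<phi> Q = h (\<Phi> Q)" for Q
  have inj: "\<Phi> P = \<Phi> P'" if "over L N P" "over L N P'" "\<phi> P = \<phi> P'" for P P'
    using bij_betw_imp_inj_on[OF h, THEN inj_onD, of "\<Phi> P" "\<Phi> P'"] that unfolding \<phi>_def by simp
  show ?thesis
  proof (rule exI[of _ \<phi>], rule exI[of _ "card (\<Phi> ` ?A)"], intro conjI allI impI ballI)
    show "\<phi> ` ?A = {..<card (\<Phi> ` ?A)}"
      using bij_betw_imp_surj_on[OF h] unfolding \<phi>_def by (simp add: image_image atLeast0LessThan)
    show "\<phi> (Loc a P) = \<phi> (Loc a P')" if "over L N P" "over L N P'" "\<phi> P = \<phi> P'" for a P P'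
      using cLoc[OF inj[OF that]] by (simp add: \<phi>_def)
    show "\<phi> (Par P Q) = \<phi> (Par P' Q')"
      if "over L N P" "over L N P'" "over L N Q" "over L N Q'" "\<phi> P = \<phi> P'" "\<phi> Q = \<phi> Q'" for P P' Q Q'
      using cPar[OF inj[OF that(1,2,5)] inj[OF that(3,4,6)]] by (simp add: \<phi>_def)
    show "X i P'" if i: "i \<in> I" and o: "over L N P" "over L N P'" "\<phi> P = \<phi> P'" and x: "X i P" for i P P'
    proof -
      \<comment> \<open>A basis element belongs to \<open>F\<close>, so processes of equal value lie
        above the same basis elements.\<close>
      obtain b where b: "b \<in> B i" "emb b P" using B(3)[OF o(1) x] by (elim bexE)
      have "emb b P'" using same[OF inj[OF o] BF[OF i b(1)]] b(2) by simp
      moreover have "X i b" using b(1) B(2)[of i] by (auto simp: subset_iff)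
      ultimately show "X i P'" using up[OF i _ emb_le, of b P'] by simp
    qed
  qed
qed

section \<open>Enumeration of computations\<close>

section \<open>Computations are semidecidable\<close>

inductive pfill_rule :: "proc \<Rightarrow> (proc \<times> proc) list \<Rightarrow> proc \<times> proc \<Rightarrow> bool" for R ps where
  "(U, V) \<in> set ps \<Longrightarrow> pfill_rule R ps (Loc a U, Loc a V)"
| "(U, V) \<in> set ps \<Longrightarrow> (U', V') \<in> set ps \<Longrightarrow> pfill_rule R ps (Par U U', Par V V')"
| "pfill_rule R ps (Sum bs, Sum bs)"
| "pfill_rule R ps (Repl p P, Repl p P)"
| "pfill_rule R ps (Hole, R)"
| "pfill_rule R ps (Star, Star)"

lemma pfill_rule_sound: "derivable (pfill_rule R) c \<Longrightarrow> pfill R (fst c) = snd c"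
proof (induction rule: derivable.induct)
  case (derivableI ps c)
  have "pfill R U = V" if "(U, V) \<in> set ps" for U V using derivableI.IH[OF that] by simp
  with derivableI.hyps show ?case by cases simp_all
qed

lemma pfill_rule_complete: "derivable (pfill_rule R) (U, pfill R U)"
proof (induction U rule: proc_top_induct)
  case (Loc a P)
  show ?case
    unfolding pfill.simps
    by (rule derivableI[where R = "pfill_rule R", OF pfill_rule.intros(1)[where ps = "[(P, pfill R P)]"]]) (simp_all add: Loc)
next
  case (Par P Q)
  show ?case
    unfolding pfill.simps
    by (rule derivableI[where R = "pfill_rule R", OF pfill_rule.intros(2)[where ps = "[(P, pfill R P), (Q, pfill R Q)]"]])
      (use Par in auto)
next
  case (Sum bs)
  show ?case
    by (simp, rule derivableI[where R = "pfill_rule R", OF pfill_rule.intros(3)[where ps = "[]"]]) simp_all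
next
  case (Repl p P)
  show ?case
    by (simp, rule derivableI[where R = "pfill_rule R", OF pfill_rule.intros(4)[where ps = "[]"]]) simp_all
next
  case Hole
  show ?case
    by (simp, rule derivableI[where R = "pfill_rule R", OF pfill_rule.intros(5)[where ps = "[]"]]) simp_all
next
  case Star
  show ?case
    by (simp, rule derivableI[where R = "pfill_rule R", OF pfill_rule.intros(6)[where ps = "[]"]]) simp_all
qed

lemma semidec_pfill:
  assumes "computable f" "computable g" "computable h" shows "semidec (\<lambda>x. pfill (f x) (g x) = h x)"
proof -
  have "semidec (\<lambda>z :: proc \<times> (proc \<times> proc) list \<times> (proc \<times> proc). pfill_rule (fst z) (fst (snd z)) (snd (snd z)))"
    unfolding pfill_rule.simps by (intro semi_intros comp_intros)
  from semidec_comp[OF semidec_derivable[OF this], of "\<lambda>x. (f x, g x, h x)"]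
  have "semidec (\<lambda>x. derivable (pfill_rule (f x)) (g x, h x))" using assms by (simp add: comp_intros)
  moreover have "derivable (pfill_rule R) (U, V) \<longleftrightarrow> pfill R U = V" for R U V
    using pfill_rule_sound[of R "(U, V)"] pfill_rule_complete[of R U] by auto
  ultimately show ?thesis by simp
qed

lemma semidec_pref_label [semi_intros]:
  assumes "computable f" "computable g" shows "semidec (\<lambda>x. pref_label (f x) = g x)"
proof -
  have "semidec (\<lambda>x. (\<exists>e. f x = Act e \<and> g x = LAct e) \<or> (\<exists>a U. f x = Upd a U \<and> g x = LUpd a U))"
    by (intro semi_intros comp_intros computable_compose[OF assms(1)] computable_compose[OF assms(2)])
  moreover have "(\<exists>e. p = Act e \<and> l = LAct e) \<or> (\<exists>a U. p = Upd a U \<and> l = LUpd a U) \<longleftrightarrow> pref_label p = l" for p l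
    by (cases p) auto
  ultimately show ?thesis by simp
qed

lemma semidec_co [semi_intros]:
  assumes "computable f" "computable g" shows "semidec (\<lambda>x. co (f x) (g x))"
  unfolding co.simps
  by (intro semi_intros comp_intros computable_compose[OF assms(1)] computable_compose[OF assms(2)])

text \<open>\<open>pref_label\<close> and \<open>pfill\<close> occur only in equations, as premises:
  their graphs are known to be semidecidable, while their computability has not been
  established.\<close>

inductive trn_rule :: "(proc \<times> label \<times> proc) list \<Rightarrow> proc \<times> label \<times> proc \<Rightarrow> bool" for ps where
  "(p, P) \<in> set bs \<Longrightarrow> pref_label p = l \<Longrightarrow> trn_rule ps (Sum bs, l, P)"
| "pref_label p = l \<Longrightarrow> trn_rule ps (Repl p P, l, Par P (Repl p P))"
| "pfill R U = V \<Longrightarrow> trn_rule ps (Loc a R, LLoc a U, V)"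
| "(P, l, P') \<in> set ps \<Longrightarrow> trn_rule ps (Loc a P, l, Loc a P')"
| "(P, l, P') \<in> set ps \<Longrightarrow> trn_rule ps (Par P Q, l, Par P' Q)"
| "(P, l, P') \<in> set ps \<Longrightarrow> trn_rule ps (Par Q P, l, Par Q P')"
| "(P, l, P') \<in> set ps \<Longrightarrow> (Q, m, Q') \<in> set ps \<Longrightarrow> co l m \<Longrightarrow> trn_rule ps (Par P Q, Tau, Par P' Q')"
| "(P, l, P') \<in> set ps \<Longrightarrow> (Q, m, Q') \<in> set ps \<Longrightarrow> co l m \<Longrightarrow> trn_rule ps (Par Q P, Tau, Par Q' P')"

lemma trn_rule_sound: "derivable trn_rule c \<Longrightarrow> trn (fst c) (fst (snd c)) (snd (snd c))"
proof (induction rule: derivable.induct)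
  case (derivableI ps c)
  have IH: "trn P l P'" if "(P, l, P') \<in> set ps" for P l P' using derivableI.IH[OF that] by simp
  from derivableI.hyps show ?case
  proof cases
    case (7 P l P' Q m Q')
    then show ?thesis using trn_com1[OF IH IH] by simp
  next
    case (8 P l P' Q m Q')
    then show ?thesis using trn_com2[OF IH IH] by simp
  qed (auto simp: IH intro: trn_sum trn_repl trn_upd trn_loc trn_par1 trn_par2)
qed

lemma trn_rule_complete: "trn P l P' \<Longrightarrow> derivable trn_rule (P, l, P')"
proof (induction rule: trn.induct)
  case (trn_sum p P bs)
  show ?case by (rule derivableI[where R = trn_rule, OF trn_rule.intros(1)[where ps = "[]"]]) (simp_all add: trn_sum)
next
  case (trn_repl p P)
  show ?case by (rule derivableI[where R = trn_rule, OF trn_rule.intros(2)[where ps = "[]"]]) simp_all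
next
  case (trn_upd a R U)
  show ?case by (rule derivableI[where R = trn_rule, OF trn_rule.intros(3)[where ps = "[]"]]) simp_all
next
  case (trn_loc P l P' a)
  show ?case by (rule derivableI[where R = trn_rule, OF trn_rule.intros(4)[where ps = "[(P, l, P')]"]]) (simp_all add: trn_loc)
next
  case (trn_par1 P l P' Q)
  show ?case by (rule derivableI[where R = trn_rule, OF trn_rule.intros(5)[where ps = "[(P, l, P')]"]]) (simp_all add: trn_par1)
next
  case (trn_par2 P l P' Q)
  show ?case by (rule derivableI[where R = trn_rule, OF trn_rule.intros(6)[where ps = "[(P, l, P')]"]]) (simp_all add: trn_par2)
next
  case (trn_com1 P l P' Q m Q')
  show ?case
    by (rule derivableI[where R = trn_rule, OF trn_rule.intros(7)[where ps = "[(P, l, P'), (Q, m, Q')]" and l = l and m = m]])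
      (use trn_com1 in auto)
next
  case (trn_com2 P l P' Q m Q')
  show ?case
    by (rule derivableI[where R = trn_rule, OF trn_rule.intros(8)[where ps = "[(P, l, P'), (Q, m, Q')]" and l = l and m = m]])
      (use trn_com2 in auto)
qed

lemma semidec_trn [semi_intros]:
  assumes "computable f" "computable g" "computable h" shows "semidec (\<lambda>x. trn (f x) (g x) (h x))"
proof -
  have "semidec (\<lambda>z :: nat \<times> (proc \<times> label \<times> proc) list \<times> (proc \<times> label \<times> proc).
      trn_rule (fst (snd z)) (snd (snd z)))"
    unfolding trn_rule.simps by (intro semi_intros comp_intros semidec_pfill)
  then have "semidec (\<lambda>z :: nat \<times> (proc \<times> label \<times> proc). derivable trn_rule (snd z))"
    by (rule semidec_derivable)
  from semidec_comp[OF this, of "\<lambda>x. (0, f x, g x, h x)"]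
  have "semidec (\<lambda>x. derivable trn_rule (f x, g x, h x))" using assms by (simp add: comp_intros)
  moreover have "derivable trn_rule (P, l, P') \<longleftrightarrow> trn P l P'" for P l P'
    using trn_rule_sound[of "(P, l, P')"] trn_rule_complete[of P l P'] by auto
  ultimately show ?thesis by simp
qed

text \<open>Only relations with a closure rule appear on the right, hence \<open>1 < i\<close> in
  place of \<open>2 \<le> i\<close>.\<close>

lemma stg_iff: "stg Ms e s t \<longleftrightarrow>
    (\<exists>Q R. Q \<in> set Ms \<and> s = (0, R) \<and> t = (0, Par R Q)) \<or> (\<exists>R. s = (0, R) \<and> t = (1, R)) \<or>
    (\<exists>R R'. s = (1, R) \<and> t = (1, R') \<and> trn R Tau R') \<or>
    (\<exists>R R'. s = (1, R) \<and> t = (2, R) \<and> trn R (LAct e) R') \<or>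
    (\<exists>i R R' R''. s = (i, R) \<and> t = (Suc i, R') \<and> 1 < i \<and> trn R Tau R' \<and> trn R' (LAct e) R'')"
  unfolding stg.simps[of Ms e s t] by (simp add: Suc_le_eq numeral_2_eq_2) blast

definition stages_rule :: "proc list \<times> act \<times> (nat \<times> proc) \<Rightarrow> (nat \<times> proc) list \<Rightarrow> nat \<times> proc \<Rightarrow> bool" where
  "stages_rule x ps c \<longleftrightarrow> c = snd (snd x) \<or> (\<exists>d\<in>set ps. stg (fst x) (fst (snd x)) d c)"

lemma derivable_stages: "derivable (stages_rule (Ms, e, s)) t \<longleftrightarrow> stages Ms e s t"
proof
  assume "derivable (stages_rule (Ms, e, s)) t"
  then show "stages Ms e s t"
  proof (induction rule: derivable.induct)
    case (derivableI ps c)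
    from derivableI.hyps(1) have "c = s \<or> (\<exists>d\<in>set ps. stg Ms e d c)" by (simp add: stages_rule_def)
    then show ?case
    proof (elim disjE bexE)
      fix d assume "d \<in> set ps" "stg Ms e d c"
      then show ?thesis using derivableI.IH[of d] by (simp add: rtranclp.rtrancl_into_rtrancl)
    qed simp
  qed
next
  assume "stages Ms e s t"
  then show "derivable (stages_rule (Ms, e, s)) t"
  proof (induction rule: rtranclp_induct)
    case base
    show ?case by (rule derivableI[where ps = "[]"]) (simp_all add: stages_rule_def)
  next
    case (step t u)
    show ?case
      by (rule derivableI[where ps = "[t]"]) (use step in \<open>simp_all add: stages_rule_def\<close>)
  qed
qed

lemma semidec_wins:
  "semidec (\<lambda>x :: problem_inst. wins (fst (snd x)) (fst (snd (snd x))) (snd (snd (snd x))) 0 (fst x))"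
proof -
  have "semidec (\<lambda>z :: (proc list \<times> act \<times> (nat \<times> proc)) \<times> (nat \<times> proc) list \<times> (nat \<times> proc).
      stages_rule (fst z) (fst (snd z)) (snd (snd z)))"
    unfolding stages_rule_def stg_iff by (intro semi_intros comp_intros)
  then have D: "semidec (\<lambda>z. derivable (stages_rule (fst z)) (snd z))" by (rule semidec_derivable)
  have "semidec (\<lambda>y :: problem_inst \<times> proc.
      derivable (stages_rule (fst (snd (fst y)), fst (snd (snd (fst y))), (0, fst (fst y))))
        (Suc (snd (snd (snd (fst y)))), snd y))"
    by (rule semidec_comp[OF D, of "\<lambda>y. ((fst (snd (fst y)), fst (snd (snd (fst y))), (0, fst (fst y))),
      (Suc (snd (snd (snd (fst y)))), snd y))", unfolded fst_conv snd_conv]) (intro comp_intros)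
  then have "semidec (\<lambda>x :: problem_inst. \<exists>R. derivable (stages_rule (fst (snd x), fst (snd (snd x)), (0, fst x)))
      (Suc (snd (snd (snd x))), R))"
    by (rule semidec_ex)
  then show ?thesis unfolding wins_def derivable_stages .
qed

section \<open>Soundness of certificates\<close>

section \<open>Finite abstractions\<close>

text \<open>
  \<open>v h U\<close> is the value of the pattern \<open>U\<close> when its holes have value \<open>h\<close>, \<open>T l\<close> the abstract
  transition relation and \<open>G i\<close> the abstract states reachable in stage \<open>i\<close>. Every condition is
  bounded, so that the whole is semidecidable in the tables.
\<close>

locale abstraction =
  fixes n :: nat and par :: "nat \<Rightarrow> nat \<Rightarrow> nat" and loc :: "name \<Rightarrow> nat \<Rightarrow> nat"
    and v :: "nat \<Rightarrow> proc \<Rightarrow> nat" and T :: "label \<Rightarrow> nat \<Rightarrow> nat \<Rightarrow> bool" and G :: "nat \<Rightarrow> nat \<Rightarrow> bool"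
    and Sub :: "proc list" and Ns :: "name list" and Ls :: "label list"
    and P :: proc and Ms :: "proc list" and e :: act and k :: nat
  assumes pos: "0 < n"
    and par_less: "\<forall>x<n. \<forall>y<n. par x y < n"
    and loc_less: "\<forall>a\<in>set Ns. \<forall>x<n. loc a x < n"
    and pattern: "\<forall>U\<in>set Sub. \<forall>h<n. v h U < n \<and>
      ((\<exists>a V. U = Loc a V \<and> a \<in> set Ns \<and> V \<in> set Sub \<and> v h U = loc a (v h V)) \<or>
       (\<exists>V W. U = Par V W \<and> V \<in> set Sub \<and> W \<in> set Sub \<and> v h U = par (v h V) (v h W)) \<or>
       (\<exists>bs. U = Sum bs \<and> v h U = v 0 U) \<or>
       (\<exists>p V. U = Repl p V \<and> v h U = v 0 U) \<or>
       (U = Hole \<and> v h U = h))"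
    and sum: "\<forall>U\<in>set Sub. (\<exists>bs. U = Sum bs \<and> (\<forall>b\<in>set bs. snd b \<in> set Sub \<and>
        (\<exists>l. pref_label (fst b) = l \<and> l \<in> set Ls \<and> T l (v 0 U) (v 0 (snd b))))) \<or>
      (\<exists>a V. U = Loc a V) \<or> (\<exists>V W. U = Par V W) \<or> (\<exists>p V. U = Repl p V) \<or> U = Hole"
    and repl: "\<forall>U\<in>set Sub. (\<exists>p V. U = Repl p V \<and> V \<in> set Sub \<and>
        (\<exists>l. pref_label p = l \<and> l \<in> set Ls \<and> T l (v 0 U) (par (v 0 V) (v 0 U)))) \<or>
      (\<exists>a V. U = Loc a V) \<or> (\<exists>V W. U = Par V W) \<or> (\<exists>bs. U = Sum bs) \<or> U = Hole"
    and cong: "\<forall>l\<in>set Ls. \<forall>x<n. \<forall>y<n. T l x y \<longrightarrow>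
      (\<forall>z<n. T l (par x z) (par y z) \<and> T l (par z x) (par z y)) \<and> (\<forall>a\<in>set Ns. T l (loc a x) (loc a y))"
    and com: "\<forall>l\<in>set Ls. (\<exists>m. co l m \<and> (\<forall>x<n. \<forall>x'<n. \<forall>y<n. \<forall>y'<n. T l x x' \<longrightarrow> T m y y' \<longrightarrow>
        T Tau (par x y) (par x' y') \<and> T Tau (par y x) (par y' x'))) \<or>
      (\<exists>a. l = LAct (Out a)) \<or> (\<exists>a U. l = LUpd a U) \<or> l = Tau"
    and upd: "\<forall>l\<in>set Ls. (\<exists>a U. l = LUpd a U \<and> U \<in> set Sub \<and> LLoc a U \<in> set Ls \<and>
        (\<forall>z<n. T (LLoc a U) (loc a z) (v z U))) \<or>
      (\<exists>c. l = LAct c) \<or> (\<exists>a U. l = LLoc a U) \<or> l = Tau"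
    and init: "P \<in> set Sub" "\<forall>Q\<in>set Ms. Q \<in> set Sub" "Tau \<in> set Ls" "LAct e \<in> set Ls"
    and stage0: "G 0 (v 0 P)"
      "\<forall>x<n. G 0 x \<longrightarrow> (\<forall>Q\<in>set Ms. G 0 (par x (v 0 Q))) \<and> G 1 x"
    and stage1: "\<forall>x<n. \<forall>y<n. G 1 x \<longrightarrow> (T Tau x y \<longrightarrow> G 1 y) \<and> (T (LAct e) x y \<longrightarrow> G 2 x)"
    and stage2: "\<forall>i<Suc k. i < 2 \<or> (\<forall>x<n. \<forall>y<n. \<forall>z<n. G i x \<longrightarrow> T Tau x y \<longrightarrow> T (LAct e) y z \<longrightarrow> G (Suc i) y)"
    and safe: "\<forall>x<n. \<not> G (Suc k) x"
begin

text \<open>No hole of a prefixed leaf can be filled, so its value is read off at hole value 0. The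
  value 0 of \<open>Hole\<close> makes \<open>ev\<close> agree with \<open>v 0\<close> on all of
  \<open>Sub\<close>, where patterns may contain holes.\<close>

primrec ev :: "proc \<Rightarrow> nat" where
  "ev (Loc a Q) = loc a (ev Q)"
| "ev (Par Q R) = par (ev Q) (ev R)"
| "ev (Sum bs) = v 0 (Sum bs)"
| "ev (Repl p Q) = v 0 (Repl p Q)"
| "ev Hole = 0"
| "ev Star = 0"

abbreviation "ok \<equiv> over (set Sub) (set Ns)"

lemma patternD:
  assumes "U \<in> set Sub" "h < n"
  shows "v h U < n"
    and "U = Loc a V \<Longrightarrow> a \<in> set Ns \<and> V \<in> set Sub \<and> v h U = loc a (v h V)"
    and "U = Par V W \<Longrightarrow> V \<in> set Sub \<and> W \<in> set Sub \<and> v h U = par (v h V) (v h W)"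
    and "U = Sum bs \<Longrightarrow> v h U = v 0 U"
    and "U = Repl p V \<Longrightarrow> v h U = v 0 U"
    and "U = Hole \<Longrightarrow> v h U = h"
    and "U \<noteq> Star"
  using bspec[OF pattern assms(1), THEN spec, THEN mp, OF assms(2)] by auto

lemma ok_ev_less: "ok Q \<Longrightarrow> ev Q < n"
proof (induction Q rule: proc_top_induct)
  case (Loc a P)
  then show ?case using loc_less by simp
next
  case (Par P Q)
  then show ?case using par_less by simp
qed (use pos patternD(1)[OF _ pos] in auto)

lemma ev_pfill: "U \<in> set Sub \<Longrightarrow> ok R \<Longrightarrow> ok (pfill R U) \<and> ev (pfill R U) = v (ev R) U"
proof (induction U rule: proc_top_induct)
  case (Loc a U)
  then show ?case using patternD(2)[OF Loc.prems(1) ok_ev_less[OF Loc.prems(2)] refl] by simp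
next
  case (Par U V)
  then show ?case using patternD(3)[OF Par.prems(1) ok_ev_less[OF Par.prems(2)] refl] by simp
next
  case (Sum bs)
  then show ?case using patternD(4)[OF Sum.prems(1) ok_ev_less[OF Sum.prems(2)] refl] by simp
next
  case (Repl p U)
  then show ?case using patternD(5)[OF Repl.prems(1) ok_ev_less[OF Repl.prems(2)] refl] by simp
next
  case Hole
  then show ?case using patternD(6)[OF Hole.prems(1) ok_ev_less[OF Hole.prems(2)] refl] by simp
next
  case Star
  then show ?case using patternD(7)[OF Star.prems(1) pos] by simp
qed

lemma ev_Sub: "U \<in> set Sub \<Longrightarrow> ok U \<and> ev U = v 0 U"
proof (induction U rule: proc_top_induct)
  case (Loc a U)
  then show ?case using patternD(2)[OF Loc.prems pos refl] by simp
next
  case (Par U V)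
  then show ?case using patternD(3)[OF Par.prems pos refl] by simp
next
  case Hole
  then show ?case using patternD(6)[OF Hole.prems pos refl] by simp
next
  case Star
  then show ?case using patternD(7)[OF Star.prems pos] by simp
qed simp_all

lemma T_com:
  assumes "co l m" "l \<in> set Ls" "T l x x'" "T m y y'" "x < n" "x' < n" "y < n" "y' < n"
  shows "T Tau (par x y) (par x' y')" "T Tau (par y x) (par y' x')"
proof -
  have "m' = m" if "co l m'" for m' using assms(1) that by (auto simp: co.simps)
  moreover have "\<not> ((\<exists>a. l = LAct (Out a)) \<or> (\<exists>a U. l = LUpd a U) \<or> l = Tau)"
    using assms(1) by (auto simp: co.simps)
  ultimately have "\<forall>x<n. \<forall>x'<n. \<forall>y<n. \<forall>y'<n. T l x x' \<longrightarrow> T m y y' \<longrightarrow>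
      T Tau (par x y) (par x' y') \<and> T Tau (par y x) (par y' x')"
    using bspec[OF com assms(2)] by metis
  then show "T Tau (par x y) (par x' y')" "T Tau (par y x) (par y' x')" using assms(3-) by blast+
qed

text \<open>\<open>trn_upd\<close> offers every pattern whatsoever, while the tables know only
  finitely many. In a communication the proviso is always met, because the label
  \<open>LUpd a U\<close> of the partner lies in \<open>Ls\<close>.\<close>

definition updatable :: "name \<Rightarrow> proc \<Rightarrow> bool" where
  "updatable a U \<longleftrightarrow> U \<in> set Sub \<and> LLoc a U \<in> set Ls \<and> (\<forall>z<n. T (LLoc a U) (loc a z) (v z U))"

lemma trn_abstract:
  "trn Q l Q' \<Longrightarrow> ok Q \<Longrightarrow> (\<And>a U. l = LLoc a U \<Longrightarrow> updatable a U) \<Longrightarrow>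
    ok Q' \<and> l \<in> set Ls \<and> T l (ev Q) (ev Q')"
proof (induction rule: trn.induct)
  case (trn_sum p R bs)
  then have "Sum bs \<in> set Sub" by simp
  from bspec[OF sum this] have "R \<in> set Sub \<and> pref_label p \<in> set Ls \<and> T (pref_label p) (v 0 (Sum bs)) (v 0 R)"
    using trn_sum.hyps by auto
  then show ?case using ev_Sub[of R] by simp
next
  case (trn_repl p R)
  then have S: "Repl p R \<in> set Sub" by simp
  from bspec[OF repl this] have "R \<in> set Sub \<and> pref_label p \<in> set Ls \<and>
      T (pref_label p) (v 0 (Repl p R)) (par (v 0 R) (v 0 (Repl p R)))" by auto
  then show ?case using ev_Sub[of R] S by simp
next
  case (trn_upd a R U)
  then have U: "updatable a U" and R: "ok R" by simp_all
  then have "U \<in> set Sub" "LLoc a U \<in> set Ls" "T (LLoc a U) (loc a (ev R)) (v (ev R) U)"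
    using ok_ev_less[OF R] by (simp_all add: updatable_def)
  then show ?case using ev_pfill[OF _ R] by simp
next
  case (trn_loc R l R' a)
  then have R: "ok R" "ok R'" "l \<in> set Ls" "T l (ev R) (ev R')" "a \<in> set Ns" by simp_all
  then have "T l (loc a (ev R)) (loc a (ev R'))" using cong ok_ev_less by blast
  then show ?case using R by simp
next
  case (trn_par1 R l R' S)
  then have R: "ok R" "ok R'" "ok S" "l \<in> set Ls" "T l (ev R) (ev R')" by simp_all
  then have "T l (par (ev R) (ev S)) (par (ev R') (ev S))" using cong ok_ev_less by blast
  then show ?case using R by simp
next
  case (trn_par2 R l R' S)
  then have R: "ok R" "ok R'" "ok S" "l \<in> set Ls" "T l (ev R) (ev R')" by simp_all
  then have "T l (par (ev S) (ev R)) (par (ev S) (ev R'))" using cong ok_ev_less by blast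
  then show ?case using R by simp
next
  case (trn_com1 R l R' S m S')
  \<comment> \<open>The sending or updating side is treated first: its label certifies that the
    pattern demanded of the other side is known to the tables.\<close>
  have m: "ok S' \<and> m \<in> set Ls \<and> T m (ev S) (ev S')"
    using trn_com1.IH(2) trn_com1.prems(1) trn_com1.hyps(3) by (auto elim: co.cases)
  have "updatable a U" if "l = LLoc a U" for a U
  proof -
    have "m = LUpd a U" using trn_com1.hyps(3) that by (auto elim: co.cases)
    then show ?thesis using bspec[OF upd, of m] m by (auto simp: updatable_def)
  qed
  then have l: "ok R' \<and> l \<in> set Ls \<and> T l (ev R) (ev R')"
    using trn_com1.IH(1) trn_com1.prems(1) by simp
  have "T Tau (par (ev R) (ev S)) (par (ev R') (ev S'))"
    using T_com(1)[OF trn_com1.hyps(3)] l m trn_com1.prems(1) ok_ev_less by simp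
  then show ?case using l m init by simp
next
  case (trn_com2 R l R' S m S')
  have m: "ok S' \<and> m \<in> set Ls \<and> T m (ev S) (ev S')"
    using trn_com2.IH(2) trn_com2.prems(1) trn_com2.hyps(3) by (auto elim: co.cases)
  have "updatable a U" if "l = LLoc a U" for a U
  proof -
    have "m = LUpd a U" using trn_com2.hyps(3) that by (auto elim: co.cases)
    then show ?thesis using bspec[OF upd, of m] m by (auto simp: updatable_def)
  qed
  then have l: "ok R' \<and> l \<in> set Ls \<and> T l (ev R) (ev R')"
    using trn_com2.IH(1) trn_com2.prems(1) by simp
  have "T Tau (par (ev S) (ev R)) (par (ev S') (ev R'))"
    using T_com(2)[OF trn_com2.hyps(3)] l m trn_com2.prems(1) ok_ev_less by simp
  then show ?case using l m init by simp
qed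

lemma trn_abstract':
  assumes "trn Q l Q'" "ok Q" "l = Tau \<or> l = LAct e" shows "ok Q' \<and> T l (ev Q) (ev Q')"
  using trn_abstract[OF assms(1,2)] assms(3) by auto

text \<open>The bound \<open>fst t \<le> k\<close> belongs to the invariant because
  \<open>stage2\<close> covers stages up to \<open>k\<close> only. It survives each step since
  \<open>safe\<close> leaves stage \<open>Suc k\<close> without abstract states;
  \<open>1 \<le> k\<close> keeps stage 1 within the bound.\<close>

lemma stages_abstract:
  assumes k: "1 \<le> k"
  shows "stages Ms e (0, P) t \<Longrightarrow> ok (snd t) \<and> fst t \<le> k \<and> G (fst t) (ev (snd t))"
proof (induction rule: rtranclp_induct)
  case base
  show ?case using ev_Sub[OF init(1)] stage0(1) by simp
next
  case (step t u)
  then have t: "ok (snd t)" "fst t \<le> k" "G (fst t) (ev (snd t))" by simp_all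
  have safe': "i \<noteq> Suc k" if "G i (ev Q)" "ok Q" for i Q using safe ok_ev_less[OF that(2)] that(1) by blast
  from step.hyps(2) show ?case
  proof cases
    case (stg_add Q R)
    then have "G 0 (par (ev R) (v 0 Q))" using stage0(2) t ok_ev_less[of R] by simp
    then show ?thesis using stg_add t ev_Sub[of Q] init(2) by simp
  next
    case (stg_run R)
    then have "G 1 (ev R)" using stage0(2) t ok_ev_less[of R] by simp
    then show ?thesis using stg_run t k by simp
  next
    case (stg_red R R')
    have R: "ok R" "G 1 (ev R)" using stg_red(1) t by simp_all
    have R': "ok R' \<and> T Tau (ev R) (ev R')" using trn_abstract'[OF stg_red(3) R(1)] by simp
    then have "G 1 (ev R')" using stage1 R ok_ev_less[of R] ok_ev_less[of R'] by blast
    then show ?thesis using stg_red R' k by simp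
  next
    case (stg_barb R R')
    have R: "ok R" "G 1 (ev R)" using stg_barb(1) t by simp_all
    have R': "ok R' \<and> T (LAct e) (ev R) (ev R')" using trn_abstract'[OF stg_barb(3) R(1)] by simp
    then have "G 2 (ev R)" using stage1 R ok_ev_less[of R] ok_ev_less[of R'] by blast
    then show ?thesis using stg_barb R(1) k safe'[of 2 R] by simp
  next
    case (stg_next i R R' R'')
    have R: "ok R" "G i (ev R)" "i \<le> k" using stg_next(1) t by simp_all
    have R': "ok R'" "T Tau (ev R) (ev R')" using trn_abstract'[OF stg_next(4) R(1)] by simp_all
    have R'': "ok R''" "T (LAct e) (ev R') (ev R'')" using trn_abstract'[OF stg_next(5) R'(1)] by simp_all
    have "i < Suc k" "\<not> i < 2" using R(3) stg_next(3) by simp_all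
    then have "G (Suc i) (ev R')"
      using stage2 R R' R'' ok_ev_less[OF R(1)] ok_ev_less[OF R'(1)] ok_ev_less[OF R''(1)] by blast
    then show ?thesis using stg_next(2) R'(1) R(3) safe'[of "Suc i" R'] by simp
  qed
qed

lemma not_wins: "1 \<le> k \<Longrightarrow> \<not> wins Ms e k 0 P"
  unfolding wins_def using stages_abstract by fastforce

end

text \<open>The outer quantifiers range over numbers and lists of coded types, so they amount to a
  search. Inside, shapes of terms are distinguished by disjunctions of existentials, as there is no
  closure rule for universal quantifiers over all processes. Truth is the table entry 1, whose
  negation is an inequation.\<close>

definition certified :: "problem_inst \<Rightarrow> bool" where
  "certified x \<longleftrightarrow> (\<exists>n tp tl tv tT tG Sub Ns Ls. abstraction n (\<lambda>x y. lookup tp (x, y)) (\<lambda>a x. lookup tl (a, x))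
     (\<lambda>h U. lookup tv (h, U)) (\<lambda>l x y. lookup tT (l, x, y) = 1) (\<lambda>i x. lookup tG (i, x) = 1) Sub Ns Ls
     (fst x) (fst (snd x)) (fst (snd (snd x))) (snd (snd (snd x))))"

lemma semidec_certified: "semidec certified"
  unfolding certified_def[abs_def] abstraction_def
  by (intro semi_intros comp_intros)

section \<open>Completeness of certificates\<close>

section \<open>Every safe instance has a finite abstraction\<close>

text \<open>In contrast to \<open>tops\<close> this descends below prefixes and into update
  patterns, because transitions can bring these terms to the surface.\<close>

inductive part :: "proc \<Rightarrow> proc \<Rightarrow> bool" where
  "part (Loc a P) P"
| "part (Par P Q) P"
| "part (Par P Q) Q"
| "(p, P) \<in> set bs \<Longrightarrow> part (Sum bs) P"
| "(Upd a U, P) \<in> set bs \<Longrightarrow> part (Sum bs) U"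
| "part (Repl p P) P"
| "part (Repl (Upd a U) P) U"

lemma size_Sum: "b \<in> set bs \<Longrightarrow> size (fst b) + size (snd b) < size (Sum bs)"
  by (induction bs) auto

lemma size_part: "part P Q \<Longrightarrow> size Q < size P"
proof (induction rule: part.induct)
  case (4 p P bs)
  from size_Sum[OF this] show ?case by simp
next
  case (5 a U P bs)
  from size_Sum[OF this] show ?case by simp
qed simp_all

lemma finite_part: "finite {Q. part P Q}"
proof -
  define pat where "pat p = (case p of Upd a U \<Rightarrow> {U} | _ \<Rightarrow> {})" for p
  have fin: "finite (pat p)" for p by (simp add: pat_def split: pref.split)
  have "{Q. part P Q} \<subseteq> (case P of Loc a Q \<Rightarrow> {Q} | Par Q R \<Rightarrow> {Q, R} |
      Sum bs \<Rightarrow> snd ` set bs \<union> (\<Union>b\<in>set bs. pat (fst b)) | Repl p Q \<Rightarrow> insert Q (pat p) | _ \<Rightarrow> {})" (is "_ \<subseteq> ?F")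
  proof
    fix Q assume "Q \<in> {Q. part P Q}"
    then have "part P Q" by simp
    then show "Q \<in> ?F" by cases (force simp: pat_def)+
  qed
  moreover have "finite ?F" by (simp add: fin split: proc.split)
  ultimately show ?thesis by (rule finite_subset)
qed

lemma finite_part_closure: "finite {Q. part\<^sup>*\<^sup>* P Q}"
proof (induction P rule: measure_induct_rule[of size])
  case (less P)
  have "{Q. part\<^sup>*\<^sup>* P Q} \<subseteq> insert P (\<Union>R\<in>{R. part P R}. {Q. part\<^sup>*\<^sup>* R Q})"
    by (auto elim: converse_rtranclpE)
  moreover have "finite (insert P (\<Union>R\<in>{R. part P R}. {Q. part\<^sup>*\<^sup>* R Q}))"
    using less size_part by (simp add: finite_part)
  ultimately show ?case by (rule finite_subset)
qed

inductive_simps Ed2_pat_simps: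
  "Ed2_pat (Loc a P)" "Ed2_pat (Par P Q)" "Ed2_pat (Sum bs)" "Ed2_pat (Repl p P)" "Ed2_pat Star"

text \<open>The invariant is \<open>Ed2_pat\<close> instead of \<open>Ed2\<close>, since parts of an
  update pattern may contain holes.\<close>

lemma Ed2_pat_part: "part P Q \<Longrightarrow> Ed2_pat P \<Longrightarrow> Ed2_pat Q"
  by (induction rule: part.induct) (fastforce simp: Ed2_pat_simps intro: Ed2_Ed2_pat_Ed2_pref.intros(7))+

fun pref_names :: "pref \<Rightarrow> name set" where
  "pref_names (Act e) = {}"
| "pref_names (Upd a U) = {a}"

fun top_names :: "proc \<Rightarrow> name set" where
  "top_names (Loc a P) = {a}"
| "top_names (Sum bs) = (\<Union>b\<in>set bs. pref_names (fst b))"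
| "top_names (Repl p P) = pref_names p"
| "top_names _ = {}"

text \<open>Both polarities are included to make the finite set of labels closed under
  \<open>co\<close>; \<open>pref_labels\<close> pairs \<open>LUpd\<close> with \<open>LLoc\<close>
  for the same reason.\<close>

fun act_labels :: "act \<Rightarrow> label set" where
  "act_labels (Inp a) = {LAct (Inp a), LAct (Out a)}"
| "act_labels (Out a) = {LAct (Inp a), LAct (Out a)}"

fun pref_labels :: "pref \<Rightarrow> label set" where
  "pref_labels (Act e) = act_labels e"
| "pref_labels (Upd a U) = {LUpd a U, LLoc a U}"

fun top_labels :: "proc \<Rightarrow> label set" where
  "top_labels (Sum bs) = (\<Union>b\<in>set bs. pref_labels (fst b))"
| "top_labels (Repl p P) = pref_labels p"
| "top_labels _ = {}"

lemma finite_act_labels: "finite (act_labels e)"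
  by (cases e) simp_all

lemma finite_pref: "finite (pref_names p)" "finite (pref_labels p)"
  by (cases p; simp add: finite_act_labels)+

lemma finite_top: "finite (top_names P)" "finite (top_labels P)"
  by (cases P; simp add: finite_pref)+

lemma LAct_act_labels: "LAct e \<in> act_labels e"
  by (cases e) simp_all

lemma pref_label_in: "pref_label p \<in> pref_labels p"
  by (cases p) (simp_all add: LAct_act_labels)

lemma act_labels_LAct: "l \<in> act_labels e \<Longrightarrow> \<exists>c. l = LAct c"
  by (cases e) auto

lemma co_act_labels: "l \<in> act_labels e \<Longrightarrow> co l m \<Longrightarrow> m \<in> act_labels e"
  by (cases e) (auto simp: co.simps)

lemma co_pref_labels: "l \<in> pref_labels p \<Longrightarrow> co l m \<Longrightarrow> m \<in> pref_labels p"
  by (cases p) (auto simp: co.simps co_act_labels)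

lemma wins_step: "stg Ms e (i, R) (j, R') \<Longrightarrow> wins Ms e k j R' \<Longrightarrow> wins Ms e k i R"
  unfolding wins_def by (meson converse_rtranclp_into_rtranclp)

text \<open>The algebra of \<open>recognisable\<close> is written into tables. Abstract transitions
  are the images of concrete ones, so every closure condition lifts from representatives; safety
  holds because winning depends on the value alone.\<close>

theorem certified_if_safe:
  assumes Ed2: "Ed2 P" "\<forall>Q\<in>set Ms. Ed2 Q" and k: "1 \<le> k" and safe: "\<not> wins Ms e k 0 P"
  shows "certified (P, Ms, e, k)"
proof -
  define S where "S = (\<Union>R\<in>insert P (set Ms). {Q. part\<^sup>*\<^sup>* R Q})"
  have finS: "finite S" unfolding S_def by (intro finite_UN_I) (simp_all add: finite_part_closure)
  have S_part: "R \<in> S" if "Q \<in> S" "part Q R" for Q R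
    using that unfolding S_def by (auto intro: rtranclp.rtrancl_into_rtrancl)
  have S_init: "P \<in> S" "Q \<in> set Ms \<Longrightarrow> Q \<in> S" for Q unfolding S_def by auto
  have "Ed2_pat Q" if "part\<^sup>*\<^sup>* R Q" "Ed2_pat R" for R Q
    using that by (induction rule: rtranclp_induct) (simp_all add: Ed2_pat_part)
  then have S_pat: "Ed2_pat Q" if "Q \<in> S" for Q
    using that Ed2 unfolding S_def by (auto intro: Ed2_Ed2_pat_Ed2_pref.intros(7))
  \<comment> \<open>Leaves are sums and replications only. A \<open>Hole\<close> in \<open>S\<close>
    is excluded, since values are assigned to terms whose holes have been filled.\<close>
  define L where "L = {Q \<in> S. (\<exists>bs. Q = Sum bs) \<or> (\<exists>p R. Q = Repl p R)}"
  define N where "N = (\<Union>Q\<in>S. top_names Q)"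
  define LS where "LS = insert Tau (act_labels e) \<union> (\<Union>Q\<in>S. top_labels Q)"
  have fin: "finite L" "finite N" "finite LS"
    using finS finite_top finite_act_labels by (simp_all add: L_def N_def LS_def)
  obtain Sub where Sub: "set Sub = S" using finite_list[OF finS] by blast
  obtain Ns where Ns: "set Ns = N" using finite_list[OF fin(2)] by blast
  obtain Ls where Ls: "set Ls = LS" using finite_list[OF fin(3)] by blast
  have N_Loc: "a \<in> N" if "Loc a Q \<in> S" for a Q using that unfolding N_def by force
  have over_Ed2: "over L N Q" if "Ed2 Q" "Q \<in> S" for Q
    using that
  proof (induction Q rule: proc_top_induct)
    case (Loc a Q)
    then show ?case using S_part[OF Loc.prems(2) part.intros(1)] N_Loc by simp
  next
    case (Par Q R)
    then show ?case using S_part[OF Par.prems(2) part.intros(2)] S_part[OF Par.prems(2) part.intros(3)] by simp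
  qed (simp_all add: L_def)
  have over_pfill: "over L N (pfill R Q)" if "Q \<in> S" "over L N R" for Q R
    using that
  proof (induction Q rule: proc_top_induct)
    case (Loc a Q)
    then show ?case using S_part[OF Loc.prems(1) part.intros(1)] N_Loc by simp
  next
    case (Par Q R)
    then show ?case using S_part[OF Par.prems(1) part.intros(2)] S_part[OF Par.prems(1) part.intros(3)] by simp
  next
    case Star
    then show ?case using S_pat[of Star] by (simp add: Ed2_pat_simps)
  qed (simp_all add: L_def)
  have Sum_S: "Q \<in> S \<and> over L N Q \<and> Ed2 Q" if "Sum bs \<in> S" "(p, Q) \<in> set bs" for bs p Q
    using S_pat[OF that(1)] S_part[OF that(1) part.intros(4)[OF that(2)]] over_Ed2[of Q] that(2)
    by (auto simp: Ed2_pat_simps)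
  have Repl_S: "Q \<in> S \<and> over L N Q \<and> Ed2 Q" if "Repl p Q \<in> S" for p Q
    using S_pat[OF that] S_part[OF that part.intros(6)] over_Ed2[of Q] by (auto simp: Ed2_pat_simps)

  \<comment> \<open>Stages 0 to \<open>Suc k\<close> use up the indices for \<open>wins\<close>. The
    index after them holds one further upward closed set, the processes with barb \<open>e\<close>:
    an abstract barb must be shared by all processes of the same value.\<close>
  define X where "X i Q \<longleftrightarrow> (if i = Suc (Suc k) then \<exists>Q'. trn Q (LAct e) Q' else wins Ms e k i Q)" for i Q
  have X_up: "X i R" if "X i Q" "Q \<sqsubseteq> R" for i Q R
  proof (cases "i = Suc (Suc k)")
    case True
    then obtain Q' where "trn Q (LAct e) Q'" using \<open>X i Q\<close> unfolding X_def by auto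
    from le_simulation[OF \<open>Q \<sqsubseteq> R\<close> this] show ?thesis using True unfolding X_def by auto
  next
    case False
    then show ?thesis using that wins_mono unfolding X_def by simp
  qed
  obtain \<phi> :: "proc \<Rightarrow> nat" and n :: nat where n: "\<phi> ` {P. over L N P} = {..<n}"
    and \<phi>_Loc: "\<forall>P P' a. over L N P \<longrightarrow> over L N P' \<longrightarrow> \<phi> P = \<phi> P' \<longrightarrow> \<phi> (Loc a P) = \<phi> (Loc a P')"
    and \<phi>_Par: "\<forall>P P' Q Q'. over L N P \<longrightarrow> over L N P' \<longrightarrow> over L N Q \<longrightarrow> over L N Q' \<longrightarrow>
      \<phi> P = \<phi> P' \<longrightarrow> \<phi> Q = \<phi> Q' \<longrightarrow> \<phi> (Par P Q) = \<phi> (Par P' Q')"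
    and \<phi>_X: "\<forall>i\<in>{..Suc (Suc k)}. \<forall>P P'. over L N P \<longrightarrow> over L N P' \<longrightarrow> \<phi> P = \<phi> P' \<longrightarrow> X i P \<longrightarrow> X i P'"
    by (rule exE[OF recognisable[where X = X, OF fin(1,2) finite_atMost[of "Suc (Suc k)"]]],
      erule X_up, assumption, elim exE conjE)
  note \<phi>_Loc = \<phi>_Loc[rule_format] and \<phi>_Par = \<phi>_Par[rule_format] and \<phi>_X = \<phi>_X[rule_format]
  have \<phi>_less: "\<phi> Q < n" if "over L N Q" for Q
  proof -
    have "\<phi> Q \<in> \<phi> ` {P. over L N P}" using that by simp
    then show ?thesis unfolding n by simp
  qed
  have nE: "\<exists>Q. over L N Q \<and> \<phi> Q = x" if "x < n" for x
  proof -
    have "x \<in> \<phi> ` {P. over L N P}" unfolding n using that by simp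
    then show ?thesis by auto
  qed
  \<comment> \<open>Tables are filled by computing with representatives; congruence of
    \<open>\<phi>\<close> makes the entries independent of this choice, as recorded in
    \<open>par\<close>, \<open>loc\<close> and \<open>v\<close>.\<close>
  define rep where "rep x = (SOME Q. over L N Q \<and> \<phi> Q = x)" for x
  have rep: "over L N (rep x)" "\<phi> (rep x) = x" if "x < n" for x
    using someI_ex[OF nE[OF that]] unfolding rep_def by simp_all
  have \<phi>_pfill: "\<phi> (pfill R U) = \<phi> (pfill R' U)"
    if "U \<in> S" "over L N R" "over L N R'" "\<phi> R = \<phi> R'" for R R' U
    using that(1)
  proof (induction U rule: proc_top_induct)
    case (Loc a U)
    then have "U \<in> S" using S_part[OF Loc.prems(1) part.intros(1)] by simp
    then show ?case using \<phi>_Loc[OF over_pfill over_pfill Loc.IH] that(2-) by simp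
  next
    case (Par U V)
    then have "U \<in> S" "V \<in> S"
      using S_part[OF Par.prems(1) part.intros(2)] S_part[OF Par.prems(1) part.intros(3)] by simp_all
    then show ?case using \<phi>_Par[OF over_pfill over_pfill over_pfill over_pfill Par.IH(1) Par.IH(2)] that(2-) by simp
  qed (use that in simp_all)

  obtain tp where tp: "\<forall>z\<in>{..<n} \<times> {..<n}. lookup tp z = \<phi> (Par (rep (fst z)) (rep (snd z)))"
    using lookup_exists[of "{..<n} \<times> {..<n}" "\<lambda>z. \<phi> (Par (rep (fst z)) (rep (snd z)))"] by auto
  obtain tl where tl: "\<forall>z\<in>N \<times> {..<n}. lookup tl z = \<phi> (Loc (fst z) (rep (snd z)))"
    using lookup_exists[of "N \<times> {..<n}" "\<lambda>z. \<phi> (Loc (fst z) (rep (snd z)))"] fin(2) by auto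
  obtain tv where tv: "\<forall>z\<in>{..<n} \<times> S. lookup tv z = \<phi> (pfill (rep (fst z)) (snd z))"
    using lookup_exists[of "{..<n} \<times> S" "\<lambda>z. \<phi> (pfill (rep (fst z)) (snd z))"] finS by auto
  define T where "T l x y \<longleftrightarrow> (\<exists>Q Q'. over L N Q \<and> over L N Q' \<and> \<phi> Q = x \<and> \<phi> Q' = y \<and> trn Q l Q')" for l x y
  obtain tT where tT: "\<forall>z\<in>LS \<times> {..<n} \<times> {..<n}. lookup tT z = of_bool (T (fst z) (fst (snd z)) (snd (snd z)))"
    using lookup_exists[of "LS \<times> {..<n} \<times> {..<n}" "\<lambda>z. of_bool (T (fst z) (fst (snd z)) (snd (snd z)))"]
      fin(3) by auto
  \<comment> \<open>Values of all processes that cannot win, reachable or not. This overapproximates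
    reachability, is closed under abstract steps, and depends on values only.\<close>
  define G where "G i x \<longleftrightarrow> (\<exists>Q. over L N Q \<and> \<phi> Q = x \<and> \<not> wins Ms e k i Q)" for i x
  obtain tG where tG: "\<forall>z\<in>{..Suc k} \<times> {..<n}. lookup tG z = of_bool (G (fst z) (snd z))"
    using lookup_exists[of "{..Suc k} \<times> {..<n}" "\<lambda>z. of_bool (G (fst z) (snd z))"] by auto
  have par: "lookup tp (\<phi> Q, \<phi> R) = \<phi> (Par Q R)" if QR: "over L N Q" "over L N R" for Q R
  proof -
    note q = \<phi>_less[OF QR(1)] and r = \<phi>_less[OF QR(2)]
    have "lookup tp (\<phi> Q, \<phi> R) = \<phi> (Par (rep (\<phi> Q)) (rep (\<phi> R)))" using tp q r by simp
    also have "\<dots> = \<phi> (Par Q R)" by (rule \<phi>_Par) (simp_all add: QR q r rep)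
    finally show ?thesis .
  qed
  have loc: "lookup tl (a, \<phi> Q) = \<phi> (Loc a Q)" if Q: "over L N Q" "a \<in> N" for a Q
  proof -
    have "lookup tl (a, \<phi> Q) = \<phi> (Loc a (rep (\<phi> Q)))" using tl \<phi>_less[OF Q(1)] Q(2) by simp
    also have "\<dots> = \<phi> (Loc a Q)" by (rule \<phi>_Loc) (simp_all add: Q \<phi>_less rep)
    finally show ?thesis .
  qed
  have v: "lookup tv (\<phi> R, U) = \<phi> (pfill R U)" if R: "over L N R" "U \<in> S" for R U
  proof -
    have "lookup tv (\<phi> R, U) = \<phi> (pfill (rep (\<phi> R)) U)" using tv \<phi>_less[OF R(1)] R(2) by simp
    also have "\<dots> = \<phi> (pfill R U)" by (rule \<phi>_pfill) (simp_all add: R \<phi>_less rep)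
    finally show ?thesis .
  qed
  have T_iff: "lookup tT (l, x, y) = 1 \<longleftrightarrow> T l x y" if "l \<in> LS" "x < n" "y < n" for l x y
    using tT that by simp
  have G_iff: "lookup tG (i, \<phi> Q) = 1 \<longleftrightarrow> \<not> wins Ms e k i Q" if i: "i \<le> Suc k" and Q: "over L N Q" for i Q
  proof -
    have "lookup tG (i, \<phi> Q) = 1 \<longleftrightarrow> G i (\<phi> Q)" using tG i \<phi>_less[OF Q] by simp
    also have "\<dots> \<longleftrightarrow> \<not> wins Ms e k i Q"
    proof
      assume "G i (\<phi> Q)"
      then obtain R where R: "over L N R" "\<phi> R = \<phi> Q" "\<not> wins Ms e k i R" unfolding G_def by (elim exE conjE)
      have "X i Q \<Longrightarrow> X i R" by (rule \<phi>_X[of i Q R]) (use i Q R in simp_all)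
      then show "\<not> wins Ms e k i Q" using R(3) i unfolding X_def by auto
    next
      assume "\<not> wins Ms e k i Q"
      with Q show "G i (\<phi> Q)" unfolding G_def by blast
    qed
    finally show ?thesis .
  qed
  have T_I: "lookup tT (l, \<phi> Q, \<phi> Q') = 1" if "trn Q l Q'" "l \<in> LS" and o: "over L N Q" "over L N Q'" for l Q Q'
  proof -
    have "T l (\<phi> Q) (\<phi> Q')" unfolding T_def using that by blast
    then show ?thesis using T_iff[OF that(2) \<phi>_less[OF o(1)] \<phi>_less[OF o(2)]] by simp
  qed
  have T_E: "\<exists>Q Q'. over L N Q \<and> over L N Q' \<and> \<phi> Q = x \<and> \<phi> Q' = y \<and> trn Q l Q'"
    if "lookup tT (l, x, y) = 1" "l \<in> LS" "x < n" "y < n" for l x y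
    using T_iff[OF that(2-)] that(1) unfolding T_def by simp
  have n0: "0 < n" using \<phi>_less[OF over_Ed2[OF Ed2(1) S_init(1)]] by simp
  have v0: "lookup tv (0::nat, Q) = \<phi> (pfill (rep 0) Q)" if "Q \<in> S" for Q
    using v[OF rep(1)[OF n0] that] rep(2)[OF n0] by simp
  have v0_Ed2: "lookup tv (0::nat, Q) = \<phi> Q" if "Q \<in> S" "Ed2 Q" for Q
    using v0[OF that(1)] Ed2_fill(1)[OF that(2)] by simp
  have labels: "pref_label p \<in> LS" "p = Upd a U \<Longrightarrow> LLoc a U \<in> LS \<and> U \<in> S \<and> a \<in> N"
    if "Sum bs \<in> S \<and> (p, Q) \<in> set bs \<or> Repl p Q \<in> S" for bs p Q a U
  proof -
    show "pref_label p \<in> LS" using that pref_label_in[of p] unfolding LS_def by force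
    show "LLoc a U \<in> LS \<and> U \<in> S \<and> a \<in> N" if "p = Upd a U"
    proof (intro conjI)
      show "LLoc a U \<in> LS" "a \<in> N" using \<open>_ \<or> _\<close> that unfolding LS_def N_def by force+
      show "U \<in> S" using \<open>_ \<or> _\<close> that S_part part.intros(5,7) by blast
    qed
  qed
  have LS_cases: "(\<exists>a U. l = LUpd a U \<and> U \<in> S \<and> LLoc a U \<in> LS \<and> a \<in> N) \<or> (\<exists>c. l = LAct c) \<or> (\<exists>a U. l = LLoc a U) \<or> l = Tau"
    if "l \<in> LS" for l
  proof (cases "l = Tau \<or> l \<in> act_labels e")
    case True
    then show ?thesis using act_labels_LAct by blast
  next
    case False
    then obtain Q where Q: "Q \<in> S" "l \<in> top_labels Q" using \<open>l \<in> LS\<close> unfolding LS_def by auto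
    then obtain p bs R where p: "l \<in> pref_labels p" "Sum bs \<in> S \<and> (p, R) \<in> set bs \<or> Repl p R \<in> S"
    proof (cases Q)
      case (Sum cs)
      then obtain b where "b \<in> set cs" "l \<in> pref_labels (fst b)" using Q(2) by auto
      then show ?thesis using that[of "fst b" cs "snd b"] Q(1) Sum by simp
    next
      case (Repl p R)
      then show ?thesis using that[of p _ R] Q by simp
    qed (use Q(2) in simp_all)
    show ?thesis using p(1) labels(2)[OF p(2)] act_labels_LAct by (cases p) auto
  qed
  have LS_co: "m \<in> LS" if lm: "l \<in> LS" "co l m" for l m
  proof (cases "l \<in> act_labels e")
    case True
    then show ?thesis using co_act_labels[OF True lm(2)] by (simp add: LS_def)
  next
    case False
    moreover have "l \<noteq> Tau" using lm(2) by (auto simp: co.simps)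
    ultimately obtain Q where Q: "Q \<in> S" "l \<in> top_labels Q" using lm(1) unfolding LS_def by auto
    have "m \<in> top_labels Q" using Q(2) co_pref_labels[OF _ lm(2)] by (cases Q) auto
    then show ?thesis using Q(1) unfolding LS_def by blast
  qed
  have "abstraction n (\<lambda>x y. lookup tp (x, y)) (\<lambda>a x. lookup tl (a, x)) (\<lambda>h U. lookup tv (h, U))
     (\<lambda>l x y. lookup tT (l, x, y) = 1) (\<lambda>i x. lookup tG (i, x) = 1) Sub Ns Ls P Ms e k"
    (is "abstraction _ ?par ?loc ?v ?T ?G _ _ _ _ _ _ _")
  proof (rule abstraction.intro, unfold Sub Ns Ls)
    show "0 < n" by (rule n0)
    show "\<forall>x<n. \<forall>y<n. ?par x y < n"
    proof (intro allI impI)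
      fix x y assume "x < n" "y < n"
      obtain Q where "over L N Q" "\<phi> Q = x" using nE[OF \<open>x < n\<close>] by (elim exE conjE)
      moreover obtain R where "over L N R" "\<phi> R = y" using nE[OF \<open>y < n\<close>] by (elim exE conjE)
      ultimately show "?par x y < n" using par[of Q R] \<phi>_less[of "Par Q R"] by simp
    qed
    show "\<forall>a\<in>N. \<forall>x<n. ?loc a x < n"
    proof (intro ballI allI impI)
      fix a x assume a: "a \<in> N" and "x < n"
      from nE[OF \<open>x < n\<close>] obtain Q where "over L N Q" "\<phi> Q = x" by (elim exE conjE)
      then show "?loc a x < n" using loc[of Q a] a \<phi>_less[of "Loc a Q"] by simp
    qed
    show "\<forall>U\<in>S. \<forall>h<n. ?v h U < n \<and>
      ((\<exists>a V. U = Loc a V \<and> a \<in> N \<and> V \<in> S \<and> ?v h U = ?loc a (?v h V)) \<or>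
       (\<exists>V W. U = Par V W \<and> V \<in> S \<and> W \<in> S \<and> ?v h U = ?par (?v h V) (?v h W)) \<or>
       (\<exists>bs. U = Sum bs \<and> ?v h U = ?v 0 U) \<or>
       (\<exists>p V. U = Repl p V \<and> ?v h U = ?v 0 U) \<or>
       (U = Hole \<and> ?v h U = h))"
    proof (intro ballI allI impI)
      fix U h assume U: "U \<in> S" and "h < n"
      from nE[OF \<open>h < n\<close>] obtain R where R: "over L N R" "\<phi> R = h" by (elim exE conjE)
      have vh: "?v h V = \<phi> (pfill R V)" if "V \<in> S" for V using v[OF R(1) that] R(2) by simp
      have less: "?v h U < n" using vh[OF U] \<phi>_less[OF over_pfill[OF U R(1)]] by simp
      show "?v h U < n \<and>
        ((\<exists>a V. U = Loc a V \<and> a \<in> N \<and> V \<in> S \<and> ?v h U = ?loc a (?v h V)) \<or>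
         (\<exists>V W. U = Par V W \<and> V \<in> S \<and> W \<in> S \<and> ?v h U = ?par (?v h V) (?v h W)) \<or>
         (\<exists>bs. U = Sum bs \<and> ?v h U = ?v 0 U) \<or>
         (\<exists>p V. U = Repl p V \<and> ?v h U = ?v 0 U) \<or>
         (U = Hole \<and> ?v h U = h))"
      proof (cases U)
        case (Loc a V)
        then have "V \<in> S" "a \<in> N" using U S_part[of U V] part.intros(1) N_Loc by simp_all
        then show ?thesis using Loc less vh[of U] vh[of V] U loc[of "pfill R V" a] over_pfill[of V R] R(1) by simp
      next
        case (Par V W)
        then have "V \<in> S" "W \<in> S" using U S_part[of U] part.intros(2,3) by simp_all
        then show ?thesis
          using Par less vh[of U] vh[of V] vh[of W] U par[of "pfill R V" "pfill R W"] over_pfill[of V R]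
            over_pfill[of W R] R(1) by simp
      next
        case (Sum bs)
        then show ?thesis using less vh[OF U] v0[OF U] by simp
      next
        case (Repl p V)
        then show ?thesis using less vh[OF U] v0[OF U] by simp
      next
        case Hole
        then show ?thesis using less vh[OF U] R(2) by simp
      next
        case Star
        then show ?thesis using S_pat[OF U] by (simp add: Ed2_pat_simps)
      qed
    qed
    show "\<forall>U\<in>S. (\<exists>bs. U = Sum bs \<and> (\<forall>b\<in>set bs. snd b \<in> S \<and>
        (\<exists>l. pref_label (fst b) = l \<and> l \<in> LS \<and> ?T l (?v 0 U) (?v 0 (snd b))))) \<or>
      (\<exists>a V. U = Loc a V) \<or> (\<exists>V W. U = Par V W) \<or> (\<exists>p V. U = Repl p V) \<or> U = Hole"
    proof
      fix U assume U: "U \<in> S"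
      have "snd b \<in> S \<and> (\<exists>l. pref_label (fst b) = l \<and> l \<in> LS \<and> ?T l (?v 0 (Sum bs)) (?v 0 (snd b)))"
        if bs: "Sum bs \<in> S" "b \<in> set bs" for bs b
      proof -
        obtain p Q where b: "b = (p, Q)" by (cases b)
        have Q: "Q \<in> S \<and> over L N Q \<and> Ed2 Q" using Sum_S[OF bs(1)] bs(2) b by simp
        have l: "pref_label p \<in> LS" using labels(1)[of bs p Q] bs b by simp
        have "?T (pref_label p) (\<phi> (Sum bs)) (\<phi> Q)"
          using T_I[OF trn_sum l, of Q bs] bs Q b by (simp add: L_def)
        then show ?thesis using Q l b v0_Ed2[of Q] v0[OF bs(1)] by simp
      qed
      then show "(\<exists>bs. U = Sum bs \<and> (\<forall>b\<in>set bs. snd b \<in> S \<and>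
          (\<exists>l. pref_label (fst b) = l \<and> l \<in> LS \<and> ?T l (?v 0 U) (?v 0 (snd b))))) \<or>
        (\<exists>a V. U = Loc a V) \<or> (\<exists>V W. U = Par V W) \<or> (\<exists>p V. U = Repl p V) \<or> U = Hole"
        using U S_pat[OF U] by (cases U) (simp_all add: Ed2_pat_simps)
    qed
    show "\<forall>U\<in>S. (\<exists>p V. U = Repl p V \<and> V \<in> S \<and>
        (\<exists>l. pref_label p = l \<and> l \<in> LS \<and> ?T l (?v 0 U) (?par (?v 0 V) (?v 0 U)))) \<or>
      (\<exists>a V. U = Loc a V) \<or> (\<exists>V W. U = Par V W) \<or> (\<exists>bs. U = Sum bs) \<or> U = Hole"
    proof
      fix U assume U: "U \<in> S"
      have "V \<in> S \<and> (\<exists>l. pref_label p = l \<and> l \<in> LS \<and> ?T l (?v 0 (Repl p V)) (?par (?v 0 V) (?v 0 (Repl p V))))"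
        if R: "Repl p V \<in> S" for p V
      proof -
        have V: "V \<in> S \<and> over L N V \<and> Ed2 V" using Repl_S[OF R] .
        have l: "pref_label p \<in> LS" using labels(1)[of _ p V] R by blast
        have o: "over L N (Repl p V)" using R by (simp add: L_def)
        have "?T (pref_label p) (\<phi> (Repl p V)) (\<phi> (Par V (Repl p V)))"
          using T_I[OF trn_repl l, of V] V o by simp
        then show ?thesis using V l o v0_Ed2[of V] v0[OF R] par[of V "Repl p V"] by simp
      qed
      then show "(\<exists>p V. U = Repl p V \<and> V \<in> S \<and>
          (\<exists>l. pref_label p = l \<and> l \<in> LS \<and> ?T l (?v 0 U) (?par (?v 0 V) (?v 0 U)))) \<or>
        (\<exists>a V. U = Loc a V) \<or> (\<exists>V W. U = Par V W) \<or> (\<exists>bs. U = Sum bs) \<or> U = Hole"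
        using U S_pat[OF U] by (cases U) (simp_all add: Ed2_pat_simps)
    qed
    show "\<forall>l\<in>LS. \<forall>x<n. \<forall>y<n. ?T l x y \<longrightarrow>
      (\<forall>z<n. ?T l (?par x z) (?par y z) \<and> ?T l (?par z x) (?par z y)) \<and> (\<forall>a\<in>N. ?T l (?loc a x) (?loc a y))"
    proof (intro ballI allI impI)
      fix l x y assume l: "l \<in> LS" and xy: "x < n" "y < n" "?T l x y"
      obtain Q Q' where Q: "over L N Q" "over L N Q'" "\<phi> Q = x" "\<phi> Q' = y" "trn Q l Q'"
        using T_E[OF xy(3) l xy(1,2)] by (elim exE conjE)
      have "?T l (?par x z) (?par y z) \<and> ?T l (?par z x) (?par z y)" if "z < n" for z
      proof -
        obtain R where R: "over L N R" "\<phi> R = z" using nE[OF \<open>z < n\<close>] by (elim exE conjE)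
        show ?thesis
          using T_I[OF trn_par1[OF Q(5), of R] l] T_I[OF trn_par2[OF Q(5), of R] l] Q R
            par[of Q R] par[of Q' R] par[of R Q] par[of R Q'] by simp
      qed
      moreover have "?T l (?loc a x) (?loc a y)" if "a \<in> N" for a
        using T_I[OF trn_loc[OF Q(5), of a] l] Q loc[of Q a] loc[of Q' a] that by simp
      ultimately show "(\<forall>z<n. ?T l (?par x z) (?par y z) \<and> ?T l (?par z x) (?par z y)) \<and>
        (\<forall>a\<in>N. ?T l (?loc a x) (?loc a y))" by simp
    qed
    have Tau: "Tau \<in> LS" by (simp add: LS_def)
    show "\<forall>l\<in>LS. (\<exists>m. co l m \<and> (\<forall>x<n. \<forall>x'<n. \<forall>y<n. \<forall>y'<n. ?T l x x' \<longrightarrow> ?T m y y' \<longrightarrow>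
        ?T Tau (?par x y) (?par x' y') \<and> ?T Tau (?par y x) (?par y' x'))) \<or>
      (\<exists>a. l = LAct (Out a)) \<or> (\<exists>a U. l = LUpd a U) \<or> l = Tau"
    proof
      fix l assume l: "l \<in> LS"
      have "?T Tau (?par x y) (?par x' y') \<and> ?T Tau (?par y x) (?par y' x')"
        if m: "co l m" and xy: "x < n" "x' < n" "y < n" "y' < n" "?T l x x'" "?T m y y'" for m x x' y y'
      proof -
        obtain Q Q' where Q: "over L N Q" "over L N Q'" "\<phi> Q = x" "\<phi> Q' = x'" "trn Q l Q'"
          using T_E[OF xy(5) l xy(1,2)] by (elim exE conjE)
        obtain R R' where R: "over L N R" "over L N R'" "\<phi> R = y" "\<phi> R' = y'" "trn R m R'"
          using T_E[OF xy(6) LS_co[OF l m] xy(3,4)] by (elim exE conjE)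
        show ?thesis
          using T_I[OF trn_com1[OF Q(5) R(5) m] Tau] T_I[OF trn_com2[OF Q(5) R(5) m] Tau] Q R
            par[of Q R] par[of Q' R'] par[of R Q] par[of R' Q'] by simp
      qed
      moreover have "(\<exists>m. co l m) \<or> (\<exists>a. l = LAct (Out a)) \<or> (\<exists>a U. l = LUpd a U) \<or> l = Tau"
      proof (cases l)
        case (LAct c)
        then show ?thesis by (cases c) (auto simp: co.simps)
      qed (auto simp: co.simps)
      ultimately show "(\<exists>m. co l m \<and> (\<forall>x<n. \<forall>x'<n. \<forall>y<n. \<forall>y'<n. ?T l x x' \<longrightarrow> ?T m y y' \<longrightarrow>
          ?T Tau (?par x y) (?par x' y') \<and> ?T Tau (?par y x) (?par y' x'))) \<or>
        (\<exists>a. l = LAct (Out a)) \<or> (\<exists>a U. l = LUpd a U) \<or> l = Tau"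
        by (elim disjE exE) (rule disjI1, rule exI, intro conjI allI impI; assumption | blast)+
    qed
    show "\<forall>l\<in>LS. (\<exists>a U. l = LUpd a U \<and> U \<in> S \<and> LLoc a U \<in> LS \<and>
        (\<forall>z<n. ?T (LLoc a U) (?loc a z) (?v z U))) \<or>
      (\<exists>c. l = LAct c) \<or> (\<exists>a U. l = LLoc a U) \<or> l = Tau"
    proof
      fix l assume l: "l \<in> LS"
      have "?T (LLoc a U) (?loc a z) (?v z U)" if U: "U \<in> S" "LLoc a U \<in> LS" "a \<in> N" and "z < n" for a U z
      proof -
        obtain R where R: "over L N R" "\<phi> R = z" using nE[OF \<open>z < n\<close>] by (elim exE conjE)
        show ?thesis
          using T_I[OF trn_upd U(2), of R] over_pfill[OF U(1) R(1)] loc[OF R(1) U(3)] v[OF R(1) U(1)] U(3) R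
          by simp
      qed
      then show "(\<exists>a U. l = LUpd a U \<and> U \<in> S \<and> LLoc a U \<in> LS \<and>
          (\<forall>z<n. ?T (LLoc a U) (?loc a z) (?v z U))) \<or>
        (\<exists>c. l = LAct c) \<or> (\<exists>a U. l = LLoc a U) \<or> l = Tau"
        using LS_cases[OF l] by blast
    qed
    show "P \<in> S" "\<forall>Q\<in>set Ms. Q \<in> S" "Tau \<in> LS" "LAct e \<in> LS"
      using S_init by (simp_all add: LS_def LAct_act_labels)
    have P: "over L N P" by (rule over_Ed2[OF Ed2(1) S_init(1)])
    show "?G 0 (?v 0 P)" using G_iff[of 0 P] v0_Ed2[OF S_init(1) Ed2(1)] P safe by simp
    show "\<forall>x<n. ?G 0 x \<longrightarrow> (\<forall>Q\<in>set Ms. ?G 0 (?par x (?v 0 Q))) \<and> ?G 1 x"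
    proof (intro allI impI)
      fix x assume x: "x < n" "?G 0 x"
      obtain R where R: "over L N R" "\<phi> R = x" using nE[OF x(1)] by (elim exE conjE)
      have nw: "\<not> wins Ms e k 0 R" using G_iff[of 0 R] R x by simp
      have "?G 0 (?par x (?v 0 Q))" if "Q \<in> set Ms" for Q
      proof -
        have Q: "Q \<in> S" "Ed2 Q" "over L N Q" using S_init(2) Ed2(2) over_Ed2 that by simp_all
        have "\<not> wins Ms e k 0 (Par R Q)" using wins_step[OF stg_add[OF that]] nw by blast
        then show ?thesis using G_iff[of 0 "Par R Q"] R Q v0_Ed2[of Q] par[of R Q] by simp
      qed
      moreover have "?G 1 x" using wins_step[OF stg_run] nw G_iff[of 1 R] R by auto
      ultimately show "(\<forall>Q\<in>set Ms. ?G 0 (?par x (?v 0 Q))) \<and> ?G 1 x" by simp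
    qed
    have LAct: "LAct e \<in> LS" by (simp add: LS_def LAct_act_labels)
    show "\<forall>x<n. \<forall>y<n. ?G 1 x \<longrightarrow> (?T Tau x y \<longrightarrow> ?G 1 y) \<and> (?T (LAct e) x y \<longrightarrow> ?G 2 x)"
    proof (intro allI impI conjI)
      fix x y assume xy: "x < n" "y < n" and G: "?G 1 x"
      {
        assume "?T Tau x y"
        from T_E[OF this Tau xy] obtain Q Q'
          where Q: "over L N Q" "over L N Q'" "\<phi> Q = x" "\<phi> Q' = y" "trn Q Tau Q'" by (elim exE conjE)
        have "\<not> wins Ms e k 1 Q" using G_iff[of 1 Q] G Q by simp
        then have "\<not> wins Ms e k 1 Q'" using wins_step[OF stg_red[OF Q(5)]] by blast
        then show "?G 1 y" using G_iff[of 1 Q'] Q by simp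
      next
        assume "?T (LAct e) x y"
        from T_E[OF this LAct xy] obtain Q Q' where Q: "over L N Q" "\<phi> Q = x" "trn Q (LAct e) Q'"
          by (elim exE conjE)
        have "\<not> wins Ms e k 1 Q" using G_iff[of 1 Q] G Q by simp
        then have "\<not> wins Ms e k 2 Q" using wins_step[OF stg_barb[OF Q(3)]] by blast
        then show "?G 2 x" using G_iff[of 2 Q] Q k by simp
      }
    qed
    show "\<forall>i<Suc k. i < 2 \<or> (\<forall>x<n. \<forall>y<n. \<forall>z<n. ?G i x \<longrightarrow> ?T Tau x y \<longrightarrow> ?T (LAct e) y z \<longrightarrow> ?G (Suc i) y)"
    proof (intro allI impI)
      fix i assume i: "i < Suc k"
      have "?G (Suc i) y"
        if i2: "\<not> i < 2" and xyz: "x < n" "y < n" "z < n" and t: "?G i x" "?T Tau x y" "?T (LAct e) y z" for x y z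
      proof -
        obtain Q Q' where Q: "over L N Q" "over L N Q'" "\<phi> Q = x" "\<phi> Q' = y" "trn Q Tau Q'"
          using T_E[OF t(2) Tau xyz(1,2)] by (elim exE conjE)
        obtain R R' where R: "over L N R" "\<phi> R = y" "trn R (LAct e) R'"
          using T_E[OF t(3) LAct xyz(2,3)] by (elim exE conjE)
        \<comment> \<open>The abstract barb comes from some \<open>R\<close> with the value of
          \<open>Q'\<close>, not from \<open>Q'\<close> itself; the extra upward closed set
          transfers it.\<close>
        have "X (Suc (Suc k)) R" using R(3) unfolding X_def by auto
        then have "X (Suc (Suc k)) Q'" using \<phi>_X[of "Suc (Suc k)" R Q'] Q R by simp
        then obtain Q'' where "trn Q' (LAct e) Q''" unfolding X_def by auto
        then have "stg Ms e (i, Q) (Suc i, Q')" using stg_next[OF _ Q(5)] i2 by simp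
        moreover have "\<not> wins Ms e k i Q" using G_iff[of i Q] t(1) Q i by simp
        ultimately have "\<not> wins Ms e k (Suc i) Q'" using wins_step by blast
        then show ?thesis using G_iff[of "Suc i" Q'] Q i by simp
      qed
      then show "i < 2 \<or> (\<forall>x<n. \<forall>y<n. \<forall>z<n. ?G i x \<longrightarrow> ?T Tau x y \<longrightarrow> ?T (LAct e) y z \<longrightarrow> ?G (Suc i) y)"
        by blast
    qed
    show "\<forall>x<n. \<not> ?G (Suc k) x"
    proof (intro allI impI)
      fix x assume "x < n"
      from nE[OF \<open>x < n\<close>] obtain R where R: "over L N R" "\<phi> R = x" by (elim exE conjE)
      \<comment> \<open>Zero steps suffice, so at this stage every process wins and no value is
        left.\<close>
      have "wins Ms e k (Suc k) R" unfolding wins_def by blast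
      then show "\<not> ?G (Suc k) x" using G_iff[of "Suc k" R] R by simp
    qed
  qed
  then show ?thesis unfolding certified_def fst_conv snd_conv by blast
qed

section \<open>Combination of the two semidecision procedures\<close>

section \<open>Decidability\<close>

lemma inst_encode_eq_enc: "inst_encode x = enc x"
proof -
  obtain P Ms e k where x: "x = (P, Ms, e, k)" by (cases x)
  show ?thesis by (simp add: x enc_Pair enc_list_def enc_act_def enc_nat_def enc_proc_def[abs_def])
qed

text \<open>Complementarity is assumed on \<open>D\<close> alone, matching the freedom that
  \<open>decidable_on\<close> leaves on other numbers. Determinism of \<open>rec_eval\<close>
  excludes a second answer.\<close>

lemma decidable_onI:
  assumes "semidec A" "semidec B" and dec: "\<And>x. x \<in> D \<Longrightarrow> Q x \<longleftrightarrow> A x" "\<And>x. x \<in> D \<Longrightarrow> \<not> Q x \<longleftrightarrow> B x"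
  shows "decidable_on enc D Q"
proof -
  obtain M where M: "semidec_nat M" "\<And>x. A x \<longleftrightarrow> M (enc x)" using assms(1) unfolding semidec_def by blast
  obtain N where N: "semidec_nat N" "\<And>x. B x \<longleftrightarrow> N (enc x)" using assms(2) unfolding semidec_def by blast
  obtain r where r: "\<forall>n. M n \<noteq> N n \<longrightarrow> rec_eval r [n] (if M n then 1 else 0)"
    using decidable_nat[OF M(1) N(1)] by (rule exE)
  have "rec_eval r [enc x] (if Q x then 1 else 0)" if "x \<in> D" for x
    using spec[OF r, of "enc x"] dec(1)[OF that] dec(2)[OF that] M(2)[of x] N(2)[of x]
    by (cases "M (enc x)") simp_all
  then show ?thesis
    unfolding decidable_on_def using rec_eval_det by (intro exI[of _ r] ballI allI iffI) blast+
qed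

theorem theorem7p24:
  "decidable_on inst_encode Ed2_instances
     (\<lambda>(P, Ms, e, k). bounded_adaptation P (set Ms) e k)"
proof -
  have "decidable_on enc Ed2_instances (\<lambda>(P, Ms, e, k). bounded_adaptation P (set Ms) e k)"
  \<comment> \<open>Adaptation is the positive answer, so a certificate confirms it and a winning
    run refutes it.\<close>
  proof (rule decidable_onI[OF semidec_certified semidec_wins])
    fix x assume "x \<in> Ed2_instances"
    then obtain P Ms e k where x: "x = (P, Ms, e, k)" and Ed2: "Ed2 P" "\<forall>Q\<in>set Ms. Ed2 Q" and k: "1 \<le> k"
      unfolding Ed2_instances_def by auto
    have iff: "bounded_adaptation P (set Ms) e k \<longleftrightarrow> \<not> wins Ms e k 0 P"
      by (rule bounded_adaptation_iff[OF Ed2 k])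
    have "certified x \<Longrightarrow> \<not> wins Ms e k 0 P"
      unfolding certified_def x fst_conv snd_conv using abstraction.not_wins[OF _ k] by (elim exE)
    then show "(case x of (P, Ms, e, k) \<Rightarrow> bounded_adaptation P (set Ms) e k) \<longleftrightarrow> certified x"
      using certified_if_safe[OF Ed2 k] iff x by auto
    show "(\<not> (case x of (P, Ms, e, k) \<Rightarrow> bounded_adaptation P (set Ms) e k)) \<longleftrightarrow>
        wins (fst (snd x)) (fst (snd (snd x))) (snd (snd (snd x))) 0 (fst x)"
      using iff by (simp add: x)
  qed
  moreover have "inst_encode = enc" using inst_encode_eq_enc by (rule ext)
  ultimately show ?thesis by simp
qed

end
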